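(* Let $M$ be a smooth manifold and let $\mathcal{F}$ be a regular foliation of $M$ generated by $k$ independent global $1$-forms. The first obstruction class $C_{\mathcal{F}}\in\mathcal{H}^1_{\mathcal{F}}(M)$ vanishes if and only if one can choose generators $\alpha_1,\ldots,\alpha_k$ of $\mathcal{F}$ such that $\mu=\alpha_1\wedge\alpha_2\wedge\cdots\wedge\alpha_k$ is closed.
   Context: Generators of a foliation: a set of generators is a set of $1$-forms $\alpha_1,\ldots,\alpha_k$ globally defined on $M$, linearly independent at every point, satisfying $\mathrm{d}\alpha_i\wedge\mu=0$ for $i=1,\ldots,k$, where $\mu=\alpha_1\wedge\cdots\wedge\alpha_k$. They generate $\mathcal{F}$ if $\mathcal{F}$ is the codimension $k$ foliation whose tangent distribution is $\{X:\alpha_i(X)=0,\ i=1,\ldots,k\}$. Two sets of generators of the same $\mathcal{F}$ are related by $\tilde\alpha_i=\sum_j F_i^j\alpha_j$ for an invertible matrix $F$ of smooth functions on $M$. Foliated cohomology: let $\Lambda^s(M)$ be the space of smooth $s$-forms. Two forms $\beta,\rho\in\Lambda^s(M)$ are $\mathcal{F}$-equivalent if $(\beta-\rho)\wedge\mu=0$ (this does not depend on the generators); $\Lambda^s_{\mathcal{F}}(M)$ is the space of equivalence classes and $\pi:\Lambda^s(M)\to\Lambda^s_{\mathcal{F}}(M)$ the projection. The operator $\mathrm{d}_{\mathcal{F}}(\pi(\beta))=\pi(\mathrm{d}\beta)$ is well defined with $\mathrm{d}_{\mathcal{F}}\circ\mathrm{d}_{\mathcal{F}}=0$, and $\mathcal{H}^s_{\mathcal{F}}(M)$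 is its cohomology in degree $s$; $[\cdot]_{\mathcal{F}}$ denotes the cohomology class. First obstruction class: for generators $\alpha_1,\ldots,\alpha_k$ of $\mathcal{F}$ choose vector fields $X^1,\ldots,X^k$ on $M$ with $\alpha_i(X^j)=\delta_{ij}$ (they exist, e.g. using a Riemannian metric) and set $\delta=-\sum_{i=1}^k L_{X^i}\alpha_i$. Then $\pi(\delta)$ is $\mathrm{d}_{\mathcal{F}}$-closed and its class $C_{\mathcal{F}}=[\pi(\delta)]_{\mathcal{F}}\in\mathcal{H}^1_{\mathcal{F}}(M)$ is independent of the choice of dual vector fields and of generators of $\mathcal{F}$. *)

theory Defs
  imports "HOL-Analysis.Analysis" "HOL-Library.Function_Algebras"
begin

text \<open>
  Sums, differences, products and zero of real functions, vector fields and forms are the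
  pointwise ones of \<^theory>\<open>HOL-Library.Function_Algebras\<close>.
\<close>


section \<open>Smooth manifolds\<close>

text \<open>
  For an open set \<open>S\<close> of a finite-dimensional space, \<open>Ck_on n f S\<close> is the usual notion
  of class \<open>C\<^sup>n\<close> on \<open>S\<close>; it is only used for open sets.
\<close>

primrec Ck_on :: "nat \<Rightarrow> ('e::euclidean_space \<Rightarrow> 'f::real_normed_vector) \<Rightarrow> 'e set \<Rightarrow> bool" where
  "Ck_on 0 f S \<longleftrightarrow> continuous_on S f"
| "Ck_on (Suc n) f S \<longleftrightarrow>
     (\<forall>x\<in>S. f differentiable (at x)) \<and> (\<forall>v. Ck_on n (\<lambda>x. frechet_derivative f (at x) v) S)"

definition smooth_on :: "('e::euclidean_space \<Rightarrow> 'f::real_normed_vector) \<Rightarrow> 'e set \<Rightarrow> bool" where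
  "smooth_on f S \<longleftrightarrow> (\<forall>n. Ck_on n f S)"

type_synonym ('a, 'e) chart = "'a set \<times> ('a \<Rightarrow> 'e)"

definition is_chart :: "('a::topological_space, 'e::euclidean_space) chart \<Rightarrow> bool" where
  "is_chart = (\<lambda>(U, \<phi>). open U \<and> open (\<phi> ` U) \<and> homeomorphism U (\<phi> ` U) \<phi> (inv_into U \<phi>))"

definition compatible :: "('a, 'e::euclidean_space) chart \<Rightarrow> ('a, 'e) chart \<Rightarrow> bool" where
  "compatible = (\<lambda>(U, \<phi>) (V, \<psi>).
     smooth_on (\<psi> \<circ> inv_into U \<phi>) (\<phi> ` (U \<inter> V)) \<and> smooth_on (\<phi> \<circ> inv_into V \<psi>) (\<psi> ` (U \<inter> V)))"

text \<open>
  The manifold is the whole Hausdorff, second countable type \<open>'a\<close>; its dimension is that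
  of the model space \<open>'e\<close>. The atlas need not be maximal.
\<close>

definition smooth_manifold ::
    "('a::{t2_space, second_countable_topology}, 'e::euclidean_space) chart set \<Rightarrow> bool" where
  "smooth_manifold \<A> \<longleftrightarrow>
     (\<forall>c\<in>\<A>. is_chart c) \<and> (\<forall>c\<in>\<A>. \<forall>c'\<in>\<A>. compatible c c') \<and> (\<Union>(fst ` \<A>) = UNIV)"

definition smooth_charts ::
    "('a::topological_space, 'e::euclidean_space) chart set \<Rightarrow> ('a, 'e) chart set" where
  "smooth_charts \<A> = {c. is_chart c \<and> (\<forall>c'\<in>\<A>. compatible c c')}"

definition smooth_functions :: "('a, 'e::euclidean_space) chart set \<Rightarrow> ('a \<Rightarrow> real) set" where
  "smooth_functions \<A> = {f. \<forall>(U, \<phi>)\<in>\<A>. smooth_on (f \<circ> inv_into U \<phi>) (\<phi> ` U)}"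


section \<open>Tangent vectors and vector fields\<close>

text \<open>
  Tangent vectors and vector fields are derivations of the algebra of smooth functions. They are
  total functions in the logic, so they are normalised to be zero off that algebra; equality is
  then equality as derivations.
\<close>

definition tangent_space ::
    "('a, 'e::euclidean_space) chart set \<Rightarrow> 'a \<Rightarrow> (('a \<Rightarrow> real) \<Rightarrow> real) set" where
  "tangent_space \<A> p = {v.
     (\<forall>f\<in>smooth_functions \<A>. \<forall>g\<in>smooth_functions \<A>. v (f + g) = v f + v g) \<and>
     (\<forall>a. \<forall>f\<in>smooth_functions \<A>. v (\<lambda>q. a * f q) = a * v f) \<and>
     (\<forall>f\<in>smooth_functions \<A>. \<forall>g\<in>smooth_functions \<A>. v (f * g) = f p * v g + g p * v f) \<and>
     (\<forall>f. f \<notin> smooth_functions \<A> \<longrightarrow> v f = 0)}"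

type_synonym 'a vfield = "('a \<Rightarrow> real) \<Rightarrow> ('a \<Rightarrow> real)"

definition value_at :: "'a vfield \<Rightarrow> 'a \<Rightarrow> (('a \<Rightarrow> real) \<Rightarrow> real)" where
  "value_at X p = (\<lambda>f. X f p)"

definition vector_fields :: "('a, 'e::euclidean_space) chart set \<Rightarrow> 'a vfield set" where
  "vector_fields \<A> = {X.
     (\<forall>p. value_at X p \<in> tangent_space \<A> p) \<and>
     (\<forall>f\<in>smooth_functions \<A>. X f \<in> smooth_functions \<A>)}"

definition fun_smult :: "('a \<Rightarrow> real) \<Rightarrow> 'a vfield \<Rightarrow> 'a vfield" where
  "fun_smult f X = (\<lambda>g. f * X g)"

definition lie_bracket :: "'a vfield \<Rightarrow> 'a vfield \<Rightarrow> 'a vfield" where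
  "lie_bracket X Y = (\<lambda>f. X (Y f) - Y (X f))"


section \<open>Differential forms\<close>

text \<open>
  A smooth \<open>s\<close>-form is an alternating, \<open>C\<^sup>\<infinity>(M)\<close>-multilinear map taking \<open>s\<close> vector fields to a
  smooth function. The arguments are given as a list, and a form is normalised to be zero on
  lists that are not lists of \<open>s\<close> vector fields. The number \<open>\<omega> Xs p\<close> is the value of the form at
  \<open>p\<close> on the tangent vectors \<open>value_at (Xs ! i) p\<close>.
\<close>

type_synonym 'a form = "'a vfield list \<Rightarrow> 'a \<Rightarrow> real"

definition field_lists :: "('a, 'e::euclidean_space) chart set \<Rightarrow> nat \<Rightarrow> 'a vfield list set" where
  "field_lists \<A> s = {Xs. length Xs = s \<and> set Xs \<subseteq> vector_fields \<A>}"

definition forms :: "('a, 'e::euclidean_space) chart set \<Rightarrow> nat \<Rightarrow> 'a form set" where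
  "forms \<A> s = {\<omega>.
     (\<forall>Xs\<in>field_lists \<A> s. \<omega> Xs \<in> smooth_functions \<A>) \<and>
     (\<forall>Xs\<in>field_lists \<A> s. \<forall>i<s. \<forall>X\<in>vector_fields \<A>. \<forall>Y\<in>vector_fields \<A>.
        \<omega> (Xs[i := X + Y]) = \<omega> (Xs[i := X]) + \<omega> (Xs[i := Y])) \<and>
     (\<forall>Xs\<in>field_lists \<A> s. \<forall>i<s. \<forall>X\<in>vector_fields \<A>. \<forall>f\<in>smooth_functions \<A>.
        \<omega> (Xs[i := fun_smult f X]) = f * \<omega> (Xs[i := X])) \<and>
     (\<forall>Xs\<in>field_lists \<A> s. \<forall>i<s. \<forall>j<s. i \<noteq> j \<and> Xs ! i = Xs ! j \<longrightarrow> \<omega> Xs = 0) \<and>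
     (\<forall>Xs. Xs \<notin> field_lists \<A> s \<longrightarrow> \<omega> Xs = 0)}"

text \<open>
  Wedge product of an \<open>r\<close>-form and an \<open>s\<close>-form, normalised such that
  \<open>(\<alpha> \<and> \<beta>)(X, Y) = \<alpha>(X) \<beta>(Y) - \<alpha>(Y) \<beta>(X)\<close> for 1-forms. The exterior derivative below uses the
  matching normalisation \<open>d\<alpha>(X, Y) = X(\<alpha>(Y)) - Y(\<alpha>(X)) - \<alpha>([X, Y])\<close>.
\<close>

definition wedge :: "nat \<Rightarrow> nat \<Rightarrow> 'a form \<Rightarrow> 'a form \<Rightarrow> 'a form" where
  "wedge r s \<omega> \<eta> = (\<lambda>Xs p.
     if length Xs = r + s
     then (\<Sum>\<sigma> | \<sigma> permutes {..<r + s}. of_int (sign \<sigma>)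
             * \<omega> (map (\<lambda>i. Xs ! \<sigma> i) [0..<r]) p
             * \<eta> (map (\<lambda>i. Xs ! \<sigma> i) [r..<r + s]) p) / (fact r * fact s)
     else 0)"

definition ext_deriv :: "('a, 'e::euclidean_space) chart set \<Rightarrow> nat \<Rightarrow> 'a form \<Rightarrow> 'a form" where
  "ext_deriv \<A> s \<omega> = (\<lambda>Xs p.
     if Xs \<in> field_lists \<A> (Suc s)
     then (\<Sum>i\<le>s. (- 1) ^ i * (Xs ! i) (\<omega> (nths Xs (- {i}))) p)
        + (\<Sum>j\<le>s. \<Sum>i<j. (- 1) ^ (i + j)
             * \<omega> (lie_bracket (Xs ! i) (Xs ! j) # nths Xs (- {i, j})) p)
     else 0)"

definition lie_derivative ::
    "('a, 'e::euclidean_space) chart set \<Rightarrow> nat \<Rightarrow> 'a vfield \<Rightarrow> 'a form \<Rightarrow> 'a form" where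
  "lie_derivative \<A> s X \<omega> = (\<lambda>Ys p.
     if Ys \<in> field_lists \<A> s
     then X (\<omega> Ys) p - (\<Sum>i<s. \<omega> (Ys[i := lie_bracket X (Ys ! i)]) p)
     else 0)"

text \<open>\<open>\<alpha> 0 \<and> \<dots> \<and> \<alpha> (k - 1)\<close> for 1-forms; the empty product is the constant function 1.\<close>

primrec wedge_list :: "nat \<Rightarrow> (nat \<Rightarrow> 'a form) \<Rightarrow> 'a form" where
  "wedge_list 0 \<alpha> = (\<lambda>Xs p. if Xs = [] then 1 else 0)"
| "wedge_list (Suc k) \<alpha> = wedge k 1 (wedge_list k \<alpha>) (\<alpha> k)"


section \<open>Foliations and their generators\<close>

text \<open>
  A foliation of codimension \<open>k\<close> is given by a foliated atlas together with a set \<open>B\<close> of \<open>k\<close>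
  standard basis vectors of the model space, which single out the transverse coordinates: plaques
  are the sets on which the \<open>B\<close>-coordinates are constant, and changes of foliated charts locally
  have the form \<open>(x, y) \<mapsto> (h\<^sub>1(x, y), h\<^sub>2(y))\<close>, where \<open>y\<close> are the \<open>B\<close>-coordinates.
\<close>

type_synonym ('a, 'e) foliation_data = "('a, 'e) chart set \<times> 'e set"

definition foliation ::
    "('a::topological_space, 'e::euclidean_space) chart set \<Rightarrow> nat \<Rightarrow> ('a, 'e) foliation_data \<Rightarrow> bool"
  where
  "foliation \<A> k = (\<lambda>(\<C>, B).
     B \<subseteq> Basis \<and> card B = k \<and> \<C> \<subseteq> smooth_charts \<A> \<and> \<Union>(fst ` \<C>) = UNIV \<and>
     (\<forall>(U, \<phi>)\<in>\<C>. \<forall>(V, \<psi>)\<in>\<C>. \<forall>p\<in>U \<inter> V.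
        \<exists>W. open W \<and> p \<in> W \<and> W \<subseteq> U \<inter> V \<and>
          (\<forall>q\<in>W. \<forall>q'\<in>W. (\<forall>b\<in>B. \<phi> q \<bullet> b = \<phi> q' \<bullet> b) \<longrightarrow> (\<forall>b\<in>B. \<psi> q \<bullet> b = \<psi> q' \<bullet> b))))"

text \<open>
  The tangent space at \<open>p\<close> to the leaf through \<open>p\<close>: the tangent vectors that kill the transverse
  coordinates. As tangent vectors act on global functions only, a coordinate is replaced by any
  global smooth function that agrees with it near \<open>p\<close>.
\<close>

definition leaf_tangent_space ::
    "('a::topological_space, 'e::euclidean_space) chart set \<Rightarrow> ('a, 'e) foliation_data \<Rightarrow> 'a
      \<Rightarrow> (('a \<Rightarrow> real) \<Rightarrow> real) set" where
  "leaf_tangent_space \<A> = (\<lambda>(\<C>, B) p. {v \<in> tangent_space \<A> p.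
     \<forall>(U, \<phi>)\<in>\<C>. p \<in> U \<longrightarrow> (\<forall>b\<in>B. \<forall>f\<in>smooth_functions \<A>.
       (\<forall>\<^sub>F q in nhds p. f q = \<phi> q \<bullet> b) \<longrightarrow> v f = 0)})"

definition generators ::
    "('a, 'e::euclidean_space) chart set \<Rightarrow> nat \<Rightarrow> (nat \<Rightarrow> 'a form) \<Rightarrow> bool" where
  "generators \<A> k \<alpha> \<longleftrightarrow>
     (\<forall>i<k. \<alpha> i \<in> forms \<A> 1) \<and>
     (\<forall>p. \<forall>c :: nat \<Rightarrow> real.
        (\<forall>X\<in>vector_fields \<A>. (\<Sum>i<k. c i * \<alpha> i [X] p) = 0) \<longrightarrow> (\<forall>i<k. c i = 0)) \<and>
     (\<forall>i<k. wedge 2 k (ext_deriv \<A> 1 (\<alpha> i)) (wedge_list k \<alpha>) = 0)"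

text \<open>
  The last condition below says that the tangent space at \<open>p\<close> to the foliation is the common
  kernel of the forms at \<open>p\<close>, since every tangent vector at \<open>p\<close> is the value of a vector field.
\<close>

definition generates ::
    "('a::topological_space, 'e::euclidean_space) chart set \<Rightarrow> nat \<Rightarrow> (nat \<Rightarrow> 'a form)
      \<Rightarrow> ('a, 'e) foliation_data \<Rightarrow> bool" where
  "generates \<A> k \<alpha> \<F> \<longleftrightarrow>
     generators \<A> k \<alpha> \<and>
     (\<forall>p. \<forall>X\<in>vector_fields \<A>.
        value_at X p \<in> leaf_tangent_space \<A> \<F> p \<longleftrightarrow> (\<forall>i<k. \<alpha> i [X] p = 0))"


section \<open>Foliated cohomology\<close>

definition fol_equiv ::
    "('a::topological_space, 'e::euclidean_space) chart set \<Rightarrow> nat \<Rightarrow> ('a, 'e) foliation_data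
      \<Rightarrow> nat \<Rightarrow> 'a form rel" where
  "fol_equiv \<A> k \<F> s = {(\<beta>, \<rho>). \<beta> \<in> forms \<A> s \<and> \<rho> \<in> forms \<A> s \<and>
     (\<forall>\<alpha>. generates \<A> k \<alpha> \<F> \<longrightarrow> wedge s k (\<beta> - \<rho>) (wedge_list k \<alpha>) = 0)}"

definition fol_forms ::
    "('a::topological_space, 'e::euclidean_space) chart set \<Rightarrow> nat \<Rightarrow> ('a, 'e) foliation_data
      \<Rightarrow> nat \<Rightarrow> 'a form set set" where
  "fol_forms \<A> k \<F> s = forms \<A> s // fol_equiv \<A> k \<F> s"

definition fol_proj ::
    "('a::topological_space, 'e::euclidean_space) chart set \<Rightarrow> nat \<Rightarrow> ('a, 'e) foliation_data
      \<Rightarrow> nat \<Rightarrow> 'a form \<Rightarrow> 'a form set" where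
  "fol_proj \<A> k \<F> s \<beta> = fol_equiv \<A> k \<F> s `` {\<beta>}"

definition fol_diff ::
    "('a::topological_space, 'e::euclidean_space) chart set \<Rightarrow> nat \<Rightarrow> ('a, 'e) foliation_data
      \<Rightarrow> nat \<Rightarrow> 'a form set \<Rightarrow> 'a form set \<Rightarrow> 'a form set" where
  "fol_diff \<A> k \<F> s a b = (\<Union>\<beta>\<in>a. \<Union>\<rho>\<in>b. fol_proj \<A> k \<F> s (\<beta> - \<rho>))"

definition fol_deriv ::
    "('a::topological_space, 'e::euclidean_space) chart set \<Rightarrow> nat \<Rightarrow> ('a, 'e) foliation_data
      \<Rightarrow> nat \<Rightarrow> 'a form set \<Rightarrow> 'a form set" where
  "fol_deriv \<A> k \<F> s a = (\<Union>\<beta>\<in>a. fol_proj \<A> k \<F> (Suc s) (ext_deriv \<A> s \<beta>))"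

definition fol_cocycles ::
    "('a::topological_space, 'e::euclidean_space) chart set \<Rightarrow> nat \<Rightarrow> ('a, 'e) foliation_data
      \<Rightarrow> nat \<Rightarrow> 'a form set set" where
  "fol_cocycles \<A> k \<F> s =
     {a \<in> fol_forms \<A> k \<F> s. fol_deriv \<A> k \<F> s a = fol_proj \<A> k \<F> (Suc s) 0}"

primrec fol_coboundaries ::
    "('a::topological_space, 'e::euclidean_space) chart set \<Rightarrow> nat \<Rightarrow> ('a, 'e) foliation_data
      \<Rightarrow> nat \<Rightarrow> 'a form set set" where
  "fol_coboundaries \<A> k \<F> 0 = {fol_proj \<A> k \<F> 0 0}"
| "fol_coboundaries \<A> k \<F> (Suc s) = fol_deriv \<A> k \<F> s ` fol_forms \<A> k \<F> s"

definition cohomologous ::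
    "('a::topological_space, 'e::euclidean_space) chart set \<Rightarrow> nat \<Rightarrow> ('a, 'e) foliation_data
      \<Rightarrow> nat \<Rightarrow> 'a form set rel" where
  "cohomologous \<A> k \<F> s = {(a, b). a \<in> fol_cocycles \<A> k \<F> s \<and> b \<in> fol_cocycles \<A> k \<F> s \<and>
     fol_diff \<A> k \<F> s a b \<in> fol_coboundaries \<A> k \<F> s}"

definition fol_cohomology ::
    "('a::topological_space, 'e::euclidean_space) chart set \<Rightarrow> nat \<Rightarrow> ('a, 'e) foliation_data
      \<Rightarrow> nat \<Rightarrow> 'a form set set set" where
  "fol_cohomology \<A> k \<F> s = fol_cocycles \<A> k \<F> s // cohomologous \<A> k \<F> s"

definition cohomology_class ::
    "('a::topological_space, 'e::euclidean_space) chart set \<Rightarrow> nat \<Rightarrow> ('a, 'e) foliation_data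
      \<Rightarrow> nat \<Rightarrow> 'a form set \<Rightarrow> 'a form set set" where
  "cohomology_class \<A> k \<F> s a = cohomologous \<A> k \<F> s `` {a}"

definition fol_zero_class ::
    "('a::topological_space, 'e::euclidean_space) chart set \<Rightarrow> nat \<Rightarrow> ('a, 'e) foliation_data
      \<Rightarrow> nat \<Rightarrow> 'a form set set" where
  "fol_zero_class \<A> k \<F> s = cohomology_class \<A> k \<F> s (fol_proj \<A> k \<F> s 0)"


section \<open>The first obstruction class\<close>

definition dual_fields ::
    "('a, 'e::euclidean_space) chart set \<Rightarrow> nat \<Rightarrow> (nat \<Rightarrow> 'a form) \<Rightarrow> (nat \<Rightarrow> 'a vfield) \<Rightarrow> bool"
  where
  "dual_fields \<A> k \<alpha> X \<longleftrightarrow>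
     (\<forall>j<k. X j \<in> vector_fields \<A>) \<and>
     (\<forall>i<k. \<forall>j<k. \<forall>p. \<alpha> i [X j] p = (if i = j then 1 else 0))"

definition delta_form ::
    "('a, 'e::euclidean_space) chart set \<Rightarrow> nat \<Rightarrow> (nat \<Rightarrow> 'a form) \<Rightarrow> (nat \<Rightarrow> 'a vfield) \<Rightarrow> 'a form"
  where
  "delta_form \<A> k \<alpha> X = - (\<Sum>i<k. lie_derivative \<A> 1 (X i) (\<alpha> i))"

definition obstruction_class ::
    "('a::topological_space, 'e::euclidean_space) chart set \<Rightarrow> nat \<Rightarrow> ('a, 'e) foliation_data
      \<Rightarrow> 'a form set set" where
  "obstruction_class \<A> k \<F> = (THE C. C \<in> fol_cohomology \<A> k \<F> 1 \<and>
     (\<exists>\<alpha> X. generates \<A> k \<alpha> \<F> \<and> dual_fields \<A> k \<alpha> X \<and>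
        C = cohomology_class \<A> k \<F> 1 (fol_proj \<A> k \<F> 1 (delta_form \<A> k \<alpha> X))))"

end

theory Submission
  imports Defs
begin

text \<open>
  The proof compares both sides of the equivalence with one function on the fields tangent to the
  leaves. Let \<open>\<alpha>\<^sub>1, \<dots>, \<alpha>\<^sub>k\<close> be generators with dual fields \<open>X\<^sub>1, \<dots>, X\<^sub>k\<close>, let \<open>\<mu>\<close> be their wedge product, and put
  \<open>div(Z) = \<Sum>\<^sub>i \<alpha>\<^sub>i([X\<^sub>i, Z])\<close> for \<open>Z\<close> tangent to the leaves. A form represents zero in the foliated complex iff
  it vanishes on tangent fields (\<open>fol_equiv_iff\<close>), and \<open>\<delta>(Z) = div(Z)\<close> on these. So the obstruction class vanishes
  iff \<open>div(Z) = Z(f)\<close> for some smooth function \<open>f\<close> and all tangent \<open>Z\<close> (\<open>obstruction_zero_iff\<close>).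

  On the other hand, \<open>L\<^sub>Z \<mu> = div(Z) \<mu>\<close> for tangent \<open>Z\<close>, as a determinant changes by a trace (\<open>lie_mu\<close>). Since \<open>\<mu>\<close>
  is annihilated by contraction with \<open>Z\<close>, Cartan's formula gives \<open>d\<mu>(Z, \<dots>) = div(Z) \<mu>\<close>; a form of degree \<open>k + 1\<close>
  that vanishes as soon as one argument is tangent is zero, and hence \<open>\<mu>\<close> is closed iff \<open>div = 0\<close>
  (\<open>mu_closed_iff\<close>). This is one half of the theorem. For the other half, replacing \<open>\<alpha>\<^sub>1\<close> by \<open>e\<^sup>h \<alpha>\<^sub>1\<close> adds \<open>Z(h)\<close> to
  \<open>div(Z)\<close> (\<open>diverg_rescale\<close>), and \<open>h = -f\<close> makes the divergence vanish.

  The class has to be well defined first. It exists because dual fields do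
  (\<open>dual_fields_exist\<close>, a partition of unity argument) and because \<open>div\<close> is closed along the leaves, being up to sign the trace
  of the flat Bott connection on the normal bundle (\<open>diverg_closed\<close>). It is unique because for other generators of the
  same foliation \<open>\<mu>' = D \<mu>\<close> with a function \<open>D\<close> without zeros, and \<open>L\<^sub>Z \<mu>' = div'(Z) \<mu>'\<close> then shows that
  \<open>div' - div\<close> is the differential of \<open>ln |D|\<close> (\<open>diverg_change\<close>).

  Tangent vectors are derivations and forms are multilinear maps over the smooth functions, so most of
  the argument is algebra over that ring. Analysis enters in three places only: the smooth functions
  form a ring that is closed under composition with smooth functions of one variable; derivations obey
  the chain rule for the exponential (\<open>vf_exp\<close>); and cut-off functions exist. That \<open>d\<omega>\<close> is again a form, which the
  explicit formula for \<open>d\<close> hides, follows from Cartan's formula by induction on the degree (\<open>ext_form\<close>).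
\<close>

section \<open>Calculus of smooth real functions\<close>

lemma Ck_on_cong:
  fixes f g :: "'e::euclidean_space \<Rightarrow> 'f::real_normed_vector"
  assumes "open S" "Ck_on n f S" "\<And>x. x \<in> S \<Longrightarrow> f x = g x"
  shows "Ck_on n g S"
  using assms(2,3)
proof (induction n arbitrary: f g)
  case 0
  then show ?case by (metis Ck_on.simps(1) continuous_on_cong)
next
  case (Suc n)
  have D: "(g has_derivative frechet_derivative f (at x)) (at x)" if "x \<in> S" for x
  proof (rule has_derivative_transform_within_open)
    show "(f has_derivative frechet_derivative f (at x)) (at x)"
      using Suc.prems that by (auto simp: frechet_derivative_works)
  qed (use that assms(1) Suc.prems(2) in auto)
  have "Ck_on n (\<lambda>x. frechet_derivative g (at x) v) S" for v
    by (rule Suc.IH[of "\<lambda>x. frechet_derivative f (at x) v"])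
      (use Suc.prems frechet_derivative_at[OF D] in auto)
  then show ?case using D by (auto simp: differentiable_def)
qed

lemma Ck_on_SucI:
  fixes f :: "'e::euclidean_space \<Rightarrow> 'f::real_normed_vector"
  assumes "open S" and D: "\<And>x. x \<in> S \<Longrightarrow> (f has_derivative D x) (at x)"
    and "\<And>v. Ck_on n (\<lambda>x. D x v) S"
  shows "Ck_on (Suc n) f S"
proof -
  have "Ck_on n (\<lambda>x. frechet_derivative f (at x) v) S" for v
    by (rule Ck_on_cong[OF assms(1) assms(3)[of v]]) (simp add: frechet_derivative_at[OF D])
  then show ?thesis using D by (auto simp: differentiable_def)
qed

lemma Ck_on_SucD:
  "Ck_on (Suc n) f S \<Longrightarrow> Ck_on n f S"
proof (induction n arbitrary: f)
  case 0
  then show ?case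
    by (auto intro!: continuous_at_imp_continuous_on differentiable_imp_continuous_within)
next
  case (Suc n)
  show ?case unfolding Ck_on.simps(2)[of n]
    using Suc.IH Suc.prems by (metis Ck_on.simps(2))
qed

lemma Ck_on_derivative:
  assumes "Ck_on (Suc n) f S"
  shows "x \<in> S \<Longrightarrow> (f has_derivative frechet_derivative f (at x)) (at x)"
    and "Ck_on n (\<lambda>x. frechet_derivative f (at x) v) S"
  using assms by (auto simp: frechet_derivative_works)

lemma Ck_on_const: "Ck_on n (\<lambda>x. c) S"
  by (induction n arbitrary: c) auto

lemma Ck_on_subset: "Ck_on n f S \<Longrightarrow> T \<subseteq> S \<Longrightarrow> Ck_on n f T"
proof (induction n arbitrary: f)
  case 0
  then show ?case by (auto intro: continuous_on_subset)
qed auto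

text \<open>
  Smoothness of a function on a manifold is checked near each point, where it is given by different
  formulas.
\<close>

lemma Ck_on_local:
  assumes "\<And>x. x \<in> S \<Longrightarrow> \<exists>W. open W \<and> x \<in> W \<and> Ck_on n f W"
  shows "Ck_on n f S"
  using assms
proof (induction n arbitrary: f)
  case 0
  show ?case unfolding Ck_on.simps
  proof (rule continuous_at_imp_continuous_on, rule ballI)
    fix x assume "x \<in> S"
    then obtain W where "open W" "x \<in> W" "continuous_on W f" using 0 by auto
    then show "isCont f x" by (simp add: continuous_on_eq_continuous_at)
  qed
next
  case (Suc n)
  show ?case unfolding Ck_on.simps
    by (intro conjI ballI allI Suc.IH) (use Suc.prems in \<open>metis Ck_on.simps(2)\<close>)+
qed

lemma Ck_on_add:
  fixes f g :: "'e::euclidean_space \<Rightarrow> real"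
  assumes "open S"
  shows "Ck_on n f S \<Longrightarrow> Ck_on n g S \<Longrightarrow> Ck_on n (\<lambda>x. f x + g x) S"
proof (induction n arbitrary: f g)
  case 0
  then show ?case by (auto intro: continuous_on_add)
next
  case (Suc n)
  show ?case
    by (rule Ck_on_SucI[OF assms has_derivative_add[OF Ck_on_derivative(1)[OF Suc.prems(1)]
          Ck_on_derivative(1)[OF Suc.prems(2)]] Suc.IH])
      (auto intro: Ck_on_derivative(2) Suc.prems)
qed

lemma Ck_on_mult:
  fixes f g :: "'e::euclidean_space \<Rightarrow> real"
  assumes "open S"
  shows "Ck_on n f S \<Longrightarrow> Ck_on n g S \<Longrightarrow> Ck_on n (\<lambda>x. f x * g x) S"
proof (induction n arbitrary: f g)
  case 0
  then show ?case by (auto intro: continuous_on_mult)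
next
  case (Suc n)
  show ?case
    by (rule Ck_on_SucI[OF assms has_derivative_mult[OF Ck_on_derivative(1)[OF Suc.prems(1)]
          Ck_on_derivative(1)[OF Suc.prems(2)]] Ck_on_add[OF assms Suc.IH Suc.IH]])
      (auto intro: Ck_on_derivative(2) Suc.prems Ck_on_SucD)
qed

lemma Ck_on_real_SucI:
  fixes g :: "real \<Rightarrow> real"
  assumes "open S" "\<And>x. x \<in> S \<Longrightarrow> (g has_real_derivative g' x) (at x)" "Ck_on n g' S"
  shows "Ck_on (Suc n) g S"
proof (rule Ck_on_SucI[OF assms(1)])
  show "x \<in> S \<Longrightarrow> (g has_derivative (*) (g' x)) (at x)" for x
    using assms(2) by (simp add: has_field_derivative_def)
  show "Ck_on n (\<lambda>x. g' x * v) S" for v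
    by (intro Ck_on_mult assms Ck_on_const)
qed

lemma Ck_on_compose:
  fixes f :: "'e::euclidean_space \<Rightarrow> real" and g :: "real \<Rightarrow> real"
  assumes "open S"
  shows "Ck_on n f S \<Longrightarrow> Ck_on n g T \<Longrightarrow> f ` S \<subseteq> T \<Longrightarrow> Ck_on n (\<lambda>x. g (f x)) S"
proof (induction n arbitrary: f g)
  case 0
  then show ?case by (auto intro: continuous_on_compose2)
next
  case (Suc n)
  note f = Ck_on_derivative[OF Suc.prems(1)] and g = Ck_on_derivative[OF Suc.prems(2)]
  define g' where "g' x = frechet_derivative g (at x) 1" for x
  have g': "(g has_real_derivative g' y) (at y)" if "y \<in> T" for y
  proof -
    interpret linear "frechet_derivative g (at y)"
      using g(1)[OF that] by (rule has_derivative_linear)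
    have "frechet_derivative g (at y) v = g' y * v" for v
      using scaleR[of v 1] by (simp add: g'_def mult.commute)
    then have "frechet_derivative g (at y) = (*) (g' y)" by (rule ext)
    then show ?thesis using g(1)[OF that] by (simp add: has_field_derivative_def)
  qed
  show ?case
  proof (rule Ck_on_SucI[OF assms])
    show "((\<lambda>x. g (f x)) has_derivative
        (\<lambda>v. g' (f x) * frechet_derivative f (at x) v)) (at x)" if "x \<in> S" for x
      using has_derivative_compose[OF f(1)[OF that] g'[unfolded has_field_derivative_def]]
        Suc.prems(3) that by auto
    have "Ck_on n (\<lambda>x. g' (f x)) S"
      by (rule Suc.IH[OF Ck_on_SucD[OF Suc.prems(1)] _ Suc.prems(3)])
        (use g(2)[of 1] in \<open>simp add: g'_def[abs_def]\<close>)
    then show "Ck_on n (\<lambda>x. g' (f x) * frechet_derivative f (at x) v) S" for v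
      by (rule Ck_on_mult[OF assms _ f(2)])
  qed
qed

lemma Ck_on_exp: "Ck_on n (exp :: real \<Rightarrow> real) UNIV"
proof (induction n)
  case (Suc n)
  show ?case by (rule Ck_on_real_SucI[OF _ _ Suc]) (auto intro: DERIV_exp)
qed (auto intro: continuous_intros)

lemma Ck_on_inverse: "Ck_on n (inverse :: real \<Rightarrow> real) (- {0})"
proof (induction n)
  case 0
  show ?case by (auto intro!: continuous_intros)
next
  case (Suc n)
  show ?case
  proof (rule Ck_on_real_SucI)
    show "(inverse has_real_derivative (-1) * (inverse x * inverse x)) (at x)"
      if "x \<in> - {0}" for x :: real
      using that by (auto intro!: derivative_eq_intros)
    show "Ck_on n (\<lambda>x::real. - 1 * (inverse x * inverse x)) (- {0})"
      by (intro Ck_on_mult Ck_on_const Suc) auto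
  qed auto
qed

lemma Ck_on_ln: "Ck_on n (ln :: real \<Rightarrow> real) {0<..}"
proof (cases n)
  case 0
  then show ?thesis by (auto intro!: continuous_intros)
next
  case (Suc m)
  show ?thesis unfolding Suc
  proof (rule Ck_on_real_SucI)
    show "(ln has_real_derivative inverse x) (at x)" if "x \<in> {0<..}" for x :: real
      using that by (auto intro!: derivative_eq_intros simp: field_simps)
  qed (auto intro: Ck_on_subset[OF Ck_on_inverse])
qed

lemma Ck_on_power_series:
  fixes c :: "nat \<Rightarrow> real"
  assumes "\<And>x. summable (\<lambda>i. c i * x ^ i)"
  shows "Ck_on n (\<lambda>x. \<Sum>i. c i * x ^ i) UNIV"
  using assms
proof (induction n arbitrary: c)
  case 0
  show ?case using isCont_powser_converges_everywhere[OF 0]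
    by (auto intro: continuous_at_imp_continuous_on)
next
  case (Suc n)
  show ?case
    by (rule Ck_on_real_SucI[OF _ termdiffs_strong_converges_everywhere[OF Suc.prems] Suc.IH])
      (auto intro: termdiff_converges_all Suc.prems)
qed

text \<open>
  The second-order Taylor remainder of the exponential is a smooth multiple of \<open>x\<^sup>2\<close>. This is all
  that an abstract derivation needs in order to obey the chain rule for \<open>exp\<close>.
\<close>

lemma exp_second_order:
  obtains r :: "real \<Rightarrow> real" where "\<And>n. Ck_on n r UNIV" "\<And>x. exp x = 1 + x + x * x * r x"
proof
  define c :: "nat \<Rightarrow> real" where "c i = inverse (fact (i + 2))" for i
  have s: "(\<lambda>i. c i * x ^ (i + 2)) sums (exp x - (\<Sum>i<2. inverse (fact i) * x ^ i))" for x :: real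
    using sums_split_initial_segment[OF exp_converges[of x], of 2]
    by (simp add: c_def field_simps)
  have sm: "summable (\<lambda>i. c i * x ^ i)" for x
  proof (cases "x = 0")
    case False
    then show ?thesis
      using summable_mult[OF sums_summable[OF s[of x]], of "inverse (x^2)"]
      by (simp add: power_add field_simps)
  qed (auto intro: summable_finite[of "{0}"])
  show "Ck_on n (\<lambda>x. \<Sum>i. c i * x ^ i) UNIV" for n
    by (rule Ck_on_power_series[OF sm])
  show "exp x = 1 + x + x * x * (\<Sum>i. c i * x ^ i)" for x :: real
  proof -
    have "(\<lambda>i. c i * x ^ (i + 2)) sums (x * x * (\<Sum>i. c i * x ^ i))"
      using sums_mult[OF summable_sums[OF sm[of x]], of "x * x"]
      by (simp add: power_add power2_eq_square mult_ac)
    from sums_unique2[OF this s] show ?thesis by (simp add: numeral_2_eq_2)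
  qed
qed

text \<open>
  The index \<open>n\<close> makes the family closed under differentiation, so that smoothness of all its
  members follows by one induction. Cut-off functions are built from \<open>flat 0\<close>.
\<close>

definition flat :: "nat \<Rightarrow> real \<Rightarrow> real" where
  "flat n t = (if 0 < t then inverse t ^ n * exp (- inverse t) else 0)"

lemma flat_has_derivative:
  "(flat n has_real_derivative flat (n + 2) t - real n * flat (n + 1) t) (at t)"
proof -
  consider "t < 0" | "t = 0" | "0 < t" by linarith
  then show ?thesis
  proof cases
    case 1
    have "((\<lambda>_. 0) has_real_derivative flat (n + 2) t - real n * flat (n + 1) t) (at t)"
      using 1 by (simp add: flat_def)
    then show ?thesis
      by (rule has_field_derivative_transform_within_open[of _ _ _ "{..<0}"])
        (use 1 in \<open>auto simp: flat_def\<close>)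
  next
    case 3
    have u: "(inverse has_real_derivative - (inverse t * inverse t)) (at t)"
      using 3 by (auto intro!: derivative_eq_intros)
    have "((\<lambda>t. inverse t ^ n * exp (- inverse t)) has_real_derivative
        real n * (- (inverse t * inverse t) * inverse t ^ (n - Suc 0)) * exp (- inverse t)
          + exp (- inverse t) * - (- (inverse t * inverse t)) * inverse t ^ n) (at t)"
      by (rule DERIV_mult[OF DERIV_power[OF u] DERIV_fun_exp[OF DERIV_minus[OF u]]])
    also have "real n * (- (inverse t * inverse t) * inverse t ^ (n - Suc 0)) * exp (- inverse t)
          + exp (- inverse t) * - (- (inverse t * inverse t)) * inverse t ^ n
        = flat (n + 2) t - real n * flat (n + 1) t"
      using 3 by (cases n) (simp_all add: flat_def algebra_simps)
    finally have "((\<lambda>t. inverse t ^ n * exp (- inverse t)) has_real_derivative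
        flat (n + 2) t - real n * flat (n + 1) t) (at t)" .
    then show ?thesis
      by (rule has_field_derivative_transform_within_open[of _ _ _ "{0<..}"])
        (use 3 in \<open>auto simp: flat_def\<close>)
  next
    case 2
    have right: "((\<lambda>h. flat n h / h) \<longlongrightarrow> 0) (at_right 0)"
    proof (rule Lim_transform_eventually)
      show "((\<lambda>h::real. inverse h ^ Suc n / exp (inverse h)) \<longlongrightarrow> 0) (at_right 0)"
        by (rule filterlim_compose[OF tendsto_power_div_exp_0 filterlim_inverse_at_top_right])
      show "\<forall>\<^sub>F h in at_right 0. inverse h ^ Suc n / exp (inverse h) = flat n h / h"
        by (auto simp: eventually_at_filter flat_def exp_minus divide_inverse)
    qed
    have left: "((\<lambda>h. flat n h / h) \<longlongrightarrow> 0) (at_left 0)"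
      by (rule Lim_transform_eventually[OF tendsto_const])
        (auto simp: eventually_at_filter flat_def)
    have "((\<lambda>h. flat n h / h) \<longlongrightarrow> 0) (at 0)"
      by (rule filterlim_split_at[OF left right])
    moreover have "flat m 0 = 0" for m by (simp add: flat_def)
    ultimately show ?thesis unfolding DERIV_def 2 by simp
  qed
qed

lemma Ck_on_flat: "Ck_on m (flat n) UNIV"
proof (induction m arbitrary: n)
  case 0
  show ?case unfolding Ck_on.simps
    by (intro continuous_at_imp_continuous_on ballI DERIV_isCont[OF flat_has_derivative])
next
  case (Suc m)
  have "Ck_on m (\<lambda>t. flat (n + 2) t + (- real n) * flat (n + 1) t) UNIV"
    by (intro Ck_on_add Ck_on_mult Ck_on_const Suc open_UNIV)
  then show ?case
    by (intro Ck_on_real_SucI[OF open_UNIV flat_has_derivative]) (simp del: add_2_eq_Suc')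
qed


lemma flat_pos: "0 < t \<Longrightarrow> 0 < flat n t" and flat_zero: "t \<le> 0 \<Longrightarrow> flat n t = 0"
  by (simp_all add: flat_def)

lemma flat_nonneg: "0 \<le> flat n t"
  by (simp add: flat_def)


section \<open>The ring of smooth functions\<close>

lemma sum_fun_apply: "(\<Sum>i\<in>I. f i) x = (\<Sum>i\<in>I. f i x)"
  for f :: "'i \<Rightarrow> 'b \<Rightarrow> 'c::comm_monoid_add"
  by (induction I rule: infinite_finite_induct) auto

lemma prod_fun_apply: "(\<Prod>i\<in>I. f i) x = (\<Prod>i\<in>I. f i x)"
  for f :: "'i \<Rightarrow> 'b \<Rightarrow> 'c::comm_monoid_mult"
  by (induction I rule: infinite_finite_induct) auto

locale smooth_atlas =
  fixes \<A> :: "('a::{t2_space, second_countable_topology}, 'e::euclidean_space) chart set"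
  assumes manifold: "smooth_manifold \<A>"
begin

abbreviation "S \<equiv> smooth_functions \<A>"
abbreviation "V \<equiv> vector_fields \<A>"

lemma chart:
  assumes "(U, \<phi>) \<in> \<A>"
  shows "open U" "open (\<phi> ` U)" "homeomorphism U (\<phi> ` U) \<phi> (inv_into U \<phi>)"
  using assms manifold unfolding smooth_manifold_def is_chart_def by auto

lemma chart_at: obtains U \<phi> where "(U, \<phi>) \<in> \<A>" "p \<in> U"
  using manifold unfolding smooth_manifold_def by (metis UNIV_I UN_E prod.collapse)

lemma smooth_iff:
  "f \<in> S \<longleftrightarrow> (\<forall>U \<phi> n. (U, \<phi>) \<in> \<A> \<longrightarrow> Ck_on n (\<lambda>x. f (inv_into U \<phi> x)) (\<phi> ` U))"
  by (auto simp: smooth_functions_def smooth_on_def o_def)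

lemma smooth_const: "(\<lambda>_. c) \<in> S"
  by (simp add: smooth_iff Ck_on_const)

lemma smooth_zero: "0 \<in> S" and smooth_one: "1 \<in> S"
  using smooth_const by (auto simp: zero_fun_def one_fun_def)

lemma smooth_add: "f \<in> S \<Longrightarrow> g \<in> S \<Longrightarrow> f + g \<in> S"
  unfolding smooth_iff plus_fun_apply by (intro allI impI Ck_on_add) (simp_all add: chart(2))

lemma smooth_mult: "f \<in> S \<Longrightarrow> g \<in> S \<Longrightarrow> f * g \<in> S"
  unfolding smooth_iff times_fun_apply by (intro allI impI Ck_on_mult) (simp_all add: chart(2))

lemma smooth_cmult: "f \<in> S \<Longrightarrow> (\<lambda>q. a * f q) \<in> S"
  using smooth_mult[OF smooth_const] by (simp add: times_fun_def)

lemma smooth_uminus: "f \<in> S \<Longrightarrow> - f \<in> S"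
  using smooth_cmult[of f "-1"] by (simp add: fun_Compl_def)

lemma smooth_diff: "f \<in> S \<Longrightarrow> g \<in> S \<Longrightarrow> f - g \<in> S"
  using smooth_add[OF _ smooth_uminus] by simp

lemma smooth_sum: "(\<And>i. i \<in> I \<Longrightarrow> f i \<in> S) \<Longrightarrow> sum f I \<in> S"
  by (induction I rule: infinite_finite_induct) (auto intro: smooth_zero smooth_add)

lemma smooth_prod: "(\<And>i. i \<in> I \<Longrightarrow> f i \<in> S) \<Longrightarrow> prod f I \<in> S"
  by (induction I rule: infinite_finite_induct) (auto intro: smooth_one smooth_mult)

lemma smooth_compose:
  assumes "f \<in> S" "\<And>n. Ck_on n g T" "range f \<subseteq> T"
  shows "(\<lambda>x. g (f x)) \<in> S"
  unfolding smooth_iff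
proof (intro allI impI)
  fix U \<phi> n assume U: "(U, \<phi>) \<in> \<A>"
  then have "Ck_on n (\<lambda>x. f (inv_into U \<phi> x)) (\<phi> ` U)" using assms(1) by (simp add: smooth_iff)
  then show "Ck_on n (\<lambda>x. g (f (inv_into U \<phi> x))) (\<phi> ` U)"
    by (rule Ck_on_compose[OF chart(2)[OF U] _ assms(2)]) (use assms(3) in auto)
qed

lemma smooth_local:
  assumes "\<And>p. \<exists>W g. open W \<and> p \<in> W \<and> g \<in> S \<and> (\<forall>q\<in>W. f q = g q)"
  shows "f \<in> S"
  unfolding smooth_iff
proof (intro allI impI)
  fix U \<phi> n assume U: "(U, \<phi>) \<in> \<A>"
  let ?\<psi> = "inv_into U \<phi>"
  note c = chart[OF U]
  show "Ck_on n (\<lambda>x. f (?\<psi> x)) (\<phi> ` U)"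
  proof (rule Ck_on_local)
    fix x assume x: "x \<in> \<phi> ` U"
    obtain W g where W: "open W" "?\<psi> x \<in> W" "g \<in> S" "\<forall>q\<in>W. f q = g q"
      using assms by blast
    have "continuous_on (\<phi> ` U) ?\<psi>" using c(3) by (simp add: homeomorphism_def)
    then have op: "open (?\<psi> -` W \<inter> \<phi> ` U)"
      using W(1) c(2) by (auto simp: continuous_on_open_vimage)
    have "Ck_on n (\<lambda>x. f (?\<psi> x)) (?\<psi> -` W \<inter> \<phi> ` U)"
    proof (rule Ck_on_cong[OF op])
      show "Ck_on n (\<lambda>x. g (?\<psi> x)) (?\<psi> -` W \<inter> \<phi> ` U)"
        using W(3) U unfolding smooth_iff by (auto intro: Ck_on_subset)
    qed (use W in auto)
    then show "\<exists>W. open W \<and> x \<in> W \<and> Ck_on n (\<lambda>x. f (?\<psi> x)) W" using op W x by blast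
  qed
qed

lemma smooth_continuous:
  assumes "f \<in> S"
  shows "continuous_on UNIV f"
proof (rule continuous_at_imp_continuous_on, rule ballI)
  fix p
  obtain U \<phi> where U: "(U, \<phi>) \<in> \<A>" "p \<in> U" by (rule chart_at)
  note c = chart[OF U(1)]
  have \<phi>: "continuous_on U \<phi>" "\<And>q. q \<in> U \<Longrightarrow> inv_into U \<phi> (\<phi> q) = q"
    using c(3) by (auto simp: homeomorphism_def)
  have "continuous_on (\<phi> ` U) (\<lambda>x. f (inv_into U \<phi> x))"
    using assms U(1) unfolding smooth_iff by (metis Ck_on.simps(1))
  then have "continuous_on U (\<lambda>q. f (inv_into U \<phi> (\<phi> q)))"
    by (rule continuous_on_compose2[OF _ \<phi>(1)]) auto
  then have "continuous_on U f" using \<phi>(2) by (simp cong: continuous_on_cong)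
  then show "isCont f p" using c(1) U(2) by (simp add: continuous_on_eq_continuous_at)
qed


section \<open>The module of vector fields\<close>

lemma vf_smooth: "X \<in> V \<Longrightarrow> f \<in> S \<Longrightarrow> X f \<in> S"
  by (simp add: vector_fields_def)

lemma vf_add: "X \<in> V \<Longrightarrow> f \<in> S \<Longrightarrow> g \<in> S \<Longrightarrow> X (f + g) = X f + X g"
  by (auto simp: vector_fields_def tangent_space_def value_at_def)

lemma vf_cmult: "X \<in> V \<Longrightarrow> f \<in> S \<Longrightarrow> X (\<lambda>q. a * f q) = (\<lambda>q. a * X f q)"
  by (auto simp: vector_fields_def tangent_space_def value_at_def)

lemma vf_mult: "X \<in> V \<Longrightarrow> f \<in> S \<Longrightarrow> g \<in> S \<Longrightarrow> X (f * g) = f * X g + g * X f"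
  by (auto simp: vector_fields_def tangent_space_def value_at_def)

lemma vf_off: "X \<in> V \<Longrightarrow> f \<notin> S \<Longrightarrow> X f = 0"
  by (auto simp: vector_fields_def tangent_space_def value_at_def)

lemma vfI:
  assumes "\<And>f. f \<in> S \<Longrightarrow> X f \<in> S"
    and "\<And>f g. f \<in> S \<Longrightarrow> g \<in> S \<Longrightarrow> X (f + g) = X f + X g"
    and "\<And>a f. f \<in> S \<Longrightarrow> X (\<lambda>q. a * f q) = (\<lambda>q. a * X f q)"
    and "\<And>f g. f \<in> S \<Longrightarrow> g \<in> S \<Longrightarrow> X (f * g) = f * X g + g * X f"
    and "\<And>f. f \<notin> S \<Longrightarrow> X f = 0"
  shows "X \<in> V"
  using assms by (auto simp: vector_fields_def tangent_space_def value_at_def)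

lemma vf_zero_arg: "X \<in> V \<Longrightarrow> X 0 = 0"
  using vf_cmult[OF _ smooth_zero, of X 0] by (simp add: zero_fun_def)

lemma vf_uminus: "X \<in> V \<Longrightarrow> f \<in> S \<Longrightarrow> X (- f) = - X f"
  using vf_cmult[of X f "-1"] by (simp add: fun_Compl_def)

lemma vf_diff: "X \<in> V \<Longrightarrow> f \<in> S \<Longrightarrow> g \<in> S \<Longrightarrow> X (f - g) = X f - X g"
  using vf_add[of X f "- g"] vf_uminus[of X g] smooth_uminus[of g] by simp

lemma vf_one: "X \<in> V \<Longrightarrow> X 1 = 0"
  using vf_mult[OF _ smooth_one smooth_one, of X] by simp

lemma vf_const: "X \<in> V \<Longrightarrow> X (\<lambda>_. c) = 0"
  using vf_cmult[OF _ smooth_one, of X c] vf_one[of X] by (simp add: fun_eq_iff)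

lemma vf_sum:
  assumes X: "X \<in> V"
  shows "(\<And>i. i \<in> I \<Longrightarrow> f i \<in> S) \<Longrightarrow> X (sum f I) = (\<Sum>i\<in>I. X (f i))"
  by (induction I rule: infinite_finite_induct)
    (simp_all add: vf_zero_arg[OF X] vf_add[OF X] smooth_sum)

lemma vf_prod:
  assumes X: "X \<in> V" and "finite I" "\<And>i. i \<in> I \<Longrightarrow> f i \<in> S"
  shows "X (prod f I) p = (\<Sum>l\<in>I. X (f l) p * (\<Prod>i\<in>I - {l}. f i p))"
  using assms(2,3)
proof (induction I)
  case (insert j I)
  have 1: "(\<Sum>l\<in>I. X (f l) p * (\<Prod>i\<in>insert j I - {l}. f i p))
      = (\<Sum>l\<in>I. f j p * (X (f l) p * (\<Prod>i\<in>I - {l}. f i p)))"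
  proof (intro sum.cong refl)
    fix l assume l: "l \<in> I"
    then have "insert j I - {l} = insert j (I - {l})" using insert.hyps by auto
    then show "X (f l) p * (\<Prod>i\<in>insert j I - {l}. f i p)
        = f j p * (X (f l) p * (\<Prod>i\<in>I - {l}. f i p))"
      using insert.hyps by simp
  qed
  have 2: "X (prod f (insert j I)) p = X (f j) p * (\<Prod>i\<in>I. f i p) + f j p * X (prod f I) p"
    using vf_mult[OF X insert.prems(1) smooth_prod[of I f]] insert.prems insert.hyps
    by (simp add: prod_fun_apply mult.commute)
  have 3: "insert j I - {j} = I" using insert.hyps by auto
  have 4: "X (prod f I) p = (\<Sum>l\<in>I. X (f l) p * (\<Prod>i\<in>I - {l}. f i p))"
    using insert.IH insert.prems by blast
  show ?case
    by (simp only: sum.insert[OF insert.hyps] 1 2 3 4 sum_distrib_left)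
qed (simp add: vf_one[OF X])

text \<open>
  At \<open>p\<close>, the exponential of \<open>f\<close> differs from an affine function of \<open>f\<close> by a product with the factor
  \<open>(f - f(p))\<^sup>2\<close>, and derivations at \<open>p\<close> kill such products.
\<close>

lemma vf_exp:
  assumes X: "X \<in> V" and f: "f \<in> S"
  shows "(\<lambda>p. exp (f p)) \<in> S" "X (\<lambda>p. exp (f p)) = (\<lambda>p. exp (f p)) * X f"
proof -
  show "(\<lambda>p. exp (f p)) \<in> S" using smooth_compose[OF f Ck_on_exp] by simp
  obtain r :: "real \<Rightarrow> real" where r: "\<And>n. Ck_on n r UNIV" "\<And>x. exp x = 1 + x + x * x * r x"
    using exp_second_order by blast
  show "X (\<lambda>p. exp (f p)) = (\<lambda>p. exp (f p)) * X f"
  proof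
    fix p
    define u where "u = f - (\<lambda>_. f p)"
    define h where "h q = r (u q)" for q
    have u: "u \<in> S" unfolding u_def by (intro smooth_diff f smooth_const)
    have h: "h \<in> S" unfolding h_def using smooth_compose[OF u r(1)] by simp
    have "exp (f q) = exp (f p) * exp (u q)" for q
      by (simp add: u_def flip: exp_add)
    moreover have "exp (u q) = (1 + u + u * u * h) q" for q
      using r(2)[of "u q"] by (simp add: h_def)
    ultimately have eq: "(\<lambda>q. exp (f q)) = (\<lambda>q. exp (f p) * (1 + u + u * u * h) q)" by metis
    have Xu: "X u = X f" by (simp add: u_def vf_diff[OF X] f smooth_const vf_const[OF X])
    have "u p = 0" by (simp add: u_def)
    then have "X (1 + u + u * u * h) p = X f p"
      by (simp add: u h vf_add[OF X] vf_mult[OF X] vf_one[OF X] smooth_add smooth_mult smooth_one Xu)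
    moreover have "1 + u + u * u * h \<in> S" by (intro smooth_add smooth_mult smooth_one u h)
    ultimately have "X (\<lambda>q. exp (f q)) p = exp (f p) * X f p"
      unfolding eq by (subst vf_cmult[OF X]) auto
    then show "X (\<lambda>p. exp (f p)) p = ((\<lambda>p. exp (f p)) * X f) p" by simp
  qed
qed

lemmas vf_rules = vf_add vf_mult vf_off vf_zero_arg vf_diff vf_uminus vf_smooth

lemma vf_closed_zero: "0 \<in> V"
  by (rule vfI) (auto simp: smooth_zero)

lemma vf_closed_add:
  assumes X: "X \<in> V" and Y: "Y \<in> V"
  shows "X + Y \<in> V"
  by (rule vfI) (auto simp: vf_rules[OF X] vf_rules[OF Y] vf_cmult[OF X] vf_cmult[OF Y] smooth_add fun_eq_iff algebra_simps)

lemma vf_closed_smult: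
  assumes X: "X \<in> V" and f: "f \<in> S"
  shows "fun_smult f X \<in> V"
  by (rule vfI) (auto simp: fun_smult_def vf_rules[OF X] vf_cmult[OF X] f smooth_mult fun_eq_iff algebra_simps)

lemma uminus_eq_smult: "- X = fun_smult (- 1) X"
  by (auto simp: fun_smult_def fun_eq_iff)

lemma vf_closed_uminus: "X \<in> V \<Longrightarrow> - X \<in> V"
  unfolding uminus_eq_smult by (intro vf_closed_smult smooth_uminus smooth_one)

lemma vf_closed_diff: "X \<in> V \<Longrightarrow> Y \<in> V \<Longrightarrow> X - Y \<in> V"
  using vf_closed_add[OF _ vf_closed_uminus] by simp

lemma vf_closed_sum: "(\<And>i. i \<in> I \<Longrightarrow> X i \<in> V) \<Longrightarrow> sum X I \<in> V"
  by (induction I rule: infinite_finite_induct) (auto intro: vf_closed_zero vf_closed_add)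

lemma vf_closed_bracket:
  assumes X: "X \<in> V" and Y: "Y \<in> V"
  shows "lie_bracket X Y \<in> V"
  by (rule vfI) (simp_all add: lie_bracket_def smooth_diff smooth_add smooth_mult smooth_cmult
      vf_cmult[OF X] vf_cmult[OF Y] vf_rules[OF X] vf_rules[OF Y], auto simp: fun_eq_iff algebra_simps)

lemma bracket_self: "lie_bracket X X = 0"
  by (simp add: lie_bracket_def fun_eq_iff)

lemma bracket_swap: "lie_bracket Y X = - lie_bracket X Y"
  by (simp add: lie_bracket_def fun_eq_iff)

lemma bracket_add_right:
  assumes X: "X \<in> V" and Y: "Y \<in> V" and Z: "Z \<in> V"
  shows "lie_bracket X (Y + Z) = lie_bracket X Y + lie_bracket X Z"
proof
  fix f
  show "lie_bracket X (Y + Z) f = (lie_bracket X Y + lie_bracket X Z) f"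
    by (cases "f \<in> S") (simp_all add: lie_bracket_def vf_rules[OF X] vf_rules[OF Y] vf_rules[OF Z])
qed

lemma bracket_smult_right:
  assumes X: "X \<in> V" and Y: "Y \<in> V" and f: "f \<in> S"
  shows "lie_bracket X (fun_smult f Y) = fun_smult (X f) Y + fun_smult f (lie_bracket X Y)"
proof (intro ext)
  fix g p
  show "lie_bracket X (fun_smult f Y) g p
      = (fun_smult (X f) Y + fun_smult f (lie_bracket X Y)) g p"
    by (cases "g \<in> S")
      (simp_all add: lie_bracket_def fun_smult_def f vf_rules[OF X] vf_rules[OF Y],
        simp_all add: right_diff_distrib)
qed

lemma bracket_add_left:
  assumes "X \<in> V" "Y \<in> V" "Z \<in> V"
  shows "lie_bracket (X + Y) Z = lie_bracket X Z + lie_bracket Y Z"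
  unfolding bracket_swap[of _ Z] bracket_add_right[OF assms(3,1,2)] by simp

lemma bracket_smult_left:
  assumes "X \<in> V" "Z \<in> V" "f \<in> S"
  shows "lie_bracket (fun_smult f X) Z = fun_smult f (lie_bracket X Z) - fun_smult (Z f) X"
proof (intro ext)
  fix g p
  show "lie_bracket (fun_smult f X) Z g p
      = (fun_smult f (lie_bracket X Z) - fun_smult (Z f) X) g p"
    unfolding bracket_swap[of _ Z] bracket_smult_right[OF assms(2,1,3)]
    by (simp add: fun_smult_def)
qed

lemma bracket_jacobi:
  assumes X: "X \<in> V" and Y: "Y \<in> V" and Z: "Z \<in> V"
  shows "lie_bracket X (lie_bracket Y Z)
      = lie_bracket (lie_bracket X Y) Z + lie_bracket Y (lie_bracket X Z)"
proof (intro ext)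
  fix f p
  show "lie_bracket X (lie_bracket Y Z) f p
      = (lie_bracket (lie_bracket X Y) Z + lie_bracket Y (lie_bracket X Z)) f p"
    by (cases "f \<in> S")
      (simp_all add: lie_bracket_def vf_rules[OF X] vf_rules[OF Y] vf_rules[OF Z])
qed


section \<open>The module of differential forms\<close>

abbreviation "L \<equiv> field_lists \<A>"
abbreviation "\<Omega> \<equiv> forms \<A>"

lemma L_iff: "Xs \<in> L n \<longleftrightarrow> length Xs = n \<and> set Xs \<subseteq> V"
  by (simp add: field_lists_def)

lemma L_nth: "Xs \<in> L n \<Longrightarrow> i < n \<Longrightarrow> Xs ! i \<in> V"
  by (auto simp: L_iff)

lemma L_update: "Xs \<in> L n \<Longrightarrow> X \<in> V \<Longrightarrow> Xs[i := X] \<in> L n"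
  using set_update_subset_insert[of Xs i X] by (auto simp: L_iff)

lemma L_Cons: "X # Xs \<in> L (Suc n) \<longleftrightarrow> X \<in> V \<and> Xs \<in> L n"
  by (auto simp: L_iff)

lemma L_Suc_cases:
  assumes "Xs \<in> L (Suc n)"
  obtains X Ys where "Xs = X # Ys" "X \<in> V" "Ys \<in> L n"
  using assms by (cases Xs) (auto simp: L_iff)

lemma L_0: "Xs \<in> L 0 \<longleftrightarrow> Xs = []"
  by (auto simp: L_iff)

lemma L_1: "Xs \<in> L 1 \<longleftrightarrow> (\<exists>X\<in>V. Xs = [X])"
  by (cases Xs) (auto simp: L_iff)

lemma L_map: "(\<And>i. i < n \<Longrightarrow> Y i \<in> V) \<Longrightarrow> map Y [0..<n] \<in> L n"
  by (auto simp: L_iff)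

lemma form_smooth: "\<omega> \<in> \<Omega> n \<Longrightarrow> Xs \<in> L n \<Longrightarrow> \<omega> Xs \<in> S"
  by (auto simp: forms_def)

lemma form_add: "\<omega> \<in> \<Omega> n \<Longrightarrow> Xs \<in> L n \<Longrightarrow> i < n \<Longrightarrow> X \<in> V \<Longrightarrow> Y \<in> V \<Longrightarrow>
    \<omega> (Xs[i := X + Y]) = \<omega> (Xs[i := X]) + \<omega> (Xs[i := Y])"
  by (auto simp: forms_def)

lemma form_smult: "\<omega> \<in> \<Omega> n \<Longrightarrow> Xs \<in> L n \<Longrightarrow> i < n \<Longrightarrow> X \<in> V \<Longrightarrow> f \<in> S \<Longrightarrow>
    \<omega> (Xs[i := fun_smult f X]) = f * \<omega> (Xs[i := X])"
  by (auto simp: forms_def)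

lemma form_alt: "\<omega> \<in> \<Omega> n \<Longrightarrow> Xs \<in> L n \<Longrightarrow> i < n \<Longrightarrow> j < n \<Longrightarrow> i \<noteq> j \<Longrightarrow> Xs ! i = Xs ! j \<Longrightarrow> \<omega> Xs = 0"
  by (auto simp: forms_def)

lemma form_off: "\<omega> \<in> \<Omega> n \<Longrightarrow> Xs \<notin> L n \<Longrightarrow> \<omega> Xs = 0"
  by (auto simp: forms_def)

lemma formI:
  assumes "\<And>Xs. Xs \<in> L n \<Longrightarrow> \<omega> Xs \<in> S"
    and "\<And>Xs i X Y. Xs \<in> L n \<Longrightarrow> i < n \<Longrightarrow> X \<in> V \<Longrightarrow> Y \<in> V \<Longrightarrow>
      \<omega> (Xs[i := X + Y]) = \<omega> (Xs[i := X]) + \<omega> (Xs[i := Y])"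
    and "\<And>Xs i X f. Xs \<in> L n \<Longrightarrow> i < n \<Longrightarrow> X \<in> V \<Longrightarrow> f \<in> S \<Longrightarrow>
      \<omega> (Xs[i := fun_smult f X]) = f * \<omega> (Xs[i := X])"
    and "\<And>Xs i j. Xs \<in> L n \<Longrightarrow> i < n \<Longrightarrow> j < n \<Longrightarrow> i \<noteq> j \<Longrightarrow> Xs ! i = Xs ! j \<Longrightarrow> \<omega> Xs = 0"
    and "\<And>Xs. Xs \<notin> L n \<Longrightarrow> \<omega> Xs = 0"
  shows "\<omega> \<in> \<Omega> n"
  using assms unfolding forms_def by blast

lemma form_closed_zero: "0 \<in> \<Omega> n"
  by (rule formI) (auto simp: smooth_zero)

lemma form_closed_add:
  assumes w: "\<omega> \<in> \<Omega> n" and h: "\<eta> \<in> \<Omega> n"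
  shows "\<omega> + \<eta> \<in> \<Omega> n"
proof (rule formI)
  show "(\<omega> + \<eta>) Xs = 0" if "Xs \<in> L n" "i < n" "j < n" "i \<noteq> j" "Xs ! i = Xs ! j" for Xs i j
    using form_alt[OF w that] form_alt[OF h that] by simp
qed (simp_all add: form_smooth[OF w] form_smooth[OF h] form_add[OF w] form_add[OF h]
    form_smult[OF w] form_smult[OF h] form_off[OF w] form_off[OF h] smooth_add distrib_left)

lemma form_closed_smult:
  assumes f: "f \<in> S" and w: "\<omega> \<in> \<Omega> n"
  shows "(\<lambda>Xs. f * \<omega> Xs) \<in> \<Omega> n"
proof (rule formI)
  show "f * \<omega> Xs = 0" if "Xs \<in> L n" "i < n" "j < n" "i \<noteq> j" "Xs ! i = Xs ! j" for Xs i j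
    using form_alt[OF w that] by simp
qed (simp_all add: form_smooth[OF w] form_add[OF w] form_smult[OF w] form_off[OF w] f
    smooth_mult distrib_left mult.left_commute)

lemma form_closed_uminus: "\<omega> \<in> \<Omega> n \<Longrightarrow> - \<omega> \<in> \<Omega> n"
proof -
  assume "\<omega> \<in> \<Omega> n"
  then have "(\<lambda>Xs. - 1 * \<omega> Xs) \<in> \<Omega> n"
    by (rule form_closed_smult[OF smooth_uminus[OF smooth_one]])
  moreover have "(\<lambda>Xs. - 1 * \<omega> Xs) = - \<omega>" by (simp add: fun_eq_iff)
  ultimately show "- \<omega> \<in> \<Omega> n" by (simp only:)
qed

lemma form_closed_diff: "\<omega> \<in> \<Omega> n \<Longrightarrow> \<eta> \<in> \<Omega> n \<Longrightarrow> \<omega> - \<eta> \<in> \<Omega> n"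
  unfolding diff_conv_add_uminus by (intro form_closed_add form_closed_uminus)

lemma form_closed_sum: "(\<And>i. i \<in> I \<Longrightarrow> \<omega> i \<in> \<Omega> n) \<Longrightarrow> sum \<omega> I \<in> \<Omega> n"
  by (induction I rule: infinite_finite_induct) (auto intro: form_closed_zero form_closed_add)

lemma form_zero_slot:
  assumes "\<omega> \<in> \<Omega> n" "Xs \<in> L n" "i < n"
  shows "\<omega> (Xs[i := 0]) = 0"
proof -
  have "fun_smult 0 0 = (0 :: 'a vfield)" by (auto simp: fun_smult_def fun_eq_iff)
  then show ?thesis using form_smult[OF assms vf_closed_zero smooth_zero] by simp
qed

lemma form_uminus_slot:
  assumes "\<omega> \<in> \<Omega> n" "Xs \<in> L n" "i < n" "X \<in> V"
  shows "\<omega> (Xs[i := - X]) = - \<omega> (Xs[i := X])"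
  using form_smult[OF assms smooth_uminus[OF smooth_one]] by (simp add: uminus_eq_smult)

lemma form_diff_slot:
  assumes "\<omega> \<in> \<Omega> n" "Xs \<in> L n" "i < n" "X \<in> V" "Y \<in> V"
  shows "\<omega> (Xs[i := X - Y]) = \<omega> (Xs[i := X]) - \<omega> (Xs[i := Y])"
  unfolding diff_conv_add_uminus form_add[OF assms(1-4) vf_closed_uminus[OF assms(5)]]
    form_uminus_slot[OF assms(1-3,5)] ..

lemma form_sum_slot:
  assumes "\<omega> \<in> \<Omega> n" "Xs \<in> L n" "i < n" "\<And>j. j \<in> J \<Longrightarrow> X j \<in> V" "\<And>j. j \<in> J \<Longrightarrow> f j \<in> S"
  shows "\<omega> (Xs[i := \<Sum>j\<in>J. fun_smult (f j) (X j)]) p = (\<Sum>j\<in>J. f j p * \<omega> (Xs[i := X j]) p)"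
  using assms(4,5)
proof (induction J rule: infinite_finite_induct)
  case (insert j J)
  let ?Y = "\<Sum>j\<in>J. fun_smult (f j) (X j)"
  have j: "X j \<in> V" "f j \<in> S" using insert.prems by auto
  have "?Y \<in> V" by (intro vf_closed_sum vf_closed_smult) (use insert.prems in auto)
  then have "\<omega> (Xs[i := fun_smult (f j) (X j) + ?Y]) = f j * \<omega> (Xs[i := X j]) + \<omega> (Xs[i := ?Y])"
    using form_add[OF assms(1-3) vf_closed_smult[OF j]] form_smult[OF assms(1-3) j] by simp
  moreover have "\<omega> (Xs[i := ?Y]) p = (\<Sum>j\<in>J. f j p * \<omega> (Xs[i := X j]) p)"
    using insert.IH insert.prems by simp
  ultimately have "\<omega> (Xs[i := fun_smult (f j) (X j) + ?Y]) p
      = f j p * \<omega> (Xs[i := X j]) p + (\<Sum>j\<in>J. f j p * \<omega> (Xs[i := X j]) p)" by simp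
  then show ?case unfolding sum.insert[OF insert.hyps] .
qed (simp_all add: form_zero_slot[OF assms(1-3)])

lemma one_form:
  assumes "\<omega> \<in> \<Omega> 1"
  shows "X \<in> V \<Longrightarrow> \<omega> [X] \<in> S"
    and "X \<in> V \<Longrightarrow> Y \<in> V \<Longrightarrow> \<omega> [X + Y] = \<omega> [X] + \<omega> [Y]"
    and "X \<in> V \<Longrightarrow> Y \<in> V \<Longrightarrow> \<omega> [X - Y] = \<omega> [X] - \<omega> [Y]"
    and "X \<in> V \<Longrightarrow> \<omega> [- X] = - \<omega> [X]"
    and "X \<in> V \<Longrightarrow> f \<in> S \<Longrightarrow> \<omega> [fun_smult f X] = f * \<omega> [X]"
  using form_smooth[OF assms, of "[X]"] form_add[OF assms, of "[X]" 0 X Y]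
    form_diff_slot[OF assms, of "[X]" 0 X Y] form_uminus_slot[OF assms, of "[X]" 0 X]
    form_smult[OF assms, of "[X]" 0 X f]
  by (simp_all add: L_iff)

lemma one_form_sum:
  assumes "\<omega> \<in> \<Omega> 1" "\<And>j. j \<in> J \<Longrightarrow> X j \<in> V" "\<And>j. j \<in> J \<Longrightarrow> f j \<in> S"
  shows "\<omega> [\<Sum>j\<in>J. fun_smult (f j) (X j)] p = (\<Sum>j\<in>J. f j p * \<omega> [X j] p)"
  using form_sum_slot[OF assms(1) _ _ assms(2,3), of "[0]" 0 J] by (simp add: L_iff vf_closed_zero)

lemma one_formI:
  assumes "\<And>X. X \<in> V \<Longrightarrow> \<omega> [X] \<in> S"
    and "\<And>X Y. X \<in> V \<Longrightarrow> Y \<in> V \<Longrightarrow> \<omega> [X + Y] = \<omega> [X] + \<omega> [Y]"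
    and "\<And>X f. X \<in> V \<Longrightarrow> f \<in> S \<Longrightarrow> \<omega> [fun_smult f X] = f * \<omega> [X]"
    and "\<And>Xs. Xs \<notin> L 1 \<Longrightarrow> \<omega> Xs = 0"
  shows "\<omega> \<in> \<Omega> 1"
  by (rule formI) (use assms in \<open>auto simp: L_1[simplified]\<close>)

text \<open>
  Polarisation: the form vanishes when the sum of the two arguments is put in both places.
\<close>

lemma form_swap:
  assumes w: "\<omega> \<in> \<Omega> n" and Xs: "Xs \<in> L n" and ij: "i < n" "j < n" "i \<noteq> j"
  shows "\<omega> (Xs[i := Xs ! j, j := Xs ! i]) = - \<omega> Xs"
proof -
  let ?X = "Xs ! i" and ?Y = "Xs ! j"
  have V: "?X \<in> V" "?Y \<in> V" "?X + ?Y \<in> V" and len: "length Xs = n"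
    using Xs ij L_nth vf_closed_add by (auto simp: L_iff)
  have alt: "\<omega> (Xs[i := Z, j := Z]) = 0" if "Z \<in> V" for Z
    by (rule form_alt[OF w _ ij]) (use that Xs ij len in \<open>auto intro!: L_update\<close>)
  have "0 = \<omega> (Xs[i := ?X + ?Y, j := ?X + ?Y])" using alt V by simp
  also have "\<dots> = \<omega> (Xs[i := ?X + ?Y, j := ?X]) + \<omega> (Xs[i := ?X + ?Y, j := ?Y])"
    by (intro form_add[OF w]) (use V Xs ij in \<open>auto intro!: L_update\<close>)
  also have "\<omega> (Xs[i := ?X + ?Y, j := ?X]) = \<omega> (Xs[i := ?X, j := ?X]) + \<omega> (Xs[i := ?Y, j := ?X])"
    using form_add[OF w L_update[OF Xs V(1), of j] ij(1) V(1,2)]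
    by (simp only: list_update_swap[OF ij(3)])
  also have "\<omega> (Xs[i := ?X + ?Y, j := ?Y]) = \<omega> (Xs[i := ?X, j := ?Y]) + \<omega> (Xs[i := ?Y, j := ?Y])"
    using form_add[OF w L_update[OF Xs V(2), of j] ij(1) V(1,2)]
    by (simp only: list_update_swap[OF ij(3)])
  also have "Xs[i := ?X, j := ?Y] = Xs" by simp
  finally have "0 = \<omega> (Xs[i := ?Y, j := ?X]) + \<omega> Xs"
    unfolding alt[OF V(1)] alt[OF V(2)] by (simp del: plus_fun_apply zero_fun_apply)
  then show ?thesis unfolding eq_neg_iff_add_eq_0 by (rule sym)
qed

text \<open>A permutation is a product of transpositions, each of which reverses the sign.\<close>

lemma form_permute:
  assumes w: "\<omega> \<in> \<Omega> n" and s: "\<sigma> permutes {..<n}" and Xs: "Xs \<in> L n"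
  shows "\<omega> (map (\<lambda>i. Xs ! \<sigma> i) [0..<n]) p = of_int (sign \<sigma>) * \<omega> Xs p"
  using finite_lessThan s
proof (induction rule: permutes_rev_induct)
  case id
  have "map (\<lambda>i. Xs ! id i) [0..<n] = Xs" using Xs map_nth[of Xs] by (auto simp: L_iff)
  then show ?case by simp
next
  case (swap a b \<sigma>)
  let ?Z = "map (\<lambda>i. Xs ! \<sigma> i) [0..<n]"
  have Z: "?Z \<in> L n"
    using permutes_in_image[OF swap.hyps(4)] by (intro L_map L_nth[OF Xs]) auto
  define \<tau> where "\<tau> = \<sigma> \<circ> Transposition.transpose a b"
  have "map (\<lambda>i. Xs ! \<tau> i) [0..<n] = ?Z[a := ?Z ! b, b := ?Z ! a]"
    using swap.hyps
    by (intro nth_equalityI) (auto simp: \<tau>_def nth_list_update Transposition.transpose_def)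
  then have "\<omega> (map (\<lambda>i. Xs ! \<tau> i) [0..<n]) = - \<omega> ?Z"
    using form_swap[OF w Z, of a b] swap.hyps(1-3) by simp
  moreover have "sign \<tau> = - sign \<sigma>"
    using swap.hyps permutation_permutes finite_lessThan unfolding \<tau>_def
    by (subst sign_compose) (auto simp: sign_swap_id permutation_swap_id)
  ultimately show ?case unfolding \<tau>_def[symmetric] using swap.IH by simp
qed

text \<open>Passing \<open>Y\<close> over the block \<open>as\<close> takes one adjacent transposition for each entry.\<close>

lemma form_move:
  assumes w: "\<omega> \<in> \<Omega> n"
  shows "pre @ Y # as @ bs \<in> L n \<Longrightarrow>
    \<omega> (pre @ Y # as @ bs) p = (- 1) ^ length as * \<omega> (pre @ as @ Y # bs) p"
proof (induction as arbitrary: pre)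
  case (Cons a as)
  let ?l = "length pre"
  have "\<omega> (pre @ Y # (a # as) @ bs) = - \<omega> ((pre @ [a]) @ Y # as @ bs)"
  proof -
    have "(pre @ Y # a # as @ bs)[?l := (pre @ Y # a # as @ bs) ! Suc ?l,
        Suc ?l := (pre @ Y # a # as @ bs) ! ?l] = pre @ a # Y # as @ bs"
      by (simp add: list_update_append nth_append)
    then show ?thesis
      using form_swap[OF w, of "pre @ Y # a # as @ bs" ?l "Suc ?l"] Cons.prems
      by (auto simp: L_iff)
  qed
  moreover have "(pre @ [a]) @ Y # as @ bs \<in> L n" using Cons.prems by (auto simp: L_iff)
  ultimately show ?case using Cons.IH[of "pre @ [a]"] by simp
qed simp

lemma nths_delete: "i < length Zs \<Longrightarrow> nths Zs (- {i}) = take i Zs @ drop (Suc i) Zs"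
proof (induction Zs arbitrary: i)
  case (Cons Z Zs)
  show ?case
  proof (cases i)
    case 0
    then have "{j. Suc j \<in> - {i}} = UNIV" by auto
    then show ?thesis using 0 by (simp add: nths_Cons nths_all)
  next
    case (Suc m)
    then have "{j. Suc j \<in> - {i}} = - {m}" by auto
    then show ?thesis using Suc Cons by (simp add: nths_Cons)
  qed
qed simp

lemma L_delete: "Zs \<in> L (Suc n) \<Longrightarrow> i \<le> n \<Longrightarrow> nths Zs (- {i}) \<in> L n"
  by (auto simp: L_iff nths_delete dest: in_set_takeD in_set_dropD)

lemma form_head_to_slot:
  assumes w: "\<omega> \<in> \<Omega> n" and Zs: "Zs \<in> L n" and m: "m < n" and Y: "Y \<in> V"
  shows "\<omega> (Y # nths Zs (- {m})) p = (- 1) ^ m * \<omega> (Zs[m := Y]) p"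
proof -
  have "Y # take m Zs @ drop (Suc m) Zs \<in> L n"
    using Zs m Y by (auto simp: L_iff dest: in_set_takeD in_set_dropD)
  then show ?thesis
    using form_move[OF w, of "[]" Y "take m Zs" "drop (Suc m) Zs" p] Zs m
    by (simp add: nths_delete L_iff upd_conv_take_nth_drop min_def)
qed


section \<open>Contraction, Lie derivative and exterior derivative\<close>

definition contract :: "'a vfield \<Rightarrow> 'a form \<Rightarrow> 'a form" where
  "contract X \<omega> = (\<lambda>Zs. \<omega> (X # Zs))"

lemma contract_form:
  assumes w: "\<omega> \<in> \<Omega> (Suc n)" and X: "X \<in> V"
  shows "contract X \<omega> \<in> \<Omega> n"
proof (rule formI)
  fix Zs i Y Z assume "Zs \<in> L n" "i < n" "Y \<in> V" "Z \<in> V"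
  then show "contract X \<omega> (Zs[i := Y + Z]) = contract X \<omega> (Zs[i := Y]) + contract X \<omega> (Zs[i := Z])"
    using form_add[OF w, of "X # Zs" "Suc i" Y Z] X by (simp add: contract_def L_Cons)
next
  fix Zs i Y f assume "Zs \<in> L n" "i < n" "Y \<in> V" "f \<in> S"
  then show "contract X \<omega> (Zs[i := fun_smult f Y]) = f * contract X \<omega> (Zs[i := Y])"
    using form_smult[OF w, of "X # Zs" "Suc i" Y f] X by (simp add: contract_def L_Cons)
next
  fix Zs i j assume "Zs \<in> L n" "i < n" "j < n" "i \<noteq> j" "Zs ! i = Zs ! j"
  then show "contract X \<omega> Zs = 0"
    using form_alt[OF w, of "X # Zs" "Suc i" "Suc j"] X by (simp add: contract_def L_Cons)
qed (use X in \<open>simp_all add: contract_def L_Cons form_smooth[OF w] form_off[OF w]\<close>)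

lemma lie_apply:
  "Zs \<in> L n \<Longrightarrow> lie_derivative \<A> n X \<omega> Zs p
    = X (\<omega> Zs) p - (\<Sum>i<n. \<omega> (Zs[i := lie_bracket X (Zs ! i)]) p)"
  by (simp add: lie_derivative_def)

lemma lie_off: "Zs \<notin> L n \<Longrightarrow> lie_derivative \<A> n X \<omega> Zs = 0"
  by (simp add: lie_derivative_def fun_eq_iff)

text \<open>
  This isolates the dependence on the argument in one slot, for the proofs of linearity.
\<close>

lemma lie_slot:
  assumes "Zs \<in> L n" "i < n" "Y \<in> V"
  shows "lie_derivative \<A> n X \<omega> (Zs[i := Y]) p
    = X (\<omega> (Zs[i := Y])) p - \<omega> (Zs[i := lie_bracket X Y]) p
      - (\<Sum>m\<in>{..<n} - {i}. \<omega> (Zs[m := lie_bracket X (Zs ! m), i := Y]) p)"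
proof -
  have "(\<Sum>m<n. \<omega> (Zs[i := Y, m := lie_bracket X (Zs[i := Y] ! m)]) p)
      = \<omega> (Zs[i := lie_bracket X Y]) p
        + (\<Sum>m\<in>{..<n} - {i}. \<omega> (Zs[i := Y, m := lie_bracket X (Zs[i := Y] ! m)]) p)"
    using assms by (subst sum.remove[of _ i]) (auto simp: L_iff)
  also have "(\<Sum>m\<in>{..<n} - {i}. \<omega> (Zs[i := Y, m := lie_bracket X (Zs[i := Y] ! m)]) p)
      = (\<Sum>m\<in>{..<n} - {i}. \<omega> (Zs[m := lie_bracket X (Zs ! m), i := Y]) p)"
    by (intro sum.cong refl) (auto simp: list_update_swap)
  finally show ?thesis using assms by (simp add: lie_apply L_update)
qed

lemma lie_form:
  assumes w: "\<omega> \<in> \<Omega> n" and X: "X \<in> V"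
  shows "lie_derivative \<A> n X \<omega> \<in> \<Omega> n"
proof (rule formI)
  fix Zs assume Zs: "Zs \<in> L n"
  have "lie_derivative \<A> n X \<omega> Zs = X (\<omega> Zs) - (\<Sum>i<n. \<omega> (Zs[i := lie_bracket X (Zs ! i)]))"
    by (rule ext) (simp add: lie_apply[OF Zs] sum_fun_apply)
  also have "\<dots> \<in> S"
    by (intro smooth_diff smooth_sum vf_smooth[OF X] form_smooth[OF w] L_update Zs
        vf_closed_bracket[OF X] L_nth[OF Zs]) auto
  finally show "lie_derivative \<A> n X \<omega> Zs \<in> S" .
next
  fix Zs i Y Z assume Zs: "Zs \<in> L n" and i: "i < n" and Y: "Y \<in> V" and Z: "Z \<in> V"
  note sl = lie_slot[OF Zs i]
  have s: "\<omega> (Zs[m := lie_bracket X (Zs ! m), i := Y + Z]) p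
      = \<omega> (Zs[m := lie_bracket X (Zs ! m), i := Y]) p + \<omega> (Zs[m := lie_bracket X (Zs ! m), i := Z]) p"
    if "m \<in> {..<n} - {i}" for m p
    using form_add[OF w L_update[OF Zs vf_closed_bracket[OF X L_nth[OF Zs]]] i Y Z, of m] that by simp
  have b: "\<omega> (Zs[i := lie_bracket X (Y + Z)])
      = \<omega> (Zs[i := lie_bracket X Y]) + \<omega> (Zs[i := lie_bracket X Z])"
    unfolding bracket_add_right[OF X Y Z]
    by (rule form_add[OF w Zs i vf_closed_bracket[OF X Y] vf_closed_bracket[OF X Z]])
  have x: "X (\<omega> (Zs[i := Y + Z])) = X (\<omega> (Zs[i := Y])) + X (\<omega> (Zs[i := Z]))"
    unfolding form_add[OF w Zs i Y Z]
    by (rule vf_add[OF X form_smooth[OF w L_update[OF Zs Y]] form_smooth[OF w L_update[OF Zs Z]]])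
  show "lie_derivative \<A> n X \<omega> (Zs[i := Y + Z])
      = lie_derivative \<A> n X \<omega> (Zs[i := Y]) + lie_derivative \<A> n X \<omega> (Zs[i := Z])"
    by (rule ext) (simp add: sl[OF Y] sl[OF Z] sl[OF vf_closed_add[OF Y Z]] s b x sum.distrib)
next
  fix Zs i Y f assume Zs: "Zs \<in> L n" and i: "i < n" and Y: "Y \<in> V" and f: "f \<in> S"
  note sl = lie_slot[OF Zs i]
  have s: "\<omega> (Zs[m := lie_bracket X (Zs ! m), i := fun_smult f Y]) p
      = f p * \<omega> (Zs[m := lie_bracket X (Zs ! m), i := Y]) p"
    if "m \<in> {..<n} - {i}" for m p
    using form_smult[OF w L_update[OF Zs vf_closed_bracket[OF X L_nth[OF Zs]]] i Y f, of m] that by simp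
  have b: "\<omega> (Zs[i := lie_bracket X (fun_smult f Y)])
      = X f * \<omega> (Zs[i := Y]) + f * \<omega> (Zs[i := lie_bracket X Y])"
    unfolding bracket_smult_right[OF X Y f] form_add[OF w Zs i vf_closed_smult[OF Y vf_smooth[OF X f]]
        vf_closed_smult[OF vf_closed_bracket[OF X Y] f]]
      form_smult[OF w Zs i Y vf_smooth[OF X f]] form_smult[OF w Zs i vf_closed_bracket[OF X Y] f] ..
  have x: "X (\<omega> (Zs[i := fun_smult f Y])) = f * X (\<omega> (Zs[i := Y])) + \<omega> (Zs[i := Y]) * X f"
    unfolding form_smult[OF w Zs i Y f]
    by (rule vf_mult[OF X f form_smooth[OF w L_update[OF Zs Y]]])
  show "lie_derivative \<A> n X \<omega> (Zs[i := fun_smult f Y]) = f * lie_derivative \<A> n X \<omega> (Zs[i := Y])"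
    by (rule ext) (simp add: sl[OF Y] sl[OF vf_closed_smult[OF Y f]] s b x sum_distrib_left algebra_simps)
next
  fix Zs i j assume Zs: "Zs \<in> L n" and ij: "i < n" "j < n" "i \<noteq> j" and eq: "Zs ! i = Zs ! j"
  let ?W = "lie_bracket X (Zs ! i)" and ?t = "\<lambda>m. \<omega> (Zs[m := lie_bracket X (Zs ! m)])"
  have W: "?W \<in> V" using vf_closed_bracket[OF X L_nth[OF Zs ij(1)]] .
  have rest: "?t m = 0" if "m \<in> {..<n} - {i} - {j}" for m
    by (rule form_alt[OF w _ ij])
      (use that ij eq Zs in \<open>auto intro!: L_update vf_closed_bracket X L_nth[OF Zs]\<close>)
  have "(Zs[i := ?W])[i := Zs[i := ?W] ! j, j := Zs[i := ?W] ! i] = Zs[j := ?W]"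
    using ij eq Zs by (simp add: L_iff flip: eq)
  then have "?t j = - ?t i" using form_swap[OF w L_update[OF Zs W] ij, of i] eq by simp
  then have "(\<Sum>m<n. ?t m p) = 0" for p
    using ij rest by (simp add: sum.remove[of _ i] sum.remove[of _ j])
  then show "lie_derivative \<A> n X \<omega> Zs = 0"
    by (intro ext) (simp add: form_alt[OF w Zs ij eq] lie_apply[OF Zs] vf_zero_arg[OF X])
qed (rule lie_off)

lemma ext_apply:
  "Xs \<in> L (Suc s) \<Longrightarrow> ext_deriv \<A> s \<omega> Xs p =
     (\<Sum>i\<le>s. (- 1) ^ i * (Xs ! i) (\<omega> (nths Xs (- {i}))) p)
   + (\<Sum>j\<le>s. \<Sum>i<j. (- 1) ^ (i + j) * \<omega> (lie_bracket (Xs ! i) (Xs ! j) # nths Xs (- {i, j})) p)"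
  by (simp add: ext_deriv_def)

lemma ext_off: "Xs \<notin> L (Suc s) \<Longrightarrow> ext_deriv \<A> s \<omega> Xs = 0"
  by (simp add: ext_deriv_def fun_eq_iff)

lemma ext_deriv_function: "X \<in> V \<Longrightarrow> ext_deriv \<A> 0 \<omega> [X] = X (\<omega> [])"
  by (rule ext) (simp add: ext_apply L_iff nths_singleton)

lemma ext_deriv_one_form:
  "X \<in> V \<Longrightarrow> Y \<in> V \<Longrightarrow>
    ext_deriv \<A> 1 \<omega> [X, Y] = X (\<omega> [Y]) - Y (\<omega> [X]) - \<omega> [lie_bracket X Y]"
  by (rule ext) (simp add: ext_apply L_iff nths_Cons)

lemma L_delete2:
  assumes "Xs \<in> L (Suc (Suc m))" "i < j" "j \<le> Suc m"
  shows "nths Xs (- {i, j}) \<in> L m"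
proof -
  have "{l. l < length Xs \<and> l \<in> - {i, j}} = {..<Suc (Suc m)} - {i, j}"
    using assms by (auto simp: L_iff)
  then have "length (nths Xs (- {i, j})) = card ({..<Suc (Suc m)} - {i, j})"
    by (simp add: length_nths)
  also have "\<dots> = m" using assms(2,3) by (subst card_Diff_subset) auto
  finally show ?thesis using assms(1) set_nths_subset[of Xs] by (auto simp: L_iff)
qed

lemma nths_Cons_delete:
  "nths (X # Zs) (- {0}) = Zs" "nths (X # Zs) (- {Suc i}) = X # nths Zs (- {i})"
  "nths (X # Zs) (- {0, Suc j}) = nths Zs (- {j})"
  "nths (X # Zs) (- {Suc i, Suc j}) = X # nths Zs (- {i, j})"
proof -
  have "{j. Suc j \<in> - {0}} = UNIV" "{j. Suc j \<in> - {Suc i}} = - {i}"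
    "{l. Suc l \<in> - {0, Suc j}} = - {j}" "{l. Suc l \<in> - {Suc i, Suc j}} = - {i, j}" for j by auto
  then show "nths (X # Zs) (- {0}) = Zs" "nths (X # Zs) (- {Suc i}) = X # nths Zs (- {i})"
    "nths (X # Zs) (- {0, Suc j}) = nths Zs (- {j})"
    "nths (X # Zs) (- {Suc i, Suc j}) = X # nths Zs (- {i, j})"
    by (simp_all add: nths_Cons nths_all)
qed

text \<open>
  In the alternating sum for \<open>d\<omega>\<close>, the terms in which \<open>X\<close> differentiates or is bracketed make up the
  Lie derivative; in the others \<open>X\<close> is a passive argument, and after it has been moved to the front
  they make up the exterior derivative of the contraction. The formula turns statements about \<open>d\<close>
  into inductions on the degree.
\<close>

lemma cartan_formula:
  assumes w: "\<omega> \<in> \<Omega> (Suc n)" and X: "X \<in> V" and Zs: "Zs \<in> L (Suc n)"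
  shows "ext_deriv \<A> (Suc n) \<omega> (X # Zs) p
    = lie_derivative \<A> (Suc n) X \<omega> Zs p - ext_deriv \<A> n (contract X \<omega>) Zs p"
proof -
  have lie: "(- 1) ^ Suc j * \<omega> (lie_bracket X (Zs ! j) # nths Zs (- {j})) p
      = - \<omega> (Zs[j := lie_bracket X (Zs ! j)]) p" if "j \<le> n" for j
    using form_head_to_slot[OF w Zs, of j "lie_bracket X (Zs ! j)" p] that
      vf_closed_bracket[OF X L_nth[OF Zs]] by (simp flip: power_add mult_2)
  have swap: "\<omega> (lie_bracket (Zs ! i) (Zs ! j) # X # nths Zs (- {i, j})) p
      = - \<omega> (X # lie_bracket (Zs ! i) (Zs ! j) # nths Zs (- {i, j})) p" if "i < j" "j \<le> n" for i j
  proof -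
    have "n \<noteq> 0" using that by auto
    then obtain m where m: "n = Suc m" by (cases n) auto
    have "lie_bracket (Zs ! i) (Zs ! j) # X # nths Zs (- {i, j}) \<in> L (Suc n)"
      using L_delete2[of Zs m i j] Zs that X m vf_closed_bracket L_nth[OF Zs] by (simp add: L_Cons)
    then show ?thesis using form_move[OF w, of "[]" _ "[X]"] by simp
  qed
  have "ext_deriv \<A> (Suc n) \<omega> (X # Zs) p
      = (\<Sum>i\<le>Suc n. (- 1) ^ i * ((X # Zs) ! i) (\<omega> (nths (X # Zs) (- {i}))) p)
        + (\<Sum>j\<le>Suc n. \<Sum>i<j. (- 1) ^ (i + j)
          * \<omega> (lie_bracket ((X # Zs) ! i) ((X # Zs) ! j) # nths (X # Zs) (- {i, j})) p)"
    by (rule ext_apply) (use X Zs in \<open>simp add: L_Cons\<close>)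
  also have "(\<Sum>i\<le>Suc n. (- 1) ^ i * ((X # Zs) ! i) (\<omega> (nths (X # Zs) (- {i}))) p)
      = X (\<omega> Zs) p - (\<Sum>i\<le>n. (- 1) ^ i * (Zs ! i) (contract X \<omega> (nths Zs (- {i}))) p)"
    unfolding sum.atMost_Suc_shift by (simp add: nths_Cons_delete contract_def sum_negf)
  also have "(\<Sum>j\<le>Suc n. \<Sum>i<j. (- 1) ^ (i + j)
        * \<omega> (lie_bracket ((X # Zs) ! i) ((X # Zs) ! j) # nths (X # Zs) (- {i, j})) p)
      = (\<Sum>j\<le>n. (- 1) ^ Suc j * \<omega> (lie_bracket X (Zs ! j) # nths Zs (- {j})) p
          + (\<Sum>i<j. (- 1) ^ (i + j)
              * \<omega> (lie_bracket (Zs ! i) (Zs ! j) # X # nths Zs (- {i, j})) p))"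
    unfolding sum.atMost_Suc_shift sum.lessThan_Suc_shift by (simp add: nths_Cons_delete)
  also have "\<dots> = (\<Sum>j\<le>n. - \<omega> (Zs[j := lie_bracket X (Zs ! j)]) p
          + (\<Sum>i<j. - ((- 1) ^ (i + j)
              * contract X \<omega> (lie_bracket (Zs ! i) (Zs ! j) # nths Zs (- {i, j})) p)))"
    by (intro sum.cong arg_cong2[where f="(+)"] refl) (auto simp: lie swap contract_def simp del: power_Suc)
  also have "\<dots> = - (\<Sum>j\<le>n. \<omega> (Zs[j := lie_bracket X (Zs ! j)]) p)
      - (\<Sum>j\<le>n. \<Sum>i<j. (- 1) ^ (i + j)
              * contract X \<omega> (lie_bracket (Zs ! i) (Zs ! j) # nths Zs (- {i, j})) p)"
    by (simp add: sum_subtractf sum_negf)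
  finally show ?thesis
    unfolding ext_apply[OF Zs] lie_apply[OF Zs] lessThan_Suc_atMost by simp
qed

lemma ext_add:
  assumes w: "\<omega> \<in> \<Omega> n" and h: "\<eta> \<in> \<Omega> n"
  shows "ext_deriv \<A> n (\<omega> + \<eta>) = ext_deriv \<A> n \<omega> + ext_deriv \<A> n \<eta>"
proof (intro ext)
  fix Xs p
  show "ext_deriv \<A> n (\<omega> + \<eta>) Xs p = (ext_deriv \<A> n \<omega> + ext_deriv \<A> n \<eta>) Xs p"
  proof (cases "Xs \<in> L (Suc n)")
    case True
    have "(Xs ! i) ((\<omega> + \<eta>) (nths Xs (- {i}))) p
        = (Xs ! i) (\<omega> (nths Xs (- {i}))) p + (Xs ! i) (\<eta> (nths Xs (- {i}))) p" if "i \<in> {..n}" for i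
      using that vf_add[OF L_nth[OF True] form_smooth[OF w L_delete[OF True]]
          form_smooth[OF h L_delete[OF True]], of i i i] by simp
    then show ?thesis using True by (simp add: ext_apply sum.distrib distrib_left)
  qed (simp add: ext_off)
qed

lemma ext_smult:
  assumes f: "f \<in> S" and w: "\<omega> \<in> \<Omega> n" and Xs: "Xs \<in> L (Suc n)"
  shows "ext_deriv \<A> n (\<lambda>Zs. f * \<omega> Zs) Xs p
    = f p * ext_deriv \<A> n \<omega> Xs p + (\<Sum>m\<le>n. (- 1) ^ m * ((Xs ! m) f p * \<omega> (nths Xs (- {m})) p))"
proof -
  have "(Xs ! i) (f * \<omega> (nths Xs (- {i}))) p
      = f p * (Xs ! i) (\<omega> (nths Xs (- {i}))) p + (Xs ! i) f p * \<omega> (nths Xs (- {i})) p" if "i \<in> {..n}" for i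
    using that vf_mult[OF L_nth[OF Xs] f form_smooth[OF w L_delete[OF Xs]], of i i] by simp
  then show ?thesis
    by (simp add: ext_apply[OF Xs] sum.distrib algebra_simps sum_distrib_left)
qed

lemma ext_zero: "ext_deriv \<A> n 0 = (0 :: 'a form)"
  using ext_add[OF form_closed_zero form_closed_zero, of n] by simp

lemma ext_uminus:
  assumes w: "\<omega> \<in> \<Omega> n"
  shows "ext_deriv \<A> n (- \<omega>) = - ext_deriv \<A> n \<omega>"
proof -
  show ?thesis
    using ext_add[OF w form_closed_uminus[OF w]] ext_zero[of n]
    by (simp add: eq_neg_iff_add_eq_0 add.commute)
qed

lemma ext_diff:
  assumes "\<omega> \<in> \<Omega> n" "\<eta> \<in> \<Omega> n"
  shows "ext_deriv \<A> n (\<omega> - \<eta>) = ext_deriv \<A> n \<omega> - ext_deriv \<A> n \<eta>"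
  unfolding diff_conv_add_uminus ext_add[OF assms(1) form_closed_uminus[OF assms(2)]]
    ext_uminus[OF assms(2)] ..

text \<open>
  The alternating sum defining \<open>d\<close> is far from visibly tensorial. By Cartan's formula,
  \<open>d\<omega>(X, \<dots>)\<close> is the difference of two forms, which settles all arguments but the first; linearity
  over functions in the first argument is a cancellation between the Lie derivative along \<open>f X\<close> and
  the differential of \<open>f\<close>.
\<close>

lemma ext_form: "\<omega> \<in> \<Omega> n \<Longrightarrow> ext_deriv \<A> n \<omega> \<in> \<Omega> (Suc n)"
proof (induction n arbitrary: \<omega>)
  case 0
  note w = form_smooth[OF 0, of "[]", unfolded L_0, simplified]
  have "ext_deriv \<A> 0 \<omega> \<in> \<Omega> 1"
  proof (rule one_formI)
    fix X assume X: "X \<in> V"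
    then show "ext_deriv \<A> 0 \<omega> [X] \<in> S" by (simp add: ext_deriv_function vf_smooth w)
    show "ext_deriv \<A> 0 \<omega> [X + Y] = ext_deriv \<A> 0 \<omega> [X] + ext_deriv \<A> 0 \<omega> [Y]" if "Y \<in> V" for Y
      using X that by (intro ext) (simp add: ext_deriv_function vf_closed_add)
    show "ext_deriv \<A> 0 \<omega> [fun_smult f X] = f * ext_deriv \<A> 0 \<omega> [X]" if "f \<in> S" for f
      using X that by (intro ext) (simp add: ext_deriv_function vf_closed_smult, simp add: fun_smult_def)
  qed (rule ext_off, simp)
  then show ?case by simp
next
  case (Suc n)
  note w = Suc.prems
  define \<theta> where "\<theta> X = lie_derivative \<A> (Suc n) X \<omega> - ext_deriv \<A> n (contract X \<omega>)" for X
  have th: "\<theta> X \<in> \<Omega> (Suc n)" if "X \<in> V" for X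
    unfolding \<theta>_def by (intro form_closed_diff lie_form Suc.IH contract_form w that)
  have Cons: "ext_deriv \<A> (Suc n) \<omega> (X # Zs) = \<theta> X Zs" if "X \<in> V" "Zs \<in> L (Suc n)" for X Zs
    using cartan_formula[OF w that] by (simp add: \<theta>_def fun_eq_iff)
  have add: "\<theta> (X + Y) Zs = \<theta> X Zs + \<theta> Y Zs" if X: "X \<in> V" and Y: "Y \<in> V" and Zs: "Zs \<in> L (Suc n)" for X Y Zs
  proof
    fix p
    have c: "contract (X + Y) \<omega> = contract X \<omega> + contract Y \<omega>"
    proof
      fix Us
      show "contract (X + Y) \<omega> Us = (contract X \<omega> + contract Y \<omega>) Us"
      proof (cases "Us \<in> L n")
        case True
        then have "X # Us \<in> L (Suc n)" using X by (simp add: L_Cons)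
        from form_add[OF w this _ X Y, of 0] show ?thesis by (simp add: contract_def)
      qed (simp add: contract_def form_off[OF w] L_Cons)
    qed
    have b: "\<omega> (Zs[i := lie_bracket (X + Y) (Zs ! i)]) p
        = \<omega> (Zs[i := lie_bracket X (Zs ! i)]) p + \<omega> (Zs[i := lie_bracket Y (Zs ! i)]) p"
      if "i < Suc n" for i
      unfolding bracket_add_left[OF X Y L_nth[OF Zs that]]
      using form_add[OF w Zs that vf_closed_bracket[OF X L_nth[OF Zs that]]
          vf_closed_bracket[OF Y L_nth[OF Zs that]]] by simp
    have "(\<Sum>i<Suc n. \<omega> (Zs[i := lie_bracket (X + Y) (Zs ! i)]) p)
        = (\<Sum>i<Suc n. \<omega> (Zs[i := lie_bracket X (Zs ! i)]) p)
          + (\<Sum>i<Suc n. \<omega> (Zs[i := lie_bracket Y (Zs ! i)]) p)"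
      unfolding sum.distrib[symmetric] by (intro sum.cong refl b) simp
    then show "\<theta> (X + Y) Zs p = (\<theta> X Zs + \<theta> Y Zs) p"
      unfolding \<theta>_def c ext_add[OF contract_form[OF w X] contract_form[OF w Y]]
      by (simp add: lie_apply[OF Zs] del: sum.lessThan_Suc)
  qed
  have smult: "\<theta> (fun_smult f X) Zs = f * \<theta> X Zs" if X: "X \<in> V" and f: "f \<in> S" and Zs: "Zs \<in> L (Suc n)" for X f Zs
  proof
    fix p
    have c: "contract (fun_smult f X) \<omega> = (\<lambda>Us. f * contract X \<omega> Us)"
    proof
      fix Us
      show "contract (fun_smult f X) \<omega> Us = f * contract X \<omega> Us"
      proof (cases "Us \<in> L n")
        case True
        then have "X # Us \<in> L (Suc n)" using X by (simp add: L_Cons)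
        from form_smult[OF w this _ X f, of 0] show ?thesis by (simp add: contract_def)
      qed (simp add: contract_def form_off[OF w] L_Cons)
    qed
    have b: "\<omega> (Zs[i := lie_bracket (fun_smult f X) (Zs ! i)]) p
        = f p * \<omega> (Zs[i := lie_bracket X (Zs ! i)]) p
          - (- 1) ^ i * ((Zs ! i) f p * contract X \<omega> (nths Zs (- {i})) p)"
      if "i < Suc n" for i
    proof -
      note Z = L_nth[OF Zs that]
      have "\<omega> (Zs[i := lie_bracket (fun_smult f X) (Zs ! i)]) p
          = f p * \<omega> (Zs[i := lie_bracket X (Zs ! i)]) p - (Zs ! i) f p * \<omega> (Zs[i := X]) p"
        unfolding bracket_smult_left[OF X Z f]
        using form_diff_slot[OF w Zs that vf_closed_smult[OF vf_closed_bracket[OF X Z] f]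
            vf_closed_smult[OF X vf_smooth[OF Z f]]]
          form_smult[OF w Zs that vf_closed_bracket[OF X Z] f]
          form_smult[OF w Zs that X vf_smooth[OF Z f]] by simp
      moreover have "\<omega> (Zs[i := X]) p = (- 1) ^ i * contract X \<omega> (nths Zs (- {i})) p"
        using form_head_to_slot[OF w Zs that X, of p] by (simp add: contract_def flip: power_add mult_2)
      ultimately show ?thesis by simp
    qed
    have "(\<Sum>i<Suc n. \<omega> (Zs[i := lie_bracket (fun_smult f X) (Zs ! i)]) p)
        = f p * (\<Sum>i<Suc n. \<omega> (Zs[i := lie_bracket X (Zs ! i)]) p)
          - (\<Sum>i\<le>n. (- 1) ^ i * ((Zs ! i) f p * contract X \<omega> (nths Zs (- {i})) p))"
      unfolding lessThan_Suc_atMost sum_distrib_left sum_subtractf[symmetric]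
      by (intro sum.cong refl b) simp
    then show "\<theta> (fun_smult f X) Zs p = (f * \<theta> X Zs) p"
      unfolding \<theta>_def c
      by (simp add: lie_apply[OF Zs] ext_smult[OF f contract_form[OF w X] Zs] fun_smult_def
          right_diff_distrib del: sum.lessThan_Suc sum.atMost_Suc)
  qed
  have self: "\<theta> X (X # Us) = 0" if X: "X \<in> V" and Us: "Us \<in> L n" for X Us
  proof
    fix p
    have XUs: "X # Us \<in> L (Suc n)" using X Us by (simp add: L_Cons)
    have z: "\<omega> (0 # Us) = 0" using form_zero_slot[OF w XUs, of 0] by simp
    have cc: "contract X (contract X \<omega>) = 0" if "n = Suc m" for m
    proof
      fix Vs
      show "contract X (contract X \<omega>) Vs = 0 Vs"
      proof (cases "X # X # Vs \<in> L (Suc n)")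
        case True
        then show ?thesis using form_alt[OF w True, of 0 1] that by (simp add: contract_def)
      qed (simp add: contract_def form_off[OF w])
    qed
    have "ext_deriv \<A> n (contract X \<omega>) (X # Us) p
        = X (\<omega> (X # Us)) p - (\<Sum>i<n. \<omega> (X # Us[i := lie_bracket X (Us ! i)]) p)"
    proof (cases n)
      case 0
      then show ?thesis using Us X by (simp add: L_0 ext_deriv_function contract_def)
    next
      case (Suc m)
      have "ext_deriv \<A> m (contract X (contract X \<omega>)) Us p = 0"
        using ext_add[OF form_closed_zero form_closed_zero, of m] by (simp add: cc[OF Suc])
      then show ?thesis
        using cartan_formula[of "contract X \<omega>" m X Us p] contract_form[OF w X] X Us Suc
        by (simp add: lie_apply contract_def)
    qed
    moreover have "lie_derivative \<A> (Suc n) X \<omega> (X # Us) p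
        = X (\<omega> (X # Us)) p - (\<Sum>i<n. \<omega> (X # Us[i := lie_bracket X (Us ! i)]) p)"
      unfolding lie_apply[OF XUs] sum.lessThan_Suc_shift by (simp add: bracket_self z)
    ultimately show "\<theta> X (X # Us) p = 0 p" by (simp add: \<theta>_def)
  qed
  show ?case
  proof (rule formI)
    fix Xs assume "Xs \<in> L (Suc (Suc n))"
    then obtain Z Zs where Xs: "Xs = Z # Zs" "Z \<in> V" "Zs \<in> L (Suc n)" by (rule L_Suc_cases)
    show "ext_deriv \<A> (Suc n) \<omega> Xs \<in> S"
      using form_smooth[OF th] Xs by (simp add: Cons)
    fix i assume i: "i < Suc (Suc n)"
    show "ext_deriv \<A> (Suc n) \<omega> (Xs[i := X + Y])
        = ext_deriv \<A> (Suc n) \<omega> (Xs[i := X]) + ext_deriv \<A> (Suc n) \<omega> (Xs[i := Y])"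
      if X: "X \<in> V" and Y: "Y \<in> V" for X Y
    proof (cases i)
      case 0
      then show ?thesis using Xs X Y add[OF X Y Xs(3)] by (simp add: Cons vf_closed_add)
    next
      case (Suc m)
      then show ?thesis using Xs X Y i form_add[OF th[OF Xs(2)] Xs(3) _ X Y, of m]
        by (simp add: Cons L_update vf_closed_add)
    qed
    show "ext_deriv \<A> (Suc n) \<omega> (Xs[i := fun_smult f X]) = f * ext_deriv \<A> (Suc n) \<omega> (Xs[i := X])"
      if X: "X \<in> V" and f: "f \<in> S" for X f
    proof (cases i)
      case 0
      then show ?thesis using Xs X f smult[OF X f Xs(3)] by (simp add: Cons vf_closed_smult)
    next
      case (Suc m)
      then show ?thesis using Xs X f i form_smult[OF th[OF Xs(2)] Xs(3) _ X f, of m]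
        by (simp add: Cons L_update vf_closed_smult)
    qed
    fix j assume j: "j < Suc (Suc n)" and ij: "i \<noteq> j" and eq: "Xs ! i = Xs ! j"
    have head: "\<theta> Z Zs = 0" if m: "m < Suc n" and Zm: "Zs ! m = Z" for m
    proof (cases m)
      case 0
      then obtain Us where "Zs = Z # Us" "Us \<in> L n"
        using Xs(3) Zm by (elim L_Suc_cases) auto
      then show ?thesis using self Xs(2) by simp
    next
      case (Suc m')
      let ?Ws = "Zs[0 := Zs ! m, m := Zs ! 0]"
      obtain Us where Ws: "?Ws = Z # Us" "Us \<in> L n"
      proof -
        have "?Ws \<in> L (Suc n)" using Xs(3) m by (auto intro!: L_update L_nth[OF Xs(3)])
        then obtain U Us where "?Ws = U # Us" "Us \<in> L n" by (rule L_Suc_cases)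
        moreover have "?Ws ! 0 = Z" using Xs(3) Zm Suc by (simp add: L_iff)
        ultimately show ?thesis using that by simp
      qed
      show ?thesis
        using form_swap[OF th[OF Xs(2)] Xs(3), of 0 m] m Suc self[OF Xs(2) Ws(2)]
        unfolding Ws by simp
    qed
    show "ext_deriv \<A> (Suc n) \<omega> Xs = 0"
    proof (cases i)
      case 0
      then show ?thesis using head[of "j - 1"] ij eq j Xs by (cases j) (auto simp: Cons)
    next
      case (Suc i')
      note i' = this
      show ?thesis
      proof (cases j)
        case 0
        then show ?thesis using head[of i'] i' eq i Xs by (auto simp: Cons)
      next
        case (Suc j')
        then show ?thesis using form_alt[OF th[OF Xs(2)] Xs(3), of i' j'] i' ij eq i j Xs
          by (auto simp: Cons)
      qed
    qed
  qed (rule ext_off)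
qed

end


section \<open>Wedge products of one-forms as determinants\<close>

lemma sign_compose_permutes:
  assumes "\<sigma> permutes I" "\<tau> permutes I" "finite I"
  shows "sign (\<sigma> \<circ> \<tau>) = sign \<sigma> * sign \<tau>"
  using assms permutation_permutes by (intro sign_compose) blast+

lemma permutes_lessThan: "\<tau> permutes {..<n} \<Longrightarrow> i < n \<Longrightarrow> \<tau> i < n"
  using permutes_in_image[of \<tau> "{..<n}" i] by simp

text \<open>
  Composition with \<open>t\<close> is a sign-reversing bijection of the summands. With a transposition for \<open>t\<close>, this
  discards every expansion in which a one-form occurs twice.
\<close>

lemma sum_permutations_odd:
  fixes g :: "(nat \<Rightarrow> nat) \<Rightarrow> real"
  assumes "t permutes I" and "\<And>\<sigma>. \<sigma> permutes I \<Longrightarrow> g (\<sigma> \<circ> t) = - g \<sigma>"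
  shows "(\<Sum>\<sigma> | \<sigma> permutes I. g \<sigma>) = 0"
proof -
  have "(\<Sum>\<sigma> | \<sigma> permutes I. g \<sigma>) = (\<Sum>\<sigma> | \<sigma> permutes I. g (\<sigma> \<circ> t))"
    by (rule sum_permutations_compose_right[OF assms(1)])
  also have "\<dots> = - (\<Sum>\<sigma> | \<sigma> permutes I. g \<sigma>)"
    unfolding sum_negf[symmetric] by (intro sum.cong refl assms(2)) simp
  finally show ?thesis by simp
qed

text \<open>
  An inner sum over permutations of some of the arguments is absorbed by the outer sum over
  permutations of all of them. The factorials in the definition of the wedge product compensate for
  the resulting factor.
\<close>

lemma sum_permutations_absorb:
  fixes g :: "(nat \<Rightarrow> nat) \<Rightarrow> real"
  assumes "\<And>\<tau>. \<tau> \<in> P \<Longrightarrow> \<tau>' \<tau> permutes I"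
    and "\<And>\<sigma> \<tau>. \<sigma> permutes I \<Longrightarrow> \<tau> \<in> P \<Longrightarrow> h \<sigma> \<tau> = g (\<sigma> \<circ> \<tau>' \<tau>)"
  shows "(\<Sum>\<sigma> | \<sigma> permutes I. \<Sum>\<tau>\<in>P. h \<sigma> \<tau>) = real (card P) * (\<Sum>\<sigma> | \<sigma> permutes I. g \<sigma>)"
proof -
  have "(\<Sum>\<sigma> | \<sigma> permutes I. \<Sum>\<tau>\<in>P. h \<sigma> \<tau>) = (\<Sum>\<tau>\<in>P. \<Sum>\<sigma> | \<sigma> permutes I. g (\<sigma> \<circ> \<tau>' \<tau>))"
    by (subst sum.swap) (intro sum.cong refl assms(2), auto)
  also have "\<dots> = (\<Sum>\<tau>\<in>P. \<Sum>\<sigma> | \<sigma> permutes I. g \<sigma>)"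
    by (intro sum.cong refl sum_permutations_compose_right[symmetric] assms(1))
  finally show ?thesis by simp
qed

text \<open>
  The permutations of the first \<open>n\<close> arguments that come with the inner wedge product are absorbed,
  which leaves the Leibniz expansion of the determinant of \<open>\<alpha>\<^sub>i(Z\<^sub>j)\<close>.
\<close>

lemma wedge_list_det:
  "length Zs = n \<Longrightarrow> wedge_list n \<alpha> Zs p
    = (\<Sum>\<tau> | \<tau> permutes {..<n}. of_int (sign \<tau>) * (\<Prod>i<n. \<alpha> i [Zs ! \<tau> i] p))"
proof (induction n arbitrary: Zs)
  case 0
  then show ?case by simp
next
  case (Suc n)
  let ?P = "{\<tau>. \<tau> permutes {..<n}}"
  let ?g = "\<lambda>\<sigma>. of_int (sign \<sigma>) * (\<Prod>i<Suc n. \<alpha> i [Zs ! \<sigma> i] p)"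
  have inner: "wedge_list n \<alpha> (map (\<lambda>i. Zs ! \<sigma> i) [0..<n]) p
      = (\<Sum>\<tau>\<in>?P. of_int (sign \<tau>) * (\<Prod>i<n. \<alpha> i [Zs ! \<sigma> (\<tau> i)] p))" for \<sigma>
    by (subst Suc.IH) (auto intro!: sum.cong prod.cong arg_cong2[where f="(*)"] simp: permutes_lessThan)
  have "wedge_list (Suc n) \<alpha> Zs p = (\<Sum>\<sigma> | \<sigma> permutes {..<Suc n}. \<Sum>\<tau>\<in>?P.
      of_int (sign \<sigma>) * (of_int (sign \<tau>) * (\<Prod>i<n. \<alpha> i [Zs ! \<sigma> (\<tau> i)] p)) * \<alpha> n [Zs ! \<sigma> n] p) / fact n"
    using Suc.prems by (simp add: wedge_def inner sum_distrib_left sum_distrib_right)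
  also have "(\<Sum>\<sigma> | \<sigma> permutes {..<Suc n}. \<Sum>\<tau>\<in>?P.
      of_int (sign \<sigma>) * (of_int (sign \<tau>) * (\<Prod>i<n. \<alpha> i [Zs ! \<sigma> (\<tau> i)] p)) * \<alpha> n [Zs ! \<sigma> n] p)
      = real (card ?P) * (\<Sum>\<sigma> | \<sigma> permutes {..<Suc n}. ?g \<sigma>)"
  proof (rule sum_permutations_absorb[where \<tau>'="\<lambda>\<tau>. \<tau>"])
    show "\<tau> permutes {..<Suc n}" if "\<tau> \<in> ?P" for \<tau>
      using that by (auto intro: permutes_subset)
    show "of_int (sign \<sigma>) * (of_int (sign \<tau>) * (\<Prod>i<n. \<alpha> i [Zs ! \<sigma> (\<tau> i)] p)) * \<alpha> n [Zs ! \<sigma> n] p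
        = ?g (\<sigma> \<circ> \<tau>)" if "\<sigma> permutes {..<Suc n}" "\<tau> \<in> ?P" for \<sigma> \<tau>
    proof -
      have "\<tau> n = n" using that(2) by (auto intro: permutes_not_in)
      moreover have "sign (\<sigma> \<circ> \<tau>) = sign \<sigma> * sign \<tau>"
        using that by (intro sign_compose_permutes[where I="{..<Suc n}"]) (auto intro: permutes_subset)
      ultimately show ?thesis by simp
    qed
  qed
  finally show ?case by (simp add: card_permutations)
qed

lemma wedge_list_length: "length Zs \<noteq> n \<Longrightarrow> wedge_list n \<alpha> Zs = 0"
  by (cases n) (auto simp: wedge_def fun_eq_iff)

text \<open>
  The permutations in the expansion of the determinant act on the last \<open>k\<close> positions, and are shifted
  by \<open>s\<close> before they are absorbed.
\<close>

lemma wedge_mu: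
  assumes "length Zs = s + k"
  shows "wedge s k \<beta> (wedge_list k \<alpha>) Zs p
    = (\<Sum>\<sigma> | \<sigma> permutes {..<s + k}. of_int (sign \<sigma>) * \<beta> (map (\<lambda>i. Zs ! \<sigma> i) [0..<s]) p
        * (\<Prod>i<k. \<alpha> i [Zs ! \<sigma> (s + i)] p)) / fact s"
proof -
  let ?P = "{\<tau>. \<tau> permutes {..<k}}"
  let ?g = "\<lambda>\<sigma>. of_int (sign \<sigma>) * \<beta> (map (\<lambda>i. Zs ! \<sigma> i) [0..<s]) p
        * (\<Prod>i<k. \<alpha> i [Zs ! \<sigma> (s + i)] p)"
  define sh where "sh = map_permutation {..<k} ((+) s)"
  have bij: "bij_betw ((+) s) {..<k} {s..<s + k}"
    using image_add_atLeastLessThan[of s 0 k]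
    by (auto simp: bij_betw_def lessThan_atLeast0)
  have inj: "inj_on ((+) s) {..<k}" by simp
  have sh0: "sh \<tau> permutes {s..<s + k}" if "\<tau> \<in> ?P" for \<tau>
    unfolding sh_def by (rule map_permutation_permutes[OF bij]) (use that in simp)
  have sh: "sh \<tau> permutes {..<s + k}" if "\<tau> \<in> ?P" for \<tau>
    by (rule permutes_subset[OF sh0[OF that]]) auto
  have inner: "wedge_list k \<alpha> (map (\<lambda>i. Zs ! \<sigma> i) [s..<s + k]) p
      = (\<Sum>\<tau>\<in>?P. of_int (sign \<tau>) * (\<Prod>i<k. \<alpha> i [Zs ! \<sigma> (s + \<tau> i)] p))" for \<sigma>
    by (subst wedge_list_det)
      (auto intro!: sum.cong prod.cong arg_cong2[where f="(*)"] simp: permutes_lessThan)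
  have "wedge s k \<beta> (wedge_list k \<alpha>) Zs p = (\<Sum>\<sigma> | \<sigma> permutes {..<s + k}. \<Sum>\<tau>\<in>?P.
      of_int (sign \<sigma>) * \<beta> (map (\<lambda>i. Zs ! \<sigma> i) [0..<s]) p
        * (of_int (sign \<tau>) * (\<Prod>i<k. \<alpha> i [Zs ! \<sigma> (s + \<tau> i)] p))) / (fact s * fact k)"
    using assms by (simp add: wedge_def inner sum_distrib_left)
  also have "(\<Sum>\<sigma> | \<sigma> permutes {..<s + k}. \<Sum>\<tau>\<in>?P.
      of_int (sign \<sigma>) * \<beta> (map (\<lambda>i. Zs ! \<sigma> i) [0..<s]) p
        * (of_int (sign \<tau>) * (\<Prod>i<k. \<alpha> i [Zs ! \<sigma> (s + \<tau> i)] p)))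
      = real (card ?P) * (\<Sum>\<sigma> | \<sigma> permutes {..<s + k}. ?g \<sigma>)"
  proof (rule sum_permutations_absorb[where \<tau>'=sh, OF sh])
    fix \<sigma> \<tau> assume s: "\<sigma> permutes {..<s + k}" and t: "\<tau> \<in> ?P"
    have a: "sign (\<sigma> \<circ> sh \<tau>) = sign \<sigma> * sign \<tau>"
      using sign_compose_permutes[OF s sh[OF t]] sign_map_permutation[OF inj, of \<tau>] t
      by (simp add: sh_def)
    have b: "map (\<lambda>i. Zs ! (\<sigma> \<circ> sh \<tau>) i) [0..<s] = map (\<lambda>i. Zs ! \<sigma> i) [0..<s]"
      using permutes_not_in[OF sh0[OF t]] by auto
    have c: "(\<Prod>i<k. \<alpha> i [Zs ! (\<sigma> \<circ> sh \<tau>) (s + i)] p) = (\<Prod>i<k. \<alpha> i [Zs ! \<sigma> (s + \<tau> i)] p)"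
      by (intro prod.cong refl) (auto simp: sh_def map_permutation_apply[OF inj])
    show "of_int (sign \<sigma>) * \<beta> (map (\<lambda>i. Zs ! \<sigma> i) [0..<s]) p
        * (of_int (sign \<tau>) * (\<Prod>i<k. \<alpha> i [Zs ! \<sigma> (s + \<tau> i)] p)) = ?g (\<sigma> \<circ> sh \<tau>)"
      unfolding a b c by simp
  qed
  finally show ?thesis by (simp add: card_permutations)
qed

context smooth_atlas
begin

text \<open>
  Each product in the Leibniz expansion contains each argument exactly once.
\<close>

lemma wedge_list_form:
  assumes al: "\<And>i. i < k \<Longrightarrow> \<alpha> i \<in> \<Omega> 1"
  shows "wedge_list k \<alpha> \<in> \<Omega> k"
proof -
  have slot: "\<exists>a<k. \<forall>Y. (\<Prod>i<k. \<alpha> i [Zs[m := Y] ! \<tau> i] p) = \<alpha> a [Y] p * (\<Prod>i\<in>{..<k} - {a}. \<alpha> i [Zs ! \<tau> i] p)"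
    if Zs: "length Zs = k" and m: "m < k" and t: "\<tau> permutes {..<k}" for Zs \<tau> m p
  proof -
    obtain a where a: "\<tau> a = m" "a < k"
      using permutes_image[OF t] m by (metis imageE lessThan_iff)
    have "(\<Prod>i<k. \<alpha> i [Zs[m := Y] ! \<tau> i] p)
        = \<alpha> a [Y] p * (\<Prod>i\<in>{..<k} - {a}. \<alpha> i [Zs[m := Y] ! \<tau> i] p)" for Y
      using a Zs m by (subst prod.remove[of _ a]) auto
    moreover have "(\<Prod>i\<in>{..<k} - {a}. \<alpha> i [Zs[m := Y] ! \<tau> i] p) = (\<Prod>i\<in>{..<k} - {a}. \<alpha> i [Zs ! \<tau> i] p)" for Y
    proof (intro prod.cong refl)
      fix i assume "i \<in> {..<k} - {a}"
      then have "m \<noteq> \<tau> i" using a(1) permutes_inj[OF t] by (auto dest: injD)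
      then show "\<alpha> i [Zs[m := Y] ! \<tau> i] p = \<alpha> i [Zs ! \<tau> i] p" by simp
    qed
    ultimately show ?thesis using a(2) by (intro exI[of _ a]) simp
  qed
  show ?thesis
  proof (rule formI)
    fix Zs assume Zs: "Zs \<in> L k"
    have "wedge_list k \<alpha> Zs
        = (\<Sum>\<tau> | \<tau> permutes {..<k}. (\<lambda>_. of_int (sign \<tau>)) * (\<Prod>i<k. \<alpha> i [Zs ! \<tau> i]))"
      using Zs by (intro ext) (simp add: wedge_list_det L_iff sum_fun_apply prod_fun_apply)
    also have "\<dots> \<in> S"
      by (intro smooth_sum smooth_mult smooth_const smooth_prod one_form(1)[OF al] L_nth[OF Zs])
        (auto intro: permutes_lessThan)
    finally show "wedge_list k \<alpha> Zs \<in> S" .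
  next
    fix Zs m Y Z assume Zs: "Zs \<in> L k" and m: "m < k" and YZ: "Y \<in> V" "Z \<in> V"
    have "(\<Prod>i<k. \<alpha> i [Zs[m := Y + Z] ! \<tau> i] p)
        = (\<Prod>i<k. \<alpha> i [Zs[m := Y] ! \<tau> i] p) + (\<Prod>i<k. \<alpha> i [Zs[m := Z] ! \<tau> i] p)"
      if t: "\<tau> permutes {..<k}" for \<tau> p
    proof -
      from slot[OF _ m t, of Zs p] Zs obtain a where "a < k"
        "\<And>Y. (\<Prod>i<k. \<alpha> i [Zs[m := Y] ! \<tau> i] p) = \<alpha> a [Y] p * (\<Prod>i\<in>{..<k} - {a}. \<alpha> i [Zs ! \<tau> i] p)"
        by (auto simp: L_iff)
      then show ?thesis using one_form(2)[OF al YZ] by (simp add: distrib_right)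
    qed
    then show "wedge_list k \<alpha> (Zs[m := Y + Z]) = wedge_list k \<alpha> (Zs[m := Y]) + wedge_list k \<alpha> (Zs[m := Z])"
      using Zs by (intro ext) (simp add: wedge_list_det L_iff sum.distrib distrib_left)
  next
    fix Zs m Y f assume Zs: "Zs \<in> L k" and m: "m < k" and Y: "Y \<in> V" and f: "f \<in> S"
    have "(\<Prod>i<k. \<alpha> i [Zs[m := fun_smult f Y] ! \<tau> i] p) = f p * (\<Prod>i<k. \<alpha> i [Zs[m := Y] ! \<tau> i] p)"
      if t: "\<tau> permutes {..<k}" for \<tau> p
    proof -
      from slot[OF _ m t, of Zs p] Zs obtain a where "a < k"
        "\<And>Y. (\<Prod>i<k. \<alpha> i [Zs[m := Y] ! \<tau> i] p) = \<alpha> a [Y] p * (\<Prod>i\<in>{..<k} - {a}. \<alpha> i [Zs ! \<tau> i] p)"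
        by (auto simp: L_iff)
      then show ?thesis using one_form(5)[OF al Y f] by simp
    qed
    then show "wedge_list k \<alpha> (Zs[m := fun_smult f Y]) = f * wedge_list k \<alpha> (Zs[m := Y])"
      using Zs by (intro ext) (simp add: wedge_list_det L_iff sum_distrib_left mult.left_commute)
  next
    fix Zs i j assume Zs: "Zs \<in> L k" and ij: "i < k" "j < k" "i \<noteq> j" and eq: "Zs ! i = Zs ! j"
    let ?t = "Transposition.transpose i j"
    have t: "?t permutes {..<k}" using ij by (intro permutes_swap_id) auto
    have Zt: "Zs ! ?t l = Zs ! l" for l
      using eq by (simp add: Transposition.transpose_def)
    show "wedge_list k \<alpha> Zs = 0"
    proof
      fix p
      let ?g = "\<lambda>\<tau>. of_int (sign \<tau>) * (\<Prod>i<k. \<alpha> i [Zs ! \<tau> i] p)"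
      have "(\<Sum>\<tau> | \<tau> permutes {..<k}. ?g \<tau>) = (\<Sum>\<tau> | \<tau> permutes {..<k}. - ?g \<tau>)"
      proof (rule sum.reindex_bij_witness[where i="\<lambda>\<tau>. ?t \<circ> \<tau>" and j="\<lambda>\<tau>. ?t \<circ> \<tau>"])
        fix \<tau> assume "\<tau> \<in> {\<tau>. \<tau> permutes {..<k}}"
        then have tau: "\<tau> permutes {..<k}" by simp
        show "?t \<circ> (?t \<circ> \<tau>) = \<tau>" "?t \<circ> (?t \<circ> \<tau>) = \<tau>" by (simp_all add: o_assoc)
        show "?t \<circ> \<tau> \<in> {\<tau>. \<tau> permutes {..<k}}" "?t \<circ> \<tau> \<in> {\<tau>. \<tau> permutes {..<k}}"
          using permutes_compose[OF tau t] by simp_all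
        have "sign (?t \<circ> \<tau>) = - sign \<tau>"
          using sign_compose_permutes[OF t tau finite_lessThan] ij by (simp add: sign_swap_id)
        then show "- ?g (?t \<circ> \<tau>) = ?g \<tau>" by (simp add: Zt)
      qed
      then have "(\<Sum>\<tau> | \<tau> permutes {..<k}. ?g \<tau>) = 0" by (simp add: sum_negf)
      then show "wedge_list k \<alpha> Zs p = 0 p" using Zs by (simp add: wedge_list_det L_iff)
    qed
  next
    fix Zs assume Zs: "Zs \<notin> L k"
    show "wedge_list k \<alpha> Zs = 0"
    proof (cases "length Zs = k")
      case True
      then have "\<not> set Zs \<subseteq> V" using Zs by (simp add: L_iff)
      then obtain m where m: "m < k" "Zs ! m \<notin> V" using True by (metis in_set_conv_nth subsetI)
      then have off: "\<alpha> a [Zs ! m] = 0" if "a < k" for a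
        using form_off[OF al[OF that]] by (simp add: L_iff)
      have "(\<Prod>i<k. \<alpha> i [Zs ! \<tau> i] p) = 0" if t: "\<tau> permutes {..<k}" for \<tau> p
      proof -
        obtain a where "\<tau> a = m" "a < k" using permutes_image[OF t] m by (metis imageE lessThan_iff)
        then have "\<alpha> a [Zs ! \<tau> a] p = 0" "a \<in> {..<k}" using off by simp_all
        then show ?thesis by (intro prod_zero) auto
      qed
      then show ?thesis using True by (intro ext) (simp add: wedge_list_det del: prod_zero_iff)
    qed (rule wedge_list_length)
  qed
qed

end


section \<open>Coframes with dual vector fields\<close>

locale coframe = smooth_atlas \<A>
  for \<A> :: "('a::{t2_space, second_countable_topology}, 'e::euclidean_space) chart set" +
  fixes k :: nat and \<alpha> :: "nat \<Rightarrow> 'a form" and X :: "nat \<Rightarrow> 'a vfield"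
  assumes coframe: "i < k \<Longrightarrow> \<alpha> i \<in> \<Omega> 1"
    and dual: "dual_fields \<A> k \<alpha> X"
begin

abbreviation "\<mu> \<equiv> wedge_list k \<alpha>"

text \<open>The sections of the distribution that the coframe annihilates.\<close>

definition T :: "'a vfield set" where
  "T = {Y \<in> V. \<forall>i<k. \<alpha> i [Y] = 0}"

lemma dual_vf: "j < k \<Longrightarrow> X j \<in> V"
  using dual by (simp add: dual_fields_def)

lemma dual_eval: "i < k \<Longrightarrow> j < k \<Longrightarrow> \<alpha> i [X j] p = (if i = j then 1 else 0)"
  using dual by (simp add: dual_fields_def)

lemma T_vf: "Y \<in> T \<Longrightarrow> Y \<in> V"
  by (simp add: T_def)

lemma T_eval: "Y \<in> T \<Longrightarrow> i < k \<Longrightarrow> \<alpha> i [Y] p = 0"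
  by (simp add: T_def)

definition proj :: "'a vfield \<Rightarrow> 'a vfield" where
  "proj Y = Y - (\<Sum>j<k. fun_smult (\<alpha> j [Y]) (X j))"

lemma normal_vf: "Y \<in> V \<Longrightarrow> (\<Sum>j<k. fun_smult (\<alpha> j [Y]) (X j)) \<in> V"
  by (intro vf_closed_sum vf_closed_smult) (auto simp: dual_vf one_form(1)[OF coframe])

lemma proj_T:
  assumes Y: "Y \<in> V"
  shows "proj Y \<in> T"
proof -
  have "\<alpha> i [proj Y] = 0" if i: "i < k" for i
  proof
    fix p
    have "\<alpha> i [proj Y] p = \<alpha> i [Y] p - (\<Sum>j<k. \<alpha> j [Y] p * \<alpha> i [X j] p)"
      unfolding proj_def one_form(3)[OF coframe[OF i] Y normal_vf[OF Y]]
      using one_form_sum[OF coframe[OF i], of "{..<k}" X "\<lambda>j. \<alpha> j [Y]"]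
      by (simp add: dual_vf one_form(1)[OF coframe] Y)
    also have "(\<Sum>j<k. \<alpha> j [Y] p * \<alpha> i [X j] p) = (\<Sum>j<k. if j = i then \<alpha> i [Y] p else 0)"
      by (intro sum.cong refl) (use i in \<open>auto simp: dual_eval\<close>)
    also have "\<dots> = \<alpha> i [Y] p" using i by simp
    finally show "\<alpha> i [proj Y] p = 0 p" by simp
  qed
  moreover have "proj Y \<in> V" unfolding proj_def by (intro vf_closed_diff Y normal_vf)
  ultimately show ?thesis by (simp add: T_def)
qed

text \<open>Every vector field is a combination of the dual fields up to a tangent one.\<close>

lemma form_expand_slot:
  assumes w: "\<omega> \<in> \<Omega> n" and Zs: "Zs \<in> L n" and i: "i < n" and Y: "Y \<in> V"
  shows "\<omega> (Zs[i := Y]) p = \<omega> (Zs[i := proj Y]) p + (\<Sum>j<k. \<alpha> j [Y] p * \<omega> (Zs[i := X j]) p)"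
proof -
  have "Y = proj Y + (\<Sum>j<k. fun_smult (\<alpha> j [Y]) (X j))" by (simp add: proj_def)
  then have "\<omega> (Zs[i := Y]) = \<omega> (Zs[i := proj Y + (\<Sum>j<k. fun_smult (\<alpha> j [Y]) (X j))])"
    by (rule arg_cong)
  also have "\<dots> = \<omega> (Zs[i := proj Y]) + \<omega> (Zs[i := \<Sum>j<k. fun_smult (\<alpha> j [Y]) (X j)])"
    by (rule form_add[OF w Zs i T_vf[OF proj_T[OF Y]] normal_vf[OF Y]])
  finally show ?thesis
    using form_sum_slot[OF w Zs i, of "{..<k}" X "\<lambda>j. \<alpha> j [Y]" p]
    by (simp add: dual_vf one_form(1)[OF coframe] Y)
qed

lemma one_form_expand:
  assumes "\<omega> \<in> \<Omega> 1" "\<And>Z. Z \<in> T \<Longrightarrow> \<omega> [Z] = 0" "Y \<in> V"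
  shows "\<omega> [Y] p = (\<Sum>j<k. \<alpha> j [Y] p * \<omega> [X j] p)"
  using form_expand_slot[OF assms(1) _ _ assms(3), of "[Y]" 0 p] assms(2)[OF proj_T[OF assms(3)]] assms(3)
  by (simp add: L_iff)

lemma mu_form: "\<mu> \<in> \<Omega> k"
  by (rule wedge_list_form[OF coframe])

lemma mu_dual: "\<mu> (map X [0..<k]) p = 1"
proof -
  have prod: "(\<Prod>i<k. \<alpha> i [map X [0..<k] ! \<tau> i] p) = (if \<tau> = id then 1 else 0)"
    if t: "\<tau> permutes {..<k}" for \<tau>
  proof (cases "\<tau> = id")
    case True
    then show ?thesis by (simp add: dual_eval)
  next
    case False
    then obtain i where i: "\<tau> i \<noteq> i" by (auto simp: fun_eq_iff)
    then have "i < k" using permutes_not_in[OF t, of i] by auto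
    then have "\<alpha> i [map X [0..<k] ! \<tau> i] p = 0"
      using i permutes_lessThan[OF t] by (simp add: dual_eval)
    then have "(\<Prod>i<k. \<alpha> i [map X [0..<k] ! \<tau> i] p) = 0"
      using \<open>i < k\<close> by (intro prod_zero) auto
    then show ?thesis using False by simp
  qed
  have "\<mu> (map X [0..<k]) p
      = (\<Sum>\<tau> | \<tau> permutes {..<k}. of_int (sign \<tau>) * (\<Prod>i<k. \<alpha> i [map X [0..<k] ! \<tau> i] p))"
    by (rule wedge_list_det) simp
  also have "\<dots> = (\<Sum>\<tau> | \<tau> permutes {..<k}. if \<tau> = id then 1 else 0)"
    by (intro sum.cong refl) (auto simp: prod)
  also have "\<dots> = 1"
    by (subst sum.delta) (auto simp: finite_permutations permutes_id)
  finally show ?thesis .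
qed

lemma mu_tangent:
  assumes Zs: "Zs \<in> L k" and m: "m < k" "Zs ! m \<in> T"
  shows "\<mu> Zs = 0"
proof
  fix p
  have "(\<Prod>i<k. \<alpha> i [Zs ! \<tau> i] p) = 0" if t: "\<tau> permutes {..<k}" for \<tau>
  proof -
    obtain a where "\<tau> a = m" "a < k" using permutes_image[OF t] m by (metis imageE lessThan_iff)
    then show ?thesis using T_eval[OF m(2)] by (intro prod_zero) auto
  qed
  then show "\<mu> Zs p = 0 p" using Zs by (simp add: wedge_list_det L_iff del: prod_zero_iff)
qed

text \<open>
  A form that vanishes as soon as one argument is tangent is determined by its values on the dual
  fields, and by alternation only lists of pairwise distinct dual fields can give a nonzero value.
  There is no such list of length above \<open>k\<close>, and up to order only one of length \<open>k\<close>.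
\<close>

lemma transverse_form_zero:
  assumes w: "\<omega> \<in> \<Omega> n"
    and tan: "\<And>Zs m. Zs \<in> L n \<Longrightarrow> m < n \<Longrightarrow> Zs ! m \<in> T \<Longrightarrow> \<omega> Zs = 0"
    and top: "k < n \<or> k = n \<and> \<omega> (map X [0..<k]) = 0"
  shows "\<omega> = 0"
proof -
  \<comment> \<open>The first \<open>m\<close> arguments are arbitrary and the others are dual fields.\<close>
  have step: "m \<le> n \<Longrightarrow> Zs \<in> L n \<Longrightarrow> (\<And>i. m \<le> i \<Longrightarrow> i < n \<Longrightarrow> \<exists>j<k. Zs ! i = X j) \<Longrightarrow> \<omega> Zs p = 0" for m Zs p
  proof (induction m arbitrary: Zs)
    case 0
    then obtain f where f: "\<And>i. i < n \<Longrightarrow> f i < k \<and> Zs ! i = X (f i)" by (metis le0)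
    show ?case
    proof (cases "inj_on f {..<n}")
      case False
      then obtain i j where "i < n" "j < n" "i \<noteq> j" "f i = f j" by (auto simp: inj_on_def)
      then show ?thesis using form_alt[OF w 0(2), of i j] f by simp
    next
      case True
      have sub: "f ` {..<n} \<subseteq> {..<k}" using f by auto
      have "n \<le> k" using card_inj_on_le[OF True sub] by simp
      then have nk: "k = n" "\<omega> (map X [0..<k]) = 0" using top by auto
      define \<sigma> where "\<sigma> i = (if i < n then f i else i)" for i
      have "bij_betw f {..<n} {..<n}"
        using True sub nk by (simp add: bij_betw_def endo_inj_surj)
      then have "bij_betw \<sigma> {..<n} {..<n}"
        by (rule bij_betw_cong[THEN iffD1, rotated]) (simp add: \<sigma>_def)
      then have s: "\<sigma> permutes {..<n}" by (rule bij_imp_permutes) (simp add: \<sigma>_def)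
      have "Zs = map (\<lambda>i. map X [0..<n] ! \<sigma> i) [0..<n]"
        using 0(2) f nk by (intro nth_equalityI) (auto simp: L_iff \<sigma>_def)
      moreover have "map X [0..<n] \<in> L n" using nk by (intro L_map) (simp add: dual_vf)
      ultimately show ?thesis using form_permute[OF w s, of "map X [0..<n]" p] nk by simp
    qed
  next
    case (Suc m)
    have m: "m < n" using Suc.prems by simp
    note Zm = L_nth[OF Suc.prems(2) m]
    have len: "length Zs = n" using Suc.prems(2) by (simp add: L_iff)
    have "\<omega> (Zs[m := proj (Zs ! m)]) = 0"
      by (rule tan[OF L_update[OF Suc.prems(2) T_vf[OF proj_T[OF Zm]]] m]) (simp add: len m proj_T[OF Zm])
    moreover have "\<omega> (Zs[m := X j]) p = 0" if j: "j < k" for j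
    proof (rule Suc.IH)
      show "\<exists>l<k. Zs[m := X j] ! i = X l" if "m \<le> i" "i < n" for i
        using that j Suc.prems(3)[of i] len by (cases "i = m") auto
    qed (use Suc.prems j m in \<open>auto intro!: L_update dual_vf\<close>)
    ultimately show ?case
      using form_expand_slot[OF w Suc.prems(2) m Zm, of p] by simp
  qed
  show ?thesis
  proof (intro ext)
    fix Zs p
    show "\<omega> Zs p = 0 Zs p"
      using step[of n Zs p] form_off[OF w, of Zs] by (cases "Zs \<in> L n") auto
  qed
qed

text \<open>
  Evaluating \<open>\<beta> \<and> \<mu>\<close> on tangent fields followed by the dual fields returns \<open>\<beta>\<close>. Conversely, replacing
  the arguments of \<open>\<beta>\<close> by their tangent parts one at a time does not change \<open>\<beta> \<and> \<mu>\<close>: the error has a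
  factor \<open>\<alpha>\<^sub>j\<close>, which also occurs in \<open>\<mu>\<close>, so that exchanging the arguments of the two factors
  reverses the sign.
\<close>

lemma wedge_mu_eval:
  assumes b: "\<beta> \<in> \<Omega> s" and Ys: "Ys \<in> L s" "set Ys \<subseteq> T"
  shows "wedge s k \<beta> \<mu> (Ys @ map X [0..<k]) p = \<beta> Ys p"
proof -
  let ?Zs = "Ys @ map X [0..<k]"
  have len: "length Ys = s" using Ys by (simp add: L_iff)
  let ?g = "\<lambda>\<sigma>. of_int (sign \<sigma>) * \<beta> (map (\<lambda>i. ?Zs ! \<sigma> i) [0..<s]) p
        * (\<Prod>i<k. \<alpha> i [?Zs ! \<sigma> (s + i)] p)"
  \<comment> \<open>Unless the factors of \<open>\<mu>\<close> receive the dual fields in their order, one of them is zero.\<close>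
  have zero: "?g \<sigma> = 0" if s: "\<sigma> permutes {..<s + k}" and n: "\<not> \<sigma> permutes {..<s}" for \<sigma>
  proof -
    have "\<exists>i<k. \<sigma> (s + i) \<noteq> s + i"
    proof (rule ccontr)
      assume "\<not> (\<exists>i<k. \<sigma> (s + i) \<noteq> s + i)"
      then have *: "\<sigma> (s + i) = s + i" if "i < k" for i using that by simp
      have "\<sigma> x = x" if "x \<notin> {..<s}" for x
      proof (cases "x < s + k")
        case True
        then have "\<sigma> (s + (x - s)) = s + (x - s)" using that by (intro *) auto
        then show ?thesis using that by simp
      qed (use permutes_not_in[OF s] in simp)
      then have "\<sigma> permutes {..<s}"
        using permutes_superset[OF s, of "{..<s}"] by auto
      then show False using n by simp
    qed
    then obtain i where i: "i < k" "\<sigma> (s + i) \<noteq> s + i" by blast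
    have "\<alpha> i [?Zs ! \<sigma> (s + i)] p = 0"
    proof (cases "\<sigma> (s + i) < s")
      case True
      then have "?Zs ! \<sigma> (s + i) \<in> T" using Ys len by (auto simp: nth_append)
      then show ?thesis using T_eval i by simp
    next
      case False
      moreover have "\<sigma> (s + i) < s + k" using permutes_lessThan[OF s] i by simp
      ultimately show ?thesis using i len by (auto simp: nth_append dual_eval)
    qed
    then have "(\<Prod>i<k. \<alpha> i [?Zs ! \<sigma> (s + i)] p) = 0" using i by (intro prod_zero) auto
    then show ?thesis by simp
  qed
  have one: "?g \<sigma> = \<beta> Ys p" if s: "\<sigma> permutes {..<s}" for \<sigma>
  proof -
    have "\<sigma> (s + i) = s + i" for i using permutes_not_in[OF s] by simp
    then have 1: "(\<Prod>i<k. \<alpha> i [?Zs ! \<sigma> (s + i)] p) = 1"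
      using len by (simp add: nth_append dual_eval)
    have 2: "map (\<lambda>i. ?Zs ! \<sigma> i) [0..<s] = map (\<lambda>i. Ys ! \<sigma> i) [0..<s]"
      using len permutes_lessThan[OF s] by (auto simp: nth_append)
    have 3: "of_int (sign \<sigma>) * (of_int (sign \<sigma>) * \<beta> Ys p) = \<beta> Ys p"
      by (simp flip: mult.assoc of_int_mult)
    show ?thesis unfolding 1 2 form_permute[OF b s Ys(1)] 3 by simp
  qed
  have "(\<Sum>\<sigma> | \<sigma> permutes {..<s + k}. ?g \<sigma>) = (\<Sum>\<sigma> | \<sigma> permutes {..<s}. ?g \<sigma>)"
    by (rule sum.mono_neutral_right)
      (auto simp: finite_permutations zero intro: permutes_subset)
  also have "\<dots> = fact s * \<beta> Ys p"
    using one by (simp add: card_permutations)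
  finally show ?thesis by (subst wedge_mu) (simp_all add: len)
qed

lemma wedge_mu_zero:
  assumes b: "\<beta> \<in> \<Omega> s" and tan: "\<And>Ys. Ys \<in> L s \<Longrightarrow> set Ys \<subseteq> T \<Longrightarrow> \<beta> Ys = 0"
  shows "wedge s k \<beta> \<mu> = 0"
proof (intro ext)
  fix Zs p
  show "wedge s k \<beta> \<mu> Zs p = 0 Zs p"
  proof (cases "length Zs = s + k")
    case False
    then show ?thesis by (simp add: wedge_def)
  next
    case len: True
    let ?P = "{\<sigma>. \<sigma> permutes {..<s + k}}"
    let ?pr = "\<lambda>\<sigma>. \<Prod>i<k. \<alpha> i [Zs ! \<sigma> (s + i)] p"
    have "(\<Sum>\<sigma>\<in>?P. of_int (sign \<sigma>) * \<beta> (map (\<lambda>i. Zs ! \<sigma> i) [0..<s]) p * ?pr \<sigma>) = 0"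
    proof (cases "Zs \<in> L (s + k)")
      case False
      then have "\<not> set Zs \<subseteq> V" using len by (simp add: L_iff)
      then obtain m where m: "m < s + k" "Zs ! m \<notin> V" using len by (metis in_set_conv_nth subsetI)
      have "\<beta> (map (\<lambda>i. Zs ! \<sigma> i) [0..<s]) p * ?pr \<sigma> = 0" if s: "\<sigma> permutes {..<s + k}" for \<sigma>
      proof -
        obtain a where a: "\<sigma> a = m" "a < s + k" using permutes_image[OF s] m by (metis imageE lessThan_iff)
        show ?thesis
        proof (cases "a < s")
          case True
          then have "Zs ! m \<in> set (map (\<lambda>i. Zs ! \<sigma> i) [0..<s])" using a by force
          then have "map (\<lambda>i. Zs ! \<sigma> i) [0..<s] \<notin> L s" using m unfolding L_iff by blast
          then show ?thesis using form_off[OF b] by simp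
        next
          case False
          have "[Zs ! m] \<notin> L 1" using m by (simp add: L_iff)
          then have "\<alpha> (a - s) [Zs ! \<sigma> (s + (a - s))] p = 0"
            using form_off[OF coframe[of "a - s"]] a False by simp
          then have "?pr \<sigma> = 0" using a False by (intro prod_zero bexI[of _ "a - s"]) auto
          then show ?thesis by simp
        qed
      qed
      then show ?thesis by (intro sum.neutral) (simp add: mult.assoc)
    next
      case Zs: True
      \<comment> \<open>The first \<open>m\<close> arguments of \<open>\<beta>\<close> have been replaced by their tangent parts.\<close>
      define lst where "lst m \<sigma> = map (\<lambda>i. if i < m then proj (Zs ! \<sigma> i) else Zs ! \<sigma> i) [0..<s]" for m \<sigma>
      define W where "W m = (\<Sum>\<sigma>\<in>?P. of_int (sign \<sigma>) * \<beta> (lst m \<sigma>) p * ?pr \<sigma>)" for m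
      have ZV: "Zs ! \<sigma> i \<in> V" if "\<sigma> \<in> ?P" "i < s + k" for \<sigma> i
        using L_nth[OF Zs] permutes_lessThan that by blast
      have lst_L: "lst m \<sigma> \<in> L s" if "\<sigma> \<in> ?P" for m \<sigma>
        unfolding lst_def using ZV[OF that] T_vf[OF proj_T] by (intro L_map) auto
      have step: "W m = W (Suc m)" if m: "m < s" for m
      proof -
        have "\<beta> (lst m \<sigma>) p = \<beta> (lst (Suc m) \<sigma>) p
            + (\<Sum>j<k. \<alpha> j [Zs ! \<sigma> m] p * \<beta> ((lst m \<sigma>)[m := X j]) p)" if s: "\<sigma> \<in> ?P" for \<sigma>
        proof -
          have "(lst m \<sigma>)[m := Zs ! \<sigma> m] = lst m \<sigma>" "(lst m \<sigma>)[m := proj (Zs ! \<sigma> m)] = lst (Suc m) \<sigma>"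
            using m by (auto intro!: nth_equalityI simp: lst_def nth_list_update less_Suc_eq)
          then show ?thesis
            using form_expand_slot[OF b lst_L[OF s] m ZV[OF s], of m m p] m by simp
        qed
        then have "W m = W (Suc m) + (\<Sum>\<sigma>\<in>?P. of_int (sign \<sigma>)
            * (\<Sum>j<k. \<alpha> j [Zs ! \<sigma> m] p * \<beta> ((lst m \<sigma>)[m := X j]) p) * ?pr \<sigma>)"
          unfolding W_def sum.distrib[symmetric] by (intro sum.cong refl) (simp add: algebra_simps)
        also have "(\<Sum>\<sigma>\<in>?P. of_int (sign \<sigma>)
            * (\<Sum>j<k. \<alpha> j [Zs ! \<sigma> m] p * \<beta> ((lst m \<sigma>)[m := X j]) p) * ?pr \<sigma>)
          = (\<Sum>j<k. \<Sum>\<sigma>\<in>?P. of_int (sign \<sigma>) * \<beta> ((lst m \<sigma>)[m := X j]) p * (\<alpha> j [Zs ! \<sigma> m] p * ?pr \<sigma>))"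
          by (subst sum.swap) (simp add: sum_distrib_left sum_distrib_right mult_ac)
        also have "\<dots> = 0"
        proof (rule sum.neutral, rule ballI)
          fix j assume "j \<in> {..<k}"
          then have j: "j < k" by simp
          let ?t = "Transposition.transpose m (s + j)"
          have t: "?t permutes {..<s + k}" using m j by (intro permutes_swap_id) auto
          show "(\<Sum>\<sigma>\<in>?P. of_int (sign \<sigma>) * \<beta> ((lst m \<sigma>)[m := X j]) p * (\<alpha> j [Zs ! \<sigma> m] p * ?pr \<sigma>)) = 0"
          proof (rule sum_permutations_odd[OF t])
            fix \<sigma> assume s: "\<sigma> permutes {..<s + k}"
            have pr: "?pr \<sigma>' = \<alpha> j [Zs ! \<sigma>' (s + j)] p * (\<Prod>i\<in>{..<k} - {j}. \<alpha> i [Zs ! \<sigma>' (s + i)] p)" for \<sigma>'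
              using j by (subst prod.remove[of _ j]) auto
            have "sign (\<sigma> \<circ> ?t) = - sign \<sigma>"
              using sign_compose_permutes[OF s t finite_lessThan] m by (simp add: sign_swap_id)
            moreover have "(lst m (\<sigma> \<circ> ?t))[m := X j] = (lst m \<sigma>)[m := X j]"
              using m by (auto intro!: nth_equalityI simp: lst_def nth_list_update Transposition.transpose_def)
            moreover have "(\<Prod>i\<in>{..<k} - {j}. \<alpha> i [Zs ! (\<sigma> \<circ> ?t) (s + i)] p)
                = (\<Prod>i\<in>{..<k} - {j}. \<alpha> i [Zs ! \<sigma> (s + i)] p)"
              using m by (intro prod.cong refl) (auto simp: Transposition.transpose_def)
            ultimately show "of_int (sign (\<sigma> \<circ> ?t)) * \<beta> ((lst m (\<sigma> \<circ> ?t))[m := X j]) p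
                * (\<alpha> j [Zs ! (\<sigma> \<circ> ?t) m] p * ?pr (\<sigma> \<circ> ?t))
              = - (of_int (sign \<sigma>) * \<beta> ((lst m \<sigma>)[m := X j]) p * (\<alpha> j [Zs ! \<sigma> m] p * ?pr \<sigma>))"
              unfolding pr by (simp add: mult_ac)
          qed
        qed
        finally show ?thesis by simp
      qed
      have "W 0 = W m" if "m \<le> s" for m using that by (induction m) (auto simp: step)
      then have "W 0 = W s" by blast
      moreover have "W s = 0" unfolding W_def
      proof (intro sum.neutral ballI)
        fix \<sigma> assume s: "\<sigma> \<in> ?P"
        have "set (lst s \<sigma>) \<subseteq> T" using ZV[OF s] proj_T by (auto simp: lst_def)
        then show "of_int (sign \<sigma>) * \<beta> (lst s \<sigma>) p * ?pr \<sigma> = 0"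
          using tan[OF lst_L[OF s]] by simp
      qed
      ultimately have "W 0 = 0" by simp
      then show ?thesis by (simp add: W_def lst_def)
    qed
    then show ?thesis by (simp add: wedge_mu[OF len])
  qed
qed

lemma wedge_mu_zero_iff:
  assumes "\<beta> \<in> \<Omega> s"
  shows "wedge s k \<beta> \<mu> = 0 \<longleftrightarrow> (\<forall>Ys\<in>L s. set Ys \<subseteq> T \<longrightarrow> \<beta> Ys = 0)"
  using wedge_mu_eval[OF assms] wedge_mu_zero[OF assms] by (auto simp: fun_eq_iff)

end


context smooth_atlas
begin

section \<open>Existence of dual vector fields\<close>

lemma smooth_flat: "f \<in> S \<Longrightarrow> (\<lambda>q. flat n (f q)) \<in> S"
  by (rule smooth_compose[OF _ Ck_on_flat]) auto

text \<open>
  The weight \<open>w\<^sub>n\<close> vanishes wherever some earlier \<open>f\<^sub>m\<close> is at least \<open>1/(n+1)\<close>. Near a point with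
  \<open>f\<^sub>m(p) > 0\<close> this happens for all large \<open>n\<close>, so that the weights are locally finite, and at \<open>p\<close> the
  weight of the first \<open>m\<close> with \<open>f\<^sub>m(p) > 0\<close> is positive.
\<close>

lemma locally_finite_weights:
  fixes f :: "nat \<Rightarrow> 'a \<Rightarrow> real"
  assumes f: "\<And>n. f n \<in> S" and nonneg: "\<And>n q. 0 \<le> f n q" and cover: "\<And>q. \<exists>n. f n q \<noteq> 0"
  obtains w :: "nat \<Rightarrow> 'a \<Rightarrow> real" where "\<And>n. w n \<in> S" "\<And>n q. 0 \<le> w n q"
    "\<And>q. \<exists>n. 0 < w n q * f n q"
    "\<And>p. \<exists>\<theta>\<in>S. \<exists>N. \<theta> p \<noteq> 0 \<and> (\<forall>q. \<theta> q \<noteq> 0 \<longrightarrow> (\<forall>n\<ge>N. w n q = 0))"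
proof
  define w where "w n q = (\<Prod>m<n. flat 0 (1 / (real n + 1) - f m q))" for n q
  show "w n \<in> S" for n
  proof -
    have "(\<lambda>q. flat 0 (1 / (real n + 1) - f m q)) \<in> S" for m
      using smooth_flat[OF smooth_diff[OF smooth_const f], of 0 "1 / (real n + 1)" m] by simp
    then have "(\<Prod>m<n. (\<lambda>q. flat 0 (1 / (real n + 1) - f m q))) \<in> S" by (intro smooth_prod)
    also have "(\<Prod>m<n. (\<lambda>q. flat 0 (1 / (real n + 1) - f m q))) = w n"
      by (rule ext) (simp add: w_def prod_fun_apply)
    finally show ?thesis .
  qed
  show "0 \<le> w n q" for n q
    unfolding w_def by (intro prod_nonneg) (simp add: flat_nonneg)
  show "\<exists>n. 0 < w n q * f n q" for q
  proof -
    define n where "n = (LEAST n. f n q \<noteq> 0)"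
    have n: "f n q \<noteq> 0" unfolding n_def by (rule LeastI_ex[OF cover])
    have "f m q = 0" if "m < n" for m using not_less_Least[OF that[unfolded n_def]] by simp
    then have "0 < w n q" unfolding w_def by (intro prod_pos) (simp add: flat_pos)
    then show ?thesis using n nonneg[of n q] by (intro exI[of _ n]) simp
  qed
  show "\<exists>\<theta>\<in>S. \<exists>N. \<theta> p \<noteq> 0 \<and> (\<forall>q. \<theta> q \<noteq> 0 \<longrightarrow> (\<forall>n\<ge>N. w n q = 0))" for p
  proof -
    obtain n where "f n p \<noteq> 0" using cover by blast
    define c where "c = f n p / 2"
    have c: "0 < c" "c < f n p" using \<open>f n p \<noteq> 0\<close> nonneg[of n p] by (auto simp: c_def)
    obtain N0 where N0: "inverse (real (Suc N0)) < c" using reals_Archimedean[OF c(1)] by blast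
    define \<theta> where "\<theta> q = flat 0 (f n q - c)" for q
    have 1: "\<theta> \<in> S"
      using smooth_flat[OF smooth_diff[OF f smooth_const], of 0 n c] by (simp add: \<theta>_def[abs_def])
    have 2: "\<theta> p \<noteq> 0" using c flat_pos[of "f n p - c" 0] by (simp add: \<theta>_def)
    have 3: "w m q = 0" if q: "\<theta> q \<noteq> 0" and m: "m \<ge> max (Suc n) N0" for q m
    proof -
      have "f n q > c" using q flat_zero[of "f n q - c" 0] by (fastforce simp: \<theta>_def)
      moreover have "1 / (real m + 1) \<le> inverse (real (Suc N0))"
        using m by (simp add: divide_simps)
      ultimately have "flat 0 (1 / (real m + 1) - f n q) = 0" using N0 by (intro flat_zero) simp
      then show ?thesis unfolding w_def using m by (intro prod_zero bexI[of _ n]) auto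
    qed
    show ?thesis
      by (intro bexI[OF _ 1] exI[of _ "max (Suc n) N0"] conjI 2 allI impI 3)
  qed
qed

text \<open>
  Countably many fields \<open>Y\<^sub>n\<close> suffice to make \<open>\<beta>(Y\<^sub>n)\<close> nonzero somewhere at each point. On the locally
  finite sum of the fields \<open>w\<^sub>n \<beta>(Y\<^sub>n) Y\<^sub>n\<close> the form takes the value \<open>\<Sum>\<^sub>n w\<^sub>n \<beta>(Y\<^sub>n)\<^sup>2 > 0\<close>, by which the sum
  is divided.
\<close>

lemma one_form_unit_field:
  assumes b: "\<beta> \<in> \<Omega> 1" and nz: "\<And>p. \<exists>Y\<in>V. \<beta> [Y] p \<noteq> 0"
  shows "\<exists>Z\<in>V. \<beta> [Z] = 1"
proof -
  obtain Y0 where Y0: "\<And>p. Y0 p \<in> V" "\<And>p. \<beta> [Y0 p] p \<noteq> 0" using nz by metis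
  define U where "U p = {q. \<beta> [Y0 p] q \<noteq> 0}" for p
  have op: "open {q. g q \<noteq> 0}" if "g \<in> S" for g :: "'a \<Rightarrow> real"
    by (intro open_Collect_neq continuous_on_const smooth_continuous that)
  have "open (U p)" for p unfolding U_def by (rule op[OF one_form(1)[OF b Y0(1)]])
  then have opU: "open W" if "W \<in> range U" for W using that by auto
  obtain F where F: "F \<subseteq> range U" "countable F" "\<Union>F = \<Union>(range U)"
    by (rule Lindelof[of "range U", OF opU]) (assumption, rule that)
  then obtain C where C: "countable C" "F = U ` C" by (metis countable_subset_image)
  have cov: "\<exists>p\<in>C. q \<in> U p" for q
    using F(3) Y0(2)[of q] unfolding C(2) by (auto simp: U_def)
  then have "C \<noteq> {}" by blast
  define Y where "Y n = Y0 (from_nat_into C n)" for n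
  define b' where "b' n = \<beta> [Y n]" for n
  have Y: "Y n \<in> V" and b': "b' n \<in> S" for n
    unfolding Y_def b'_def using Y0(1) one_form(1)[OF b] by auto
  have nz': "\<exists>n. (b' n * b' n) q \<noteq> 0" for q
    using cov[of q] from_nat_into_surj[OF C(1)] unfolding U_def b'_def Y_def by fastforce
  have nonneg: "0 \<le> (b' n * b' n) q" for n q by simp
  obtain w where w: "\<And>n. w n \<in> S" "\<And>n q. 0 \<le> w n q" "\<And>q. \<exists>n. 0 < w n q * (b' n * b' n) q"
    "\<And>p. \<exists>\<theta>\<in>S. \<exists>N. \<theta> p \<noteq> 0 \<and> (\<forall>q. \<theta> q \<noteq> 0 \<longrightarrow> (\<forall>n\<ge>N. w n q = 0))"
    by (rule locally_finite_weights[of "\<lambda>n. b' n * b' n", OF smooth_mult[OF b' b'] nonneg nz'])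
      (rule that)
  define ser where "ser g q = (\<Sum>n. w n q * g n q)" for g :: "nat \<Rightarrow> 'a \<Rightarrow> real" and q
  have ser: "ser g q = (\<Sum>n<N. w n q * g n q)" if "\<forall>n\<ge>N. w n q = 0" for g q N
    unfolding ser_def using that by (intro suminf_finite) (auto simp: not_less)
  have ev_zero: "\<exists>N. \<forall>n\<ge>N. w n q = 0" for q
    using w(4)[of q] by blast
  have ser_at: "\<exists>N. \<forall>g. ser g q = (\<Sum>n<N. w n q * g n q)" for q
  proof -
    obtain N where N: "\<forall>n\<ge>N. w n q = 0" using ev_zero by blast
    show ?thesis by (intro exI[of _ N] allI ser N)
  qed
  have ser_smooth: "ser g \<in> S" if g: "\<And>n. g n \<in> S" for g
  proof (rule smooth_local)
    fix p
    obtain \<theta> N where \<theta>: "\<theta> \<in> S" "\<theta> p \<noteq> 0" "\<forall>q. \<theta> q \<noteq> 0 \<longrightarrow> (\<forall>n\<ge>N. w n q = 0)"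
      using w(4)[of p] by blast
    have "(\<Sum>n<N. w n * g n) \<in> S" by (intro smooth_sum smooth_mult w g)
    moreover have "ser g q = (\<Sum>n<N. w n * g n) q" if "q \<in> {q. \<theta> q \<noteq> 0}" for q
      using ser[of N q g] \<theta>(3) that by (simp add: sum_fun_apply)
    ultimately show "\<exists>W g'. open W \<and> p \<in> W \<and> g' \<in> S \<and> (\<forall>q\<in>W. ser g q = g' q)"
      using op[OF \<theta>(1)] \<theta>(2) by (intro exI[of _ "{q. \<theta> q \<noteq> 0}"] exI[of _ "\<Sum>n<N. w n * g n"]) blast
  qed
  define Z where "Z g = ser (\<lambda>n. b' n * Y n g)" for g
  have Z: "Z \<in> V"
  proof (rule vfI)
    show "Z g \<in> S" if "g \<in> S" for g
      unfolding Z_def by (intro ser_smooth smooth_mult b' vf_smooth[OF Y] that)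
    show "Z (f + g) = Z f + Z g" if "f \<in> S" "g \<in> S" for f g
    proof
      fix q
      obtain N where N: "\<And>g. ser g q = (\<Sum>n<N. w n q * g n q)" using ser_at[of q] by blast
      show "Z (f + g) q = (Z f + Z g) q"
        by (simp add: Z_def N vf_add[OF Y that] sum.distrib distrib_left)
    qed
    show "Z (\<lambda>q. a * f q) = (\<lambda>q. a * Z f q)" if "f \<in> S" for a f
    proof
      fix q
      obtain N where N: "\<And>g. ser g q = (\<Sum>n<N. w n q * g n q)" using ser_at[of q] by blast
      show "Z (\<lambda>q. a * f q) q = a * Z f q"
        by (simp add: Z_def N vf_cmult[OF Y that] sum_distrib_left mult_ac)
    qed
    show "Z (f * g) = f * Z g + g * Z f" if "f \<in> S" "g \<in> S" for f g
    proof
      fix q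
      obtain N where N: "\<And>g. ser g q = (\<Sum>n<N. w n q * g n q)" using ser_at[of q] by blast
      show "Z (f * g) q = (f * Z g + g * Z f) q"
        by (simp add: Z_def N vf_mult[OF Y that] sum_distrib_left flip: sum.distrib)
          (simp add: algebra_simps)
    qed
    show "Z f = 0" if "f \<notin> S" for f
      by (rule ext) (simp add: Z_def ser_def vf_off[OF Y that])
  qed
  define D where "D = ser (\<lambda>n. b' n * b' n)"
  have D: "D \<in> S" unfolding D_def by (intro ser_smooth smooth_mult b')
  have D_pos: "D p > 0" for p
  proof -
    obtain N where N: "\<forall>n\<ge>N. w n p = 0" using ev_zero by blast
    obtain n where n: "0 < w n p * (b' n * b' n) p" using w(3) by blast
    then have "n < N" using N by (metis less_irrefl mult_zero_left not_le)
    then show ?thesis unfolding D_def ser[OF N] using n w(2)[of _ p]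
      by (intro sum_pos2[of _ n]) auto
  qed
  \<comment> \<open>A form acts on an infinite sum of vector fields only after multiplication by a function
    that leaves finitely many summands.\<close>
  have bZ: "\<beta> [Z] = D"
  proof
    fix p
    obtain \<theta> N where \<theta>: "\<theta> \<in> S" "\<theta> p \<noteq> 0" "\<forall>q. \<theta> q \<noteq> 0 \<longrightarrow> (\<forall>n\<ge>N. w n q = 0)"
      using w(4)[of p] by blast
    have coeff: "\<theta> * w n * b' n \<in> S" for n by (intro smooth_mult \<theta> w b')
    have eq: "fun_smult \<theta> Z = (\<Sum>n<N. fun_smult (\<theta> * w n * b' n) (Y n))"
    proof (intro ext)
      fix g q
      have "(\<Sum>n<N. fun_smult (\<theta> * w n * b' n) (Y n)) g q
          = \<theta> q * (\<Sum>n<N. w n q * (b' n * Y n g) q)"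
        by (simp add: sum_fun_apply fun_smult_def sum_distrib_left mult_ac)
      then show "fun_smult \<theta> Z g q = (\<Sum>n<N. fun_smult (\<theta> * w n * b' n) (Y n)) g q"
        using ser[of N q] \<theta>(3) by (cases "\<theta> q = 0") (simp_all add: fun_smult_def Z_def)
    qed
    have "\<theta> p * \<beta> [Z] p = \<beta> [fun_smult \<theta> Z] p" using one_form(5)[OF b Z \<theta>(1)] by simp
    also have "\<dots> = (\<Sum>n<N. (\<theta> * w n * b' n) p * \<beta> [Y n] p)"
      unfolding eq by (rule one_form_sum[OF b]) (use Y coeff in auto)
    also have "\<dots> = \<theta> p * (\<Sum>n<N. w n p * (b' n * b' n) p)"
      by (simp add: b'_def sum_distrib_left mult_ac)
    also have "\<dots> = \<theta> p * D p" using ser[of N p] \<theta>(2,3) by (simp add: D_def)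
    finally show "\<beta> [Z] p = D p" using \<theta>(2) by simp
  qed
  have D_nz: "D p \<noteq> 0" for p using D_pos[of p] by simp
  have inv: "(\<lambda>p. inverse (D p)) \<in> S"
    by (rule smooth_compose[OF D Ck_on_inverse]) (use D_nz in auto)
  show ?thesis
  proof
    show "fun_smult (\<lambda>p. inverse (D p)) Z \<in> V" by (rule vf_closed_smult[OF Z inv])
    show "\<beta> [fun_smult (\<lambda>p. inverse (D p)) Z] = 1"
      by (intro ext) (simp add: one_form(5)[OF b Z inv] bZ D_nz)
  qed
qed

text \<open>
  Induction on the number of forms: the component of \<open>\<alpha>\<^sub>k\<close> along the kernel of the previous forms is
  a one-form without zeros. A field on which it is \<open>1\<close>, corrected by the previous dual fields, is dual
  to \<open>\<alpha>\<^sub>k\<close> and is used to correct the previous dual fields in turn.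
\<close>

lemma dual_fields_exist:
  assumes "\<And>i. i < k \<Longrightarrow> \<alpha> i \<in> \<Omega> 1"
    and "\<And>p c. (\<forall>X\<in>V. (\<Sum>i<k. c i * \<alpha> i [X] p) = 0) \<Longrightarrow> \<forall>i<k. c i = (0::real)"
  shows "\<exists>X. dual_fields \<A> k \<alpha> X"
  using assms
proof (induction k)
  case 0
  then show ?case by (simp add: dual_fields_def)
next
  case (Suc k)
  have "\<forall>i<k. c i = 0" if "\<forall>X\<in>V. (\<Sum>i<k. c i * \<alpha> i [X] p) = 0" for p and c :: "nat \<Rightarrow> real"
    using Suc.prems(2)[of "c(k := 0)" p] that by (auto simp: less_Suc_eq)
  then obtain X where X: "dual_fields \<A> k \<alpha> X" using Suc.IH Suc.prems(1) by force
  interpret coframe \<A> k \<alpha> X by unfold_locales (use Suc.prems(1) X in auto)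
  have ak: "\<alpha> k \<in> \<Omega> 1" using Suc.prems(1) by blast
  define \<beta> where "\<beta> Ys = \<alpha> k Ys - (\<Sum>j<k. \<alpha> k [X j] * \<alpha> j Ys)" for Ys
  have "(\<Sum>j<k. (\<lambda>Ys. \<alpha> k [X j] * \<alpha> j Ys)) \<in> \<Omega> 1"
    by (intro form_closed_sum form_closed_smult one_form(1)[OF ak] dual_vf coframe) auto
  moreover have "\<beta> = \<alpha> k - (\<Sum>j<k. (\<lambda>Ys. \<alpha> k [X j] * \<alpha> j Ys))"
    by (intro ext) (simp add: \<beta>_def sum_fun_apply)
  ultimately have b: "\<beta> \<in> \<Omega> 1" using form_closed_diff[OF ak] by simp
  have b_apply: "\<beta> [Y] p = \<alpha> k [Y] p - (\<Sum>j<k. \<alpha> k [X j] p * \<alpha> j [Y] p)" for Y p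
    by (simp add: \<beta>_def sum_fun_apply)
  have "\<exists>Y\<in>V. \<beta> [Y] p \<noteq> 0" for p
  proof (rule ccontr)
    assume *: "\<not> (\<exists>Y\<in>V. \<beta> [Y] p \<noteq> 0)"
    define c where "c i = (if i = k then 1 else - \<alpha> k [X i] p)" for i
    have "(\<Sum>i<Suc k. c i * \<alpha> i [Y] p) = \<beta> [Y] p" for Y
      by (simp add: c_def b_apply sum_negf)
    then have "\<forall>Y\<in>V. (\<Sum>i<Suc k. c i * \<alpha> i [Y] p) = 0" using * by metis
    from Suc.prems(2)[OF this] have "c k = 0" by blast
    then show False by (simp add: c_def)
  qed
  then obtain Z where Z: "Z \<in> V" "\<beta> [Z] = 1" using one_form_unit_field[OF b] by blast
  let ?Z = "proj Z"
  have pZ: "?Z \<in> V" "\<And>i p. i < k \<Longrightarrow> \<alpha> i [?Z] p = 0"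
    using proj_T[OF Z(1)] T_vf T_eval by auto
  have kZ: "\<alpha> k [?Z] p = 1" for p
  proof -
    have "\<alpha> k [?Z] p = \<alpha> k [Z] p - (\<Sum>j<k. \<alpha> j [Z] p * \<alpha> k [X j] p)"
      unfolding proj_def one_form(3)[OF ak Z(1) normal_vf[OF Z(1)]]
      using one_form_sum[OF ak, of "{..<k}" X "\<lambda>j. \<alpha> j [Z]"]
      by (simp add: dual_vf one_form(1)[OF coframe] Z(1))
    also have "\<dots> = \<beta> [Z] p" by (simp add: b_apply mult.commute)
    finally show ?thesis using Z(2) by simp
  qed
  \<comment> \<open>Subtracting multiples of \<open>?Z\<close> changes only the value under \<open>\<alpha> k\<close>.\<close>
  define X' where "X' j = (if j = k then ?Z else X j - fun_smult (\<alpha> k [X j]) ?Z)" for j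
  have corr: "fun_smult (\<alpha> k [X j]) ?Z \<in> V" if "j < k" for j
    by (intro vf_closed_smult pZ one_form(1)[OF ak] dual_vf that)
  have "X' j \<in> V" if "j < Suc k" for j
    using that corr by (auto simp: X'_def pZ dual_vf intro!: vf_closed_diff)
  moreover have "\<alpha> i [X' j] p = (if i = j then 1 else 0)" if "i < Suc k" "j < Suc k" for i j p
  proof (cases "j = k")
    case True
    then show ?thesis using that pZ(2) kZ by (auto simp: X'_def)
  next
    case False
    then have j: "j < k" using that by simp
    have "\<alpha> i [X' j] p = \<alpha> i [X j] p - \<alpha> k [X j] p * \<alpha> i [?Z] p"
      using one_form(3)[OF Suc.prems(1)[OF that(1)] dual_vf[OF j] corr[OF j]]
        one_form(5)[OF Suc.prems(1)[OF that(1)] pZ(1) one_form(1)[OF ak dual_vf[OF j]]] False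
      by (simp add: X'_def)
    then show ?thesis using that j pZ(2)[of i p] kZ[of p] dual_eval[of i j p]
      by (cases "i = k") auto
  qed
  ultimately show ?case unfolding dual_fields_def by blast
qed

end


section \<open>The divergence of a coframe along the leaves\<close>

locale foliated_coframe = coframe +
  assumes integrable: "i < k \<Longrightarrow> wedge 2 k (ext_deriv \<A> 1 (\<alpha> i)) \<mu> = 0"
begin

text \<open>
  The wedge condition \<open>d\<alpha>\<^sub>i \<and> \<mu> = 0\<close> says that \<open>d\<alpha>\<^sub>i\<close> vanishes on pairs of tangent fields, where it equals
  \<open>- \<alpha>\<^sub>i([Y, Z])\<close>.
\<close>

lemma T_bracket:
  assumes Y: "Y \<in> T" and Z: "Z \<in> T"
  shows "lie_bracket Y Z \<in> T"
proof -
  note V = T_vf[OF Y] T_vf[OF Z]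
  have "\<alpha> i [lie_bracket Y Z] = 0" if i: "i < k" for i
  proof -
    have d: "ext_deriv \<A> 1 (\<alpha> i) \<in> \<Omega> 2"
      using ext_form[OF coframe[OF i]] by (simp add: numeral_2_eq_2)
    have "[Y, Z] \<in> L 2" "set [Y, Z] \<subseteq> T" using V Y Z by (simp_all add: L_iff)
    then have "ext_deriv \<A> 1 (\<alpha> i) [Y, Z] = 0"
      using integrable[OF i] unfolding wedge_mu_zero_iff[OF d] by blast
    moreover have "\<alpha> i [Y] = 0" "\<alpha> i [Z] = 0" using Y Z i by (simp_all add: T_def)
    ultimately show ?thesis
      using ext_deriv_one_form[OF V, of "\<alpha> i"] by (simp add: vf_zero_arg[OF V(1)] vf_zero_arg[OF V(2)])
  qed
  then show ?thesis using vf_closed_bracket[OF V] by (simp add: T_def)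
qed

lemma lie_one_form:
  "Z \<in> V \<Longrightarrow> Y \<in> V \<Longrightarrow> lie_derivative \<A> 1 Z \<omega> [Y] p = Z (\<omega> [Y]) p - \<omega> [lie_bracket Z Y] p"
  by (simp add: lie_apply L_iff)

text \<open>
  Flows along the leaves preserve the span of the coframe. Up to sign, the coefficients are those of
  the Bott connection \<open>\<nabla>\<^sub>Z X = [Z, X]\<close> on the normal bundle, in the frame of the dual fields.
\<close>

lemma lie_coframe:
  assumes Z: "Z \<in> T" and l: "l < k" and Y: "Y \<in> V"
  shows "lie_derivative \<A> 1 Z (\<alpha> l) [Y] p = (\<Sum>j<k. \<alpha> j [Y] p * \<alpha> l [lie_bracket (X j) Z] p)"
proof -
  note ZV = T_vf[OF Z]
  have "lie_derivative \<A> 1 Z (\<alpha> l) [U] = 0" if "U \<in> T" for U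
  proof
    fix p
    have "\<alpha> l [U] = 0" using that l by (simp add: T_def)
    then show "lie_derivative \<A> 1 Z (\<alpha> l) [U] p = 0 p"
      using T_eval[OF T_bracket[OF Z that] l]
      unfolding lie_one_form[OF ZV T_vf[OF that]] by (simp add: vf_zero_arg[OF ZV])
  qed
  from one_form_expand[OF lie_form[OF coframe[OF l] ZV] this Y]
  have "lie_derivative \<A> 1 Z (\<alpha> l) [Y] p
      = (\<Sum>j<k. \<alpha> j [Y] p * lie_derivative \<A> 1 Z (\<alpha> l) [X j] p)" .
  also have "\<dots> = (\<Sum>j<k. \<alpha> j [Y] p * \<alpha> l [lie_bracket (X j) Z] p)"
  proof (intro sum.cong refl arg_cong2[where f="(*)"])
    fix j assume "j \<in> {..<k}"
    then have j: "j < k" by simp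
    have "\<alpha> l [X j] = (\<lambda>_. if l = j then 1 else 0)" using dual_eval[OF l j] by (intro ext) simp
    then have "Z (\<alpha> l [X j]) = 0" by (simp only: vf_const[OF ZV])
    moreover have "\<alpha> l [lie_bracket Z (X j)] = - \<alpha> l [lie_bracket (X j) Z]"
      unfolding bracket_swap[of Z] by (rule one_form(4)[OF coframe[OF l] vf_closed_bracket[OF dual_vf[OF j] ZV]])
    ultimately show "lie_derivative \<A> 1 Z (\<alpha> l) [X j] p = \<alpha> l [lie_bracket (X j) Z] p"
      unfolding lie_one_form[OF ZV dual_vf[OF j]] by simp
  qed
  finally show ?thesis .
qed

text \<open>
  The values of \<open>\<delta>\<close> on tangent fields, freed from the terms that vanish there: minus the trace of the
  Bott connection.
\<close>

definition diverg :: "'a vfield \<Rightarrow> 'a \<Rightarrow> real" where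
  "diverg Z = (\<Sum>i<k. \<alpha> i [lie_bracket (X i) Z])"

abbreviation "\<delta> \<equiv> delta_form \<A> k \<alpha> X"

lemma delta_one_form: "\<delta> \<in> \<Omega> 1"
  unfolding delta_form_def by (intro form_closed_uminus form_closed_sum lie_form coframe dual_vf) auto

lemma delta_tangent:
  assumes Z: "Z \<in> T"
  shows "\<delta> [Z] = diverg Z"
proof
  fix p
  have "lie_derivative \<A> 1 (X i) (\<alpha> i) [Z] p = - \<alpha> i [lie_bracket (X i) Z] p" if "i < k" for i
  proof -
    have "\<alpha> i [Z] = 0" using Z that by (simp add: T_def)
    then show ?thesis
      unfolding lie_one_form[OF dual_vf[OF that] T_vf[OF Z]] by (simp add: vf_zero_arg[OF dual_vf[OF that]])
  qed
  then show "\<delta> [Z] p = diverg Z p"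
    by (simp add: delta_form_def diverg_def sum_fun_apply sum_negf)
qed

text \<open>
  The transverse volume form is scaled by the divergence, as a determinant is by a trace: the
  off-diagonal coefficients of the Bott connection repeat a factor of the determinant.
\<close>

lemma lie_mu:
  assumes Z: "Z \<in> T" and Zs: "Zs \<in> L k"
  shows "lie_derivative \<A> k Z \<mu> Zs p = diverg Z p * \<mu> Zs p"
proof -
  note ZV = T_vf[OF Z]
  let ?P = "{\<tau>. \<tau> permutes {..<k}}"
  let ?r = "\<lambda>\<tau> l. \<Prod>i\<in>{..<k} - {l}. \<alpha> i [Zs ! \<tau> i] p"
  let ?c = "\<lambda>l j. \<alpha> l [lie_bracket (X j) Z] p"
  have len: "length Zs = k" using Zs by (simp add: L_iff)
  have ZsV: "Zs ! \<tau> i \<in> V" if "\<tau> \<in> ?P" "i < k" for \<tau> i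
    using L_nth[OF Zs] permutes_lessThan that by blast
  have sm: "(\<Prod>i<k. \<alpha> i [Zs ! \<tau> i]) \<in> S" if "\<tau> \<in> ?P" for \<tau>
    by (intro smooth_prod one_form(1)[OF coframe] ZsV that) auto
  have "\<mu> Zs = (\<Sum>\<tau>\<in>?P. (\<lambda>q. of_int (sign \<tau>) * (\<Prod>i<k. \<alpha> i [Zs ! \<tau> i]) q))"
    by (intro ext) (simp add: wedge_list_det[OF len] sum_fun_apply prod_fun_apply)
  then have "Z (\<mu> Zs) = (\<Sum>\<tau>\<in>?P. Z (\<lambda>q. of_int (sign \<tau>) * (\<Prod>i<k. \<alpha> i [Zs ! \<tau> i]) q))"
    by (simp only:) (intro vf_sum[OF ZV] smooth_cmult sm)
  also have "\<dots> = (\<Sum>\<tau>\<in>?P. (\<lambda>q. of_int (sign \<tau>) * Z (\<Prod>i<k. \<alpha> i [Zs ! \<tau> i]) q))"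
    by (intro sum.cong refl vf_cmult[OF ZV] sm)
  finally have "Z (\<mu> Zs) p = (\<Sum>\<tau>\<in>?P. of_int (sign \<tau>) * Z (\<Prod>i<k. \<alpha> i [Zs ! \<tau> i]) p)"
    by (simp add: sum_fun_apply)
  also have "\<dots> = (\<Sum>\<tau>\<in>?P. of_int (sign \<tau>) * (\<Sum>l<k. Z (\<alpha> l [Zs ! \<tau> l]) p * ?r \<tau> l))"
    by (intro sum.cong refl arg_cong2[where f="(*)"] vf_prod[OF ZV] one_form(1)[OF coframe] ZsV) auto
  finally have 1: "Z (\<mu> Zs) p = (\<Sum>\<tau>\<in>?P. of_int (sign \<tau>) * (\<Sum>l<k. Z (\<alpha> l [Zs ! \<tau> l]) p * ?r \<tau> l))" .
  have swap: "(\<Sum>m<k. \<Prod>i<k. \<alpha> i [Zs[m := lie_bracket Z (Zs ! m)] ! \<tau> i] p)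
      = (\<Sum>l<k. \<alpha> l [lie_bracket Z (Zs ! \<tau> l)] p * ?r \<tau> l)" if t: "\<tau> permutes {..<k}" for \<tau>
  proof -
    have "(\<Sum>m<k. \<Prod>i<k. \<alpha> i [Zs[m := lie_bracket Z (Zs ! m)] ! \<tau> i] p)
        = (\<Sum>l<k. \<Prod>i<k. \<alpha> i [Zs[\<tau> l := lie_bracket Z (Zs ! \<tau> l)] ! \<tau> i] p)"
      by (subst sum.permute[OF t]) (simp add: o_def)
    also have "\<dots> = (\<Sum>l<k. \<alpha> l [lie_bracket Z (Zs ! \<tau> l)] p * ?r \<tau> l)"
    proof (intro sum.cong refl)
      fix l assume "l \<in> {..<k}"
      then have l: "l < k" by simp
      have "\<tau> l \<noteq> \<tau> i" if "i \<noteq> l" for i using permutes_inj[OF t] that by (auto dest: injD)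
      then have "(\<Prod>i\<in>{..<k} - {l}. \<alpha> i [Zs[\<tau> l := lie_bracket Z (Zs ! \<tau> l)] ! \<tau> i] p) = ?r \<tau> l"
        by (intro prod.cong refl) auto
      then show "(\<Prod>i<k. \<alpha> i [Zs[\<tau> l := lie_bracket Z (Zs ! \<tau> l)] ! \<tau> i] p)
          = \<alpha> l [lie_bracket Z (Zs ! \<tau> l)] p * ?r \<tau> l"
        using l len permutes_lessThan[OF t l] by (subst prod.remove[of _ l]) auto
    qed
    finally show ?thesis .
  qed
  have "(\<Sum>m<k. \<mu> (Zs[m := lie_bracket Z (Zs ! m)]) p)
      = (\<Sum>\<tau>\<in>?P. of_int (sign \<tau>) * (\<Sum>m<k. \<Prod>i<k. \<alpha> i [Zs[m := lie_bracket Z (Zs ! m)] ! \<tau> i] p))"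
    by (simp add: wedge_list_det len sum_distrib_left) (rule sum.swap)
  also have "\<dots> = (\<Sum>\<tau>\<in>?P. of_int (sign \<tau>) * (\<Sum>l<k. \<alpha> l [lie_bracket Z (Zs ! \<tau> l)] p * ?r \<tau> l))"
    by (intro sum.cong refl) (simp add: swap)
  finally have "lie_derivative \<A> k Z \<mu> Zs p = (\<Sum>\<tau>\<in>?P. of_int (sign \<tau>)
      * (\<Sum>l<k. (Z (\<alpha> l [Zs ! \<tau> l]) p - \<alpha> l [lie_bracket Z (Zs ! \<tau> l)] p) * ?r \<tau> l))"
    unfolding lie_apply[OF Zs] 1
    by (simp only: left_diff_distrib sum_subtractf right_diff_distrib)
  also have "\<dots> = (\<Sum>\<tau>\<in>?P. of_int (sign \<tau>) * (\<Sum>l<k. (\<Sum>j<k. \<alpha> j [Zs ! \<tau> l] p * ?c l j) * ?r \<tau> l))"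
  proof (intro sum.cong refl arg_cong2[where f="(*)"])
    fix \<tau> l assume t: "\<tau> \<in> ?P" and "l \<in> {..<k}"
    then have l: "l < k" by simp
    show "Z (\<alpha> l [Zs ! \<tau> l]) p - \<alpha> l [lie_bracket Z (Zs ! \<tau> l)] p = (\<Sum>j<k. \<alpha> j [Zs ! \<tau> l] p * ?c l j)"
      using lie_coframe[OF Z l ZsV[OF t l], of p] lie_one_form[OF ZV ZsV[OF t l], of "\<alpha> l" p] by simp
  qed
  also have "\<dots> = (\<Sum>\<tau>\<in>?P. \<Sum>l<k. \<Sum>j<k. ?c l j * (of_int (sign \<tau>) * (\<alpha> j [Zs ! \<tau> l] p * ?r \<tau> l)))"
    by (simp add: sum_distrib_left sum_distrib_right mult_ac)
  also have "\<dots> = (\<Sum>l<k. \<Sum>j<k. ?c l j * (\<Sum>\<tau>\<in>?P. of_int (sign \<tau>) * (\<alpha> j [Zs ! \<tau> l] p * ?r \<tau> l)))"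
    unfolding sum_distrib_left by (subst sum.swap, intro sum.cong refl, rule sum.swap)
  also have "\<dots> = (\<Sum>l<k. \<Sum>j<k. if j = l then ?c l l * \<mu> Zs p else 0)"
  proof (intro sum.cong refl)
    fix l j assume "l \<in> {..<k}" "j \<in> {..<k}"
    then have l: "l < k" and j: "j < k" by auto
    show "?c l j * (\<Sum>\<tau>\<in>?P. of_int (sign \<tau>) * (\<alpha> j [Zs ! \<tau> l] p * ?r \<tau> l))
        = (if j = l then ?c l l * \<mu> Zs p else 0)"
    proof (cases "j = l")
      case True
      have "\<alpha> l [Zs ! \<tau> l] p * ?r \<tau> l = (\<Prod>i<k. \<alpha> i [Zs ! \<tau> i] p)" for \<tau>
        using l by (subst (2) prod.remove[of _ l]) auto
      then show ?thesis using True by (simp add: wedge_list_det[OF len])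
    next
      case False
      let ?t = "Transposition.transpose l j"
      have t: "?t permutes {..<k}" using l j by (intro permutes_swap_id) auto
      have "(\<Sum>\<tau>\<in>?P. of_int (sign \<tau>) * (\<alpha> j [Zs ! \<tau> l] p * ?r \<tau> l)) = 0"
      proof (rule sum_permutations_odd[OF t])
        fix \<tau> assume tau: "\<tau> permutes {..<k}"
        have r: "?r \<tau>' l = \<alpha> j [Zs ! \<tau>' j] p * (\<Prod>i\<in>{..<k} - {l} - {j}. \<alpha> i [Zs ! \<tau>' i] p)" for \<tau>'
          using j False by (subst prod.remove[of _ j]) auto
        have a: "(\<Prod>i\<in>{..<k} - {l} - {j}. \<alpha> i [Zs ! (\<tau> \<circ> ?t) i] p)
            = (\<Prod>i\<in>{..<k} - {l} - {j}. \<alpha> i [Zs ! \<tau> i] p)"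
          by (intro prod.cong refl) (auto simp: Transposition.transpose_def)
        have b: "sign (\<tau> \<circ> ?t) = - sign \<tau>"
          using sign_compose_permutes[OF tau t finite_lessThan] False by (simp add: sign_swap_id)
        have c: "(\<tau> \<circ> ?t) l = \<tau> j" "(\<tau> \<circ> ?t) j = \<tau> l" by simp_all
        show "of_int (sign (\<tau> \<circ> ?t)) * (\<alpha> j [Zs ! (\<tau> \<circ> ?t) l] p * ?r (\<tau> \<circ> ?t) l)
            = - (of_int (sign \<tau>) * (\<alpha> j [Zs ! \<tau> l] p * ?r \<tau> l))"
          unfolding r a b c by simp
      qed
      then show ?thesis using False by simp
    qed
  qed
  also have "\<dots> = diverg Z p * \<mu> Zs p"
    by (simp add: diverg_def sum_fun_apply sum_distrib_right)
  finally show ?thesis .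
qed

text \<open>
  Cartan's formula reduces to the Lie derivative, as the contraction of \<open>\<mu>\<close> with a tangent field is zero.
\<close>

lemma ext_mu:
  assumes Z: "Z \<in> T" and Zs: "Zs \<in> L k"
  shows "ext_deriv \<A> k \<mu> (Z # Zs) p = diverg Z p * \<mu> Zs p"
proof (cases k)
  case 0
  have "diverg Z = 0" unfolding diverg_def using 0 by simp
  moreover have "\<mu> [] = 1" using 0 by (intro ext) simp
  then have "ext_deriv \<A> k \<mu> [Z] = 0"
    using ext_deriv_function[OF T_vf[OF Z], of \<mu>] vf_one[OF T_vf[OF Z]] 0 by simp
  moreover have "Zs = []" using Zs 0 by (simp add: L_0)
  ultimately show ?thesis by simp
next
  case (Suc n)
  have "contract Z \<mu> = 0"
  proof
    fix Us
    show "contract Z \<mu> Us = 0 Us"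
      using mu_tangent[of "Z # Us" 0] form_off[OF mu_form, of "Z # Us"] Z Suc
      by (cases "Z # Us \<in> L k") (auto simp: contract_def)
  qed
  then show ?thesis
    using cartan_formula[of \<mu> n Z Zs p] mu_form T_vf[OF Z] Zs lie_mu[OF Z Zs, of p] Suc
    by (simp add: ext_zero)
qed

text \<open>
  If the divergence vanishes, then \<open>d\<mu>\<close> vanishes as soon as one argument is tangent, and its degree
  \<open>k + 1\<close> exceeds the number of dual fields.
\<close>

lemma mu_closed_iff: "ext_deriv \<A> k \<mu> = 0 \<longleftrightarrow> (\<forall>Z\<in>T. diverg Z = 0)"
proof
  assume closed: "ext_deriv \<A> k \<mu> = 0"
  show "\<forall>Z\<in>T. diverg Z = 0"
  proof (intro ballI ext)
    fix Z p assume "Z \<in> T"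
    moreover have "map X [0..<k] \<in> L k" by (intro L_map dual_vf)
    ultimately show "diverg Z p = 0 p"
      using ext_mu[of Z "map X [0..<k]" p] closed by (simp add: mu_dual)
  qed
next
  assume div: "\<forall>Z\<in>T. diverg Z = 0"
  note d = ext_form[OF mu_form]
  have head: "ext_deriv \<A> k \<mu> (Z # Zs) = 0" if "Z \<in> T" "Zs \<in> L k" for Z Zs
    by (rule ext) (simp add: ext_mu[OF that] div that)
  show "ext_deriv \<A> k \<mu> = 0"
  proof (rule transverse_form_zero[OF d])
    fix Zs m assume Zs: "Zs \<in> L (Suc k)" and m: "m < Suc k" "Zs ! m \<in> T"
    show "ext_deriv \<A> k \<mu> Zs = 0"
    proof (cases "m = 0")
      case True
      then show ?thesis using Zs m head by (elim L_Suc_cases) auto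
    next
      case False
      let ?Ws = "Zs[0 := Zs ! m, m := Zs ! 0]"
      have "?Ws \<in> L (Suc k)" by (intro L_update Zs L_nth[OF Zs]) (use m in auto)
      moreover have "?Ws ! 0 \<in> T" using m Zs False by (simp add: L_iff)
      ultimately have "ext_deriv \<A> k \<mu> ?Ws = 0" using head by (elim L_Suc_cases) auto
      then show ?thesis using form_swap[OF d Zs, of 0 m] False m by simp
    qed
  qed simp
qed

text \<open>
  The Bott connection is flat along the leaves, by the Jacobi identity. Taking traces in the
  curvature equation removes the commutator term and leaves closedness of the divergence.
\<close>

lemma diverg_closed:
  assumes Y: "Y \<in> T" and Z: "Z \<in> T"
  shows "diverg (lie_bracket Y Z) = Y (diverg Z) - Z (diverg Y)"
proof
  fix p
  note YV = T_vf[OF Y] and ZV = T_vf[OF Z]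
  let ?a = "\<lambda>W i j. \<alpha> j [lie_bracket (X i) W]"
  have bott: "\<alpha> l [lie_bracket U W] p = (\<Sum>j<k. \<alpha> j [U] p * ?a W j l p) - W (\<alpha> l [U]) p"
    if "W \<in> T" "l < k" "U \<in> V" for W l U
  proof -
    have "\<alpha> l [lie_bracket W U] = - \<alpha> l [lie_bracket U W]"
      unfolding bracket_swap[of W]
      by (rule one_form(4)[OF coframe[OF that(2)] vf_closed_bracket[OF that(3) T_vf[OF that(1)]]])
    then show ?thesis
      using lie_coframe[OF that, of p] lie_one_form[OF T_vf[OF that(1)] that(3), of "\<alpha> l" p] by simp
  qed
  have i: "?a (lie_bracket Y Z) i i p = (\<Sum>j<k. ?a Y i j p * ?a Z j i p) - Z (?a Y i i) p
      - ((\<Sum>j<k. ?a Z i j p * ?a Y j i p) - Y (?a Z i i) p)" if i: "i < k" for i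
  proof -
    note Xi = dual_vf[OF i]
    note B = vf_closed_bracket[OF Xi YV] vf_closed_bracket[OF Xi ZV]
    have "\<alpha> i [lie_bracket (X i) (lie_bracket Y Z)]
        = \<alpha> i [lie_bracket (lie_bracket (X i) Y) Z] - \<alpha> i [lie_bracket (lie_bracket (X i) Z) Y]"
      unfolding bracket_jacobi[OF Xi YV ZV] bracket_swap[of Y "lie_bracket (X i) Z"]
      using one_form(2)[OF coframe[OF i] vf_closed_bracket[OF B(1) ZV]
          vf_closed_uminus[OF vf_closed_bracket[OF B(2) YV]]]
        one_form(4)[OF coframe[OF i] vf_closed_bracket[OF B(2) YV]] by simp
    then show ?thesis using bott[OF Z i B(1)] bott[OF Y i B(2)] by simp
  qed
  have sm: "?a W i i \<in> S" if "W \<in> V" "i \<in> {..<k}" for W i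
    using that by (intro one_form(1)[OF coframe] vf_closed_bracket dual_vf) auto
  have "diverg (lie_bracket Y Z) p = (\<Sum>i<k. \<Sum>j<k. ?a Y i j p * ?a Z j i p) - (\<Sum>i<k. Z (?a Y i i) p)
      - ((\<Sum>i<k. \<Sum>j<k. ?a Z i j p * ?a Y j i p) - (\<Sum>i<k. Y (?a Z i i) p))"
    by (simp add: diverg_def sum_fun_apply i sum_subtractf)
  also have "(\<Sum>i<k. \<Sum>j<k. ?a Z i j p * ?a Y j i p) = (\<Sum>i<k. \<Sum>j<k. ?a Y i j p * ?a Z j i p)"
    by (subst sum.swap) (simp add: mult.commute)
  also have "(\<Sum>i<k. Z (?a Y i i) p) = Z (diverg Y) p"
    unfolding diverg_def by (subst vf_sum[OF ZV sm[OF YV]]) (simp_all add: sum_fun_apply)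
  also have "(\<Sum>i<k. Y (?a Z i i) p) = Y (diverg Z) p"
    unfolding diverg_def by (subst vf_sum[OF YV sm[OF ZV]]) (simp_all add: sum_fun_apply)
  finally show "diverg (lie_bracket Y Z) p = (Y (diverg Z) - Z (diverg Y)) p" by simp
qed

text \<open>
  Two coframes with the same kernel have proportional volume forms, \<open>\<mu>' = D \<mu>\<close>, and the divergence
  changes by the logarithmic derivative of \<open>D\<close>. As \<open>D\<close> may be negative, its square is used.
\<close>

lemma diverg_change:
  assumes "foliated_coframe \<A> k \<alpha>' X'" and T': "coframe.T \<A> k \<alpha>' = T"
  obtains f where "f \<in> S" "\<And>Z. Z \<in> T \<Longrightarrow> foliated_coframe.diverg k \<alpha>' X' Z = diverg Z + Z f"
proof -
  interpret B: foliated_coframe \<A> k \<alpha>' X' by fact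
  define D where "D = B.\<mu> (map X [0..<k])"
  have Xs: "map X [0..<k] \<in> L k" by (intro L_map dual_vf)
  have D: "D \<in> S" unfolding D_def by (rule form_smooth[OF B.mu_form Xs])
  have ratio: "B.\<mu> = (\<lambda>Zs. D * \<mu> Zs)"
  proof -
    have "B.\<mu> - (\<lambda>Zs. D * \<mu> Zs) = 0"
    proof (rule transverse_form_zero[where n=k])
      show "B.\<mu> - (\<lambda>Zs. D * \<mu> Zs) \<in> \<Omega> k"
        by (intro form_closed_diff B.mu_form form_closed_smult D mu_form)
      show "(B.\<mu> - (\<lambda>Zs. D * \<mu> Zs)) Zs = 0" if "Zs \<in> L k" "m < k" "Zs ! m \<in> T" for Zs m
        using mu_tangent[OF that] B.mu_tangent[OF that(1,2)] that(3) T' by simp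
      have "(B.\<mu> - (\<lambda>Zs. D * \<mu> Zs)) (map X [0..<k]) = 0"
        by (rule ext) (simp add: mu_dual D_def)
      then show "k < k \<or> k = k \<and> (B.\<mu> - (\<lambda>Zs. D * \<mu> Zs)) (map X [0..<k]) = 0" by simp
    qed
    then show ?thesis by (metis eq_iff_diff_eq_0)
  qed
  have D_nz: "D p \<noteq> 0" for p
    using B.mu_dual[of p] unfolding ratio by auto
  have ZD: "Z D p = D p * (B.diverg Z p - diverg Z p)" if Z: "Z \<in> T" for Z p
  proof -
    note ZV = T_vf[OF Z]
    let ?Xs = "map X [0..<k]"
    have "B.diverg Z p * (D p * \<mu> ?Xs p) = lie_derivative \<A> k Z B.\<mu> ?Xs p"
      using B.lie_mu[OF _ Xs, of Z p] Z T' by (simp add: ratio)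
    also have "\<dots> = Z (D * \<mu> ?Xs) p - D p * (\<Sum>i<k. \<mu> (?Xs[i := lie_bracket Z (?Xs ! i)]) p)"
      by (simp add: lie_apply[OF Xs] ratio sum_distrib_left)
    also have "Z (D * \<mu> ?Xs) p = D p * Z (\<mu> ?Xs) p + Z D p * \<mu> ?Xs p"
      by (simp add: vf_mult[OF ZV D form_smooth[OF mu_form Xs]] mult.commute)
    also have "D p * Z (\<mu> ?Xs) p + Z D p * \<mu> ?Xs p - D p * (\<Sum>i<k. \<mu> (?Xs[i := lie_bracket Z (?Xs ! i)]) p)
        = D p * lie_derivative \<A> k Z \<mu> ?Xs p + Z D p * \<mu> ?Xs p"
      by (simp add: lie_apply[OF Xs] right_diff_distrib)
    finally show ?thesis by (simp add: lie_mu[OF Z Xs] mu_dual algebra_simps)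
  qed
  have D2_pos: "0 < D p * D p" for p
    using D_nz[of p] by (auto simp: zero_less_mult_iff linorder_neq_iff)
  define g where "g p = ln ((D * D) p)" for p
  have g: "g \<in> S" unfolding g_def
    by (rule smooth_compose[OF smooth_mult[OF D D] Ck_on_ln]) (use D2_pos in auto)
  have exp_g: "(\<lambda>p. exp (g p)) = D * D"
    using D2_pos by (intro ext) (simp add: g_def)
  show thesis
  proof
    show "(\<lambda>p. 1 / 2 * g p) \<in> S" by (rule smooth_cmult[OF g])
    show "B.diverg Z = diverg Z + Z (\<lambda>p. 1 / 2 * g p)" if Z: "Z \<in> T" for Z
    proof
      fix p
      note ZV = T_vf[OF Z]
      have "Z (D * D) p = (D p * D p) * Z g p"
        using vf_exp(2)[OF ZV g] unfolding exp_g by simp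
      moreover have "Z (D * D) p = (D p * D p) * (2 * (B.diverg Z p - diverg Z p))"
        by (simp add: vf_mult[OF ZV D D] ZD[OF Z])
      ultimately have "Z g p = 2 * (B.diverg Z p - diverg Z p)" using D_nz[of p] by simp
      then show "B.diverg Z p = (diverg Z + Z (\<lambda>p. 1 / 2 * g p)) p"
        unfolding plus_fun_apply vf_cmult[OF ZV g, of "1 / 2"] by (simp add: field_simps)
    qed
  qed
qed

text \<open>Conversely, scaling one of the forms by \<open>e\<^sup>h\<close> shifts the divergence by the differential of \<open>h\<close>.\<close>

lemma diverg_rescale:
  assumes h: "h \<in> S" and k: "0 < k"
  defines "\<alpha>' \<equiv> \<alpha>(0 := (\<lambda>Ys. (\<lambda>p. exp (h p)) * \<alpha> 0 Ys))"
    and "X' \<equiv> X(0 := fun_smult (\<lambda>p. exp (- h p)) (X 0))"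
  shows "foliated_coframe \<A> k \<alpha>' X'"
    and "\<And>Z. Z \<in> T \<Longrightarrow> foliated_coframe.diverg k \<alpha>' X' Z = diverg Z + Z h"
proof -
  let ?e = "\<lambda>p. exp (h p)" and ?e' = "\<lambda>p. exp (- h p)"
  have e: "?e \<in> S" using smooth_compose[OF h Ck_on_exp] by simp
  have e': "?e' \<in> S" using smooth_compose[OF smooth_uminus[OF h] Ck_on_exp] by simp
  have a': "\<alpha>' i \<in> \<Omega> 1" if "i < k" for i
    using that by (auto simp: \<alpha>'_def coframe intro!: form_closed_smult e simp del: One_nat_def)
  have X': "X' j \<in> V" if "j < k" for j
    using that by (auto simp: X'_def dual_vf intro!: vf_closed_smult e')
  have dual': "dual_fields \<A> k \<alpha>' X'"
    unfolding dual_fields_def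
  proof (intro conjI allI impI X')
    fix i j p assume i: "i < k" and j: "j < k"
    have "\<alpha> i [X' j] p = (if j = 0 then exp (- h p) else 1) * \<alpha> i [X j] p"
      using one_form(5)[OF coframe[OF i] dual_vf[OF j] e'] by (auto simp: X'_def)
    moreover have "\<alpha>' i [X' j] p = (if i = 0 then exp (h p) else 1) * \<alpha> i [X' j] p"
      by (simp add: \<alpha>'_def)
    ultimately show "\<alpha>' i [X' j] p = (if i = j then 1 else 0)"
      by (simp add: dual_eval i j exp_minus)
  qed
  interpret B: coframe \<A> k \<alpha>' X' by unfold_locales (use a' dual' in auto)
  have ker: "\<alpha>' i [Y] p = 0 \<longleftrightarrow> \<alpha> i [Y] p = 0" for i Y p
    by (simp add: \<alpha>'_def)
  then have T': "B.T = T" by (simp add: B.T_def T_def fun_eq_iff)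
  show fc: "foliated_coframe \<A> k \<alpha>' X'"
  proof unfold_locales
    fix i assume i: "i < k"
    have d: "ext_deriv \<A> 1 (\<alpha>' i) \<in> \<Omega> 2"
      using ext_form[OF a'[OF i]] by (simp add: numeral_2_eq_2)
    have "ext_deriv \<A> 1 (\<alpha>' i) Ys = 0" if Ys: "Ys \<in> L 2" "set Ys \<subseteq> B.T" for Ys
    proof -
      obtain Y Z where YZ: "Ys = [Y, Z]" using Ys(1) by (auto simp: L_iff length_Suc_conv numeral_2_eq_2)
      then have YT: "Y \<in> T" and ZT: "Z \<in> T" using Ys(2) T' by auto
      have z: "\<alpha>' i [W] = 0" if "W \<in> T" for W
        by (rule ext) (simp add: ker T_eval[OF that i])
      show ?thesis
        unfolding YZ ext_deriv_one_form[OF T_vf[OF YT] T_vf[OF ZT]] z[OF YT] z[OF ZT]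
          z[OF T_bracket[OF YT ZT]] vf_zero_arg[OF T_vf[OF YT]] vf_zero_arg[OF T_vf[OF ZT]] by simp
    qed
    then show "wedge 2 k (ext_deriv \<A> 1 (\<alpha>' i)) B.\<mu> = 0"
      unfolding B.wedge_mu_zero_iff[OF d] by blast
  qed
  interpret B: foliated_coframe \<A> k \<alpha>' X' by fact
  show "B.diverg Z = diverg Z + Z h" if Z: "Z \<in> T" for Z
  proof
    fix p
    note ZV = T_vf[OF Z]
    have first: "\<alpha>' 0 [lie_bracket (X' 0) Z] p = \<alpha> 0 [lie_bracket (X 0) Z] p + Z h p"
    proof -
      note a0 = coframe[OF k] and X0 = dual_vf[OF k]
      note br = vf_closed_bracket[OF X0 ZV]
      have Ze: "Z ?e' = ?e' * - Z h"
        using vf_exp(2)[OF ZV smooth_uminus[OF h]] vf_uminus[OF ZV h] by simp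
      then have ZeS: "Z ?e' \<in> S" using vf_smooth[OF ZV e'] by simp
      have "\<alpha> 0 [lie_bracket (X' 0) Z]
          = ?e' * \<alpha> 0 [lie_bracket (X 0) Z] - Z ?e' * \<alpha> 0 [X 0]"
        using one_form(3)[OF a0 vf_closed_smult[OF br e'] vf_closed_smult[OF X0 ZeS]]
          one_form(5)[OF a0 br e'] one_form(5)[OF a0 X0 ZeS]
        by (simp add: X'_def bracket_smult_left[OF X0 ZV e'])
      then have "\<alpha> 0 [lie_bracket (X' 0) Z] p = exp (- h p) * (\<alpha> 0 [lie_bracket (X 0) Z] p + Z h p)"
        unfolding Ze by (simp add: dual_eval k algebra_simps)
      then show ?thesis by (simp add: \<alpha>'_def exp_minus)
    qed
    have rest: "\<alpha>' i [lie_bracket (X' i) Z] p = \<alpha> i [lie_bracket (X i) Z] p" if "i \<in> {..<k} - {0}" for i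
      using that by (simp add: \<alpha>'_def X'_def)
    have split: "(\<Sum>i<k. t i) = t 0 + (\<Sum>i\<in>{..<k} - {0}. t i)" for t :: "nat \<Rightarrow> real"
      using k by (subst sum.remove[of _ 0]) auto
    show "B.diverg Z p = (diverg Z + Z h) p"
      by (simp add: B.diverg_def diverg_def sum_fun_apply split first rest)
  qed
qed

end


section \<open>Foliated cohomology\<close>

definition (in smooth_atlas) leaf_fields :: "('a, 'e) foliation_data \<Rightarrow> 'a vfield set" where
  "leaf_fields \<F> = {Y \<in> V. \<forall>p. value_at Y p \<in> leaf_tangent_space \<A> \<F> p}"

lemma (in smooth_atlas) generates_foliated_coframe:
  assumes g: "generates \<A> k \<alpha> \<F>" and d: "dual_fields \<A> k \<alpha> X"
  shows "foliated_coframe \<A> k \<alpha> X" and "coframe.T \<A> k \<alpha> = leaf_fields \<F>"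
proof -
  have gen: "\<And>i. i < k \<Longrightarrow> \<alpha> i \<in> \<Omega> 1"
    "\<And>i. i < k \<Longrightarrow> wedge 2 k (ext_deriv \<A> 1 (\<alpha> i)) (wedge_list k \<alpha>) = 0"
    using g by (auto simp: generates_def generators_def)
  show "foliated_coframe \<A> k \<alpha> X" by unfold_locales (use gen d in auto)
  then interpret foliated_coframe \<A> k \<alpha> X .
  have "value_at Y p \<in> leaf_tangent_space \<A> \<F> p \<longleftrightarrow> (\<forall>i<k. \<alpha> i [Y] p = 0)" if "Y \<in> V" for Y p
    using g that by (auto simp: generates_def)
  then show "T = leaf_fields \<F>" by (auto simp: T_def leaf_fields_def fun_eq_iff)
qed

lemma (in smooth_atlas) generates_dual_fields:
  assumes "generates \<A> k \<alpha> \<F>"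
  shows "\<exists>X. dual_fields \<A> k \<alpha> X"
proof (rule dual_fields_exist)
  show "\<alpha> i \<in> \<Omega> 1" if "i < k" for i
    using assms that by (auto simp: generates_def generators_def)
  show "\<forall>i<k. c i = 0" if "\<forall>X\<in>V. (\<Sum>i<k. c i * \<alpha> i [X] p) = 0" for p and c :: "nat \<Rightarrow> real"
    using assms that unfolding generates_def generators_def by blast
qed

text \<open>A coframe with the right kernel generates: dual fields witness linear independence.\<close>

lemma (in foliated_coframe) generatesI:
  assumes "\<And>Y p. Y \<in> V \<Longrightarrow>
    value_at Y p \<in> leaf_tangent_space \<A> \<F> p \<longleftrightarrow> (\<forall>i<k. \<alpha> i [Y] p = 0)"
  shows "generates \<A> k \<alpha> \<F>"
proof -
  have "c j = 0" if c: "\<forall>Y\<in>V. (\<Sum>i<k. c i * \<alpha> i [Y] p) = 0" and j: "j < k"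
    for p and c :: "nat \<Rightarrow> real" and j
  proof -
    have "0 = (\<Sum>i<k. c i * \<alpha> i [X j] p)" using c dual_vf[OF j] by simp
    also have "\<dots> = (\<Sum>i<k. if i = j then c j else 0)"
      by (intro sum.cong refl) (use j in \<open>auto simp: dual_eval\<close>)
    finally show ?thesis using j by simp
  qed
  then show ?thesis
    using assms coframe integrable unfolding generates_def generators_def by blast
qed

locale generated_foliation = smooth_atlas \<A>
  for \<A> :: "('a::{t2_space, second_countable_topology}, 'e::euclidean_space) chart set" +
  fixes k :: nat and \<F> :: "('a, 'e) foliation_data"
  assumes generated: "\<exists>\<alpha>. generates \<A> k \<alpha> \<F>"
begin

abbreviation "TF \<equiv> leaf_fields \<F>"

text \<open>A form represents zero in the foliated complex iff it vanishes on tangent fields.\<close>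

definition null_on_leaves :: "nat \<Rightarrow> 'a form \<Rightarrow> bool" where
  "null_on_leaves s \<beta> \<longleftrightarrow> (\<forall>Ys\<in>L s. set Ys \<subseteq> TF \<longrightarrow> \<beta> Ys = 0)"

lemma null_add: "null_on_leaves s \<beta> \<Longrightarrow> null_on_leaves s \<rho> \<Longrightarrow> null_on_leaves s (\<beta> + \<rho>)"
  by (simp add: null_on_leaves_def)

lemma null_diff: "null_on_leaves s \<beta> \<Longrightarrow> null_on_leaves s \<rho> \<Longrightarrow> null_on_leaves s (\<beta> - \<rho>)"
  by (simp add: null_on_leaves_def)

lemma null_zero: "null_on_leaves s 0"
  by (simp add: null_on_leaves_def)

lemma null_diff_swap: "null_on_leaves s (\<beta> - \<rho>) \<Longrightarrow> null_on_leaves s (\<rho> - \<beta>)"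
  by (simp add: null_on_leaves_def)

text \<open>
  For each set of generators the wedge condition is restriction to the tangent fields, and these depend
  on the foliation only.
\<close>

lemma fol_equiv_iff:
  "(\<beta>, \<rho>) \<in> fol_equiv \<A> k \<F> s \<longleftrightarrow> \<beta> \<in> \<Omega> s \<and> \<rho> \<in> \<Omega> s \<and> null_on_leaves s (\<beta> - \<rho>)"
proof -
  have "wedge s k (\<beta> - \<rho>) (wedge_list k \<alpha>) = 0 \<longleftrightarrow> null_on_leaves s (\<beta> - \<rho>)"
    if g: "generates \<A> k \<alpha> \<F>" and f: "\<beta> \<in> \<Omega> s" "\<rho> \<in> \<Omega> s" for \<alpha>
  proof -
    obtain X where X: "dual_fields \<A> k \<alpha> X" using generates_dual_fields[OF g] by blast
    interpret C: foliated_coframe \<A> k \<alpha> X by (rule generates_foliated_coframe[OF g X])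
    show ?thesis
      using C.wedge_mu_zero_iff[OF form_closed_diff[OF f]] generates_foliated_coframe(2)[OF g X]
      by (simp add: null_on_leaves_def)
  qed
  then show ?thesis using generated unfolding fol_equiv_def by blast
qed

lemma TF_bracket: "Y \<in> TF \<Longrightarrow> Z \<in> TF \<Longrightarrow> lie_bracket Y Z \<in> TF"
proof -
  assume YZ: "Y \<in> TF" "Z \<in> TF"
  obtain \<alpha> X where g: "generates \<A> k \<alpha> \<F>" and X: "dual_fields \<A> k \<alpha> X"
    using generated generates_dual_fields by blast
  interpret C: foliated_coframe \<A> k \<alpha> X by (rule generates_foliated_coframe[OF g X])
  show ?thesis using C.T_bracket YZ unfolding generates_foliated_coframe(2)[OF g X] by blast
qed

lemma TF_vf: "Y \<in> TF \<Longrightarrow> Y \<in> V"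
  by (simp add: leaf_fields_def)

text \<open>By involutivity, the exterior derivative is defined along the leaves.\<close>

lemma null_ext:
  assumes "null_on_leaves s \<beta>"
  shows "null_on_leaves (Suc s) (ext_deriv \<A> s \<beta>)"
  unfolding null_on_leaves_def
proof (intro ballI impI ext)
  fix Ys p assume Ys: "Ys \<in> L (Suc s)" and T: "set Ys \<subseteq> TF"
  have nth: "Ys ! i \<in> TF" if "i \<le> s" for i using Ys T that by (auto simp: L_iff)
  have 1: "\<beta> (nths Ys (- {i})) = 0" if "i \<le> s" for i
    using assms L_delete[OF Ys that] T set_nths_subset[of Ys]
    unfolding null_on_leaves_def by blast
  have 2: "\<beta> (lie_bracket (Ys ! i) (Ys ! j) # nths Ys (- {i, j})) = 0" if "i < j" "j \<le> s" for i j
  proof -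
    have b: "lie_bracket (Ys ! i) (Ys ! j) \<in> TF" by (intro TF_bracket nth) (use that in auto)
    have "s \<noteq> 0" using that by auto
    then obtain m where m: "s = Suc m" by (cases s) auto
    then have "lie_bracket (Ys ! i) (Ys ! j) # nths Ys (- {i, j}) \<in> L s"
      using L_delete2[of Ys m i j] Ys that TF_vf[OF b] by (simp add: L_Cons)
    moreover have "set (lie_bracket (Ys ! i) (Ys ! j) # nths Ys (- {i, j})) \<subseteq> TF"
      using b T set_nths_subset[of Ys] by auto
    ultimately show ?thesis using assms unfolding null_on_leaves_def by blast
  qed
  have "(\<Sum>i\<le>s. (- 1) ^ i * (Ys ! i) (\<beta> (nths Ys (- {i}))) p) = 0"
    by (intro sum.neutral) (auto simp: 1 vf_zero_arg[OF TF_vf[OF nth]])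
  moreover have "(\<Sum>j\<le>s. \<Sum>i<j. (- 1) ^ (i + j)
      * \<beta> (lie_bracket (Ys ! i) (Ys ! j) # nths Ys (- {i, j})) p) = 0"
    by (intro sum.neutral) (auto simp: 2)
  ultimately show "ext_deriv \<A> s \<beta> Ys p = 0 p" by (simp add: ext_apply[OF Ys])
qed

abbreviation "pr \<equiv> fol_proj \<A> k \<F>"

lemma in_pr: "\<rho> \<in> pr s \<beta> \<longleftrightarrow> \<beta> \<in> \<Omega> s \<and> \<rho> \<in> \<Omega> s \<and> null_on_leaves s (\<beta> - \<rho>)"
  by (simp add: fol_proj_def fol_equiv_iff)

lemma pr_self: "\<beta> \<in> \<Omega> s \<Longrightarrow> \<beta> \<in> pr s \<beta>"
  by (simp add: in_pr null_zero)

lemma pr_eq_iff: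
  assumes "\<beta> \<in> \<Omega> s" "\<rho> \<in> \<Omega> s"
  shows "pr s \<beta> = pr s \<rho> \<longleftrightarrow> null_on_leaves s (\<beta> - \<rho>)"
proof
  assume "pr s \<beta> = pr s \<rho>"
  then have "\<rho> \<in> pr s \<beta>" using pr_self[OF assms(2)] by simp
  then show "null_on_leaves s (\<beta> - \<rho>)" by (simp add: in_pr)
next
  assume n: "null_on_leaves s (\<beta> - \<rho>)"
  have "null_on_leaves s (\<beta> - \<eta>) \<longleftrightarrow> null_on_leaves s (\<rho> - \<eta>)" for \<eta>
    using null_diff[OF _ n, of "\<beta> - \<eta>"] null_add[OF n, of "\<rho> - \<eta>"] by auto
  then show "pr s \<beta> = pr s \<rho>" using assms by (auto simp: in_pr)
qed

lemma fol_forms_eq: "fol_forms \<A> k \<F> s = pr s ` \<Omega> s"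
  by (auto simp: fol_forms_def quotient_def fol_proj_def)

lemma fol_diff_pr:
  assumes "\<beta> \<in> \<Omega> s" "\<rho> \<in> \<Omega> s"
  shows "fol_diff \<A> k \<F> s (pr s \<beta>) (pr s \<rho>) = pr s (\<beta> - \<rho>)"
proof -
  have "pr s (\<beta>' - \<rho>') = pr s (\<beta> - \<rho>)" if b: "\<beta>' \<in> pr s \<beta>" and r: "\<rho>' \<in> pr s \<rho>" for \<beta>' \<rho>'
  proof -
    have "null_on_leaves s ((\<rho> - \<rho>') - (\<beta> - \<beta>'))" using b r by (intro null_diff[of s "\<rho> - \<rho>'" "\<beta> - \<beta>'"]) (simp_all add: in_pr)
    moreover have "(\<rho> - \<rho>') - (\<beta> - \<beta>') = (\<beta>' - \<rho>') - (\<beta> - \<rho>)" by (simp add: algebra_simps)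
    moreover have "\<beta>' - \<rho>' \<in> \<Omega> s" "\<beta> - \<rho> \<in> \<Omega> s"
      using b r assms by (auto simp only: in_pr intro!: form_closed_diff)
    ultimately show ?thesis by (simp only: pr_eq_iff)
  qed
  then show ?thesis using pr_self[OF assms(1)] pr_self[OF assms(2)] unfolding fol_diff_def by blast
qed

lemma fol_deriv_pr:
  assumes "\<beta> \<in> \<Omega> s"
  shows "fol_deriv \<A> k \<F> s (pr s \<beta>) = pr (Suc s) (ext_deriv \<A> s \<beta>)"
proof -
  have "pr (Suc s) (ext_deriv \<A> s \<beta>') = pr (Suc s) (ext_deriv \<A> s \<beta>)" if "\<beta>' \<in> pr s \<beta>" for \<beta>'
  proof -
    have b: "\<beta>' \<in> \<Omega> s" and n: "null_on_leaves s (\<beta>' - \<beta>)"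
      using that by (auto simp: in_pr intro: null_diff_swap)
    show ?thesis
      using null_ext[OF n] unfolding ext_diff[OF b assms]
      by (simp add: pr_eq_iff ext_form b assms)
  qed
  then show ?thesis using pr_self[OF assms] unfolding fol_deriv_def by blast
qed

lemma pr_cocycle_iff:
  assumes "\<beta> \<in> \<Omega> s"
  shows "pr s \<beta> \<in> fol_cocycles \<A> k \<F> s \<longleftrightarrow> null_on_leaves (Suc s) (ext_deriv \<A> s \<beta>)"
proof -
  have "pr s \<beta> \<in> fol_forms \<A> k \<F> s" using assms by (simp add: fol_forms_eq)
  then show ?thesis
    using pr_eq_iff[OF ext_form[OF assms] form_closed_zero]
    by (simp add: fol_cocycles_def fol_deriv_pr[OF assms])
qed

lemma function_form: "f \<in> S \<Longrightarrow> (\<lambda>Xs. if Xs = [] then f else 0) \<in> \<Omega> 0"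
  by (rule formI) (auto simp: L_0)

text \<open>
  Forms of degree zero are smooth functions, and \<open>df(Z) = Z(f)\<close>.
\<close>

lemma coboundary_iff:
  assumes b: "\<beta> \<in> \<Omega> 1"
  shows "pr 1 \<beta> \<in> fol_coboundaries \<A> k \<F> 1 \<longleftrightarrow> (\<exists>f\<in>S. \<forall>Z\<in>TF. \<beta> [Z] = Z f)"
proof -
  have e: "ext_deriv \<A> 0 u \<in> \<Omega> 1" if "u \<in> \<Omega> 0" for u using ext_form[OF that] by simp
  have n: "null_on_leaves 1 (\<beta> - ext_deriv \<A> 0 u) \<longleftrightarrow> (\<forall>Z\<in>TF. \<beta> [Z] = Z (u []))" for u
  proof -
    have "null_on_leaves 1 (\<beta> - ext_deriv \<A> 0 u) \<longleftrightarrow> (\<forall>Z\<in>TF. \<beta> [Z] - ext_deriv \<A> 0 u [Z] = 0)"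
    proof
      assume n: "null_on_leaves 1 (\<beta> - ext_deriv \<A> 0 u)"
      show "\<forall>Z\<in>TF. \<beta> [Z] - ext_deriv \<A> 0 u [Z] = 0"
      proof
        fix Z assume Z: "Z \<in> TF"
        then have "[Z] \<in> L 1" "set [Z] \<subseteq> TF" using TF_vf by (auto simp only: L_1 set_simps)
        then show "\<beta> [Z] - ext_deriv \<A> 0 u [Z] = 0" using n unfolding null_on_leaves_def by fastforce
      qed
    next
      assume *: "\<forall>Z\<in>TF. \<beta> [Z] - ext_deriv \<A> 0 u [Z] = 0"
      show "null_on_leaves 1 (\<beta> - ext_deriv \<A> 0 u)"
        unfolding null_on_leaves_def
      proof (intro ballI impI)
        fix Ys assume "Ys \<in> L 1" and T: "set Ys \<subseteq> TF"
        then obtain Z where "Ys = [Z]" unfolding L_1 by blast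
        then show "(\<beta> - ext_deriv \<A> 0 u) Ys = 0" using * T by simp
      qed
    qed
    then show ?thesis using TF_vf by (simp add: ext_deriv_function)
  qed
  have "fol_coboundaries \<A> k \<F> 1 = (\<lambda>u. pr 1 (ext_deriv \<A> 0 u)) ` \<Omega> 0"
    using fol_deriv_pr[of _ 0] by (auto simp: fol_forms_eq image_image)
  then have "pr 1 \<beta> \<in> fol_coboundaries \<A> k \<F> 1 \<longleftrightarrow> (\<exists>u\<in>\<Omega> 0. pr 1 \<beta> = pr 1 (ext_deriv \<A> 0 u))"
    by blast
  also have "\<dots> \<longleftrightarrow> (\<exists>u\<in>\<Omega> 0. \<forall>Z\<in>TF. \<beta> [Z] = Z (u []))"
    using pr_eq_iff[OF b e] n by blast
  also have "\<dots> \<longleftrightarrow> (\<exists>f\<in>S. \<forall>Z\<in>TF. \<beta> [Z] = Z f)"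
  proof
    assume "\<exists>u\<in>\<Omega> 0. \<forall>Z\<in>TF. \<beta> [Z] = Z (u [])"
    then show "\<exists>f\<in>S. \<forall>Z\<in>TF. \<beta> [Z] = Z f" using form_smooth[of _ 0 "[]"] by (auto simp: L_0)
  next
    assume "\<exists>f\<in>S. \<forall>Z\<in>TF. \<beta> [Z] = Z f"
    then obtain f where "f \<in> S" "\<forall>Z\<in>TF. \<beta> [Z] = Z f" by blast
    then show "\<exists>u\<in>\<Omega> 0. \<forall>Z\<in>TF. \<beta> [Z] = Z (u [])"
      using function_form by (intro bexI[of _ "\<lambda>Xs. if Xs = [] then f else 0"]) simp_all
  qed
  finally show ?thesis .
qed

lemma cohomologous_iff:
  assumes "\<beta> \<in> \<Omega> 1" "\<rho> \<in> \<Omega> 1"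
    "pr 1 \<beta> \<in> fol_cocycles \<A> k \<F> 1" "pr 1 \<rho> \<in> fol_cocycles \<A> k \<F> 1"
  shows "(pr 1 \<beta>, pr 1 \<rho>) \<in> cohomologous \<A> k \<F> 1 \<longleftrightarrow> (\<exists>f\<in>S. \<forall>Z\<in>TF. \<beta> [Z] - \<rho> [Z] = Z f)"
  using coboundary_iff[OF form_closed_diff[OF assms(1,2)]] assms(3,4)
  by (simp add: cohomologous_def fol_diff_pr[OF assms(1,2)]
      del: One_nat_def fol_coboundaries.simps)

lemma cohomologous_sub: "(a, b) \<in> cohomologous \<A> k \<F> s \<Longrightarrow> a \<in> fol_cocycles \<A> k \<F> s \<and> b \<in> fol_cocycles \<A> k \<F> s"
  by (auto simp: cohomologous_def)

lemma cohomologous_equiv: "equiv (fol_cocycles \<A> k \<F> 1) (cohomologous \<A> k \<F> 1)"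
proof (rule equivI)
  have rep: "\<exists>\<beta>\<in>\<Omega> 1. a = pr 1 \<beta>" if "a \<in> fol_cocycles \<A> k \<F> 1" for a
    using that unfolding fol_cocycles_def fol_forms_eq by blast
  show "cohomologous \<A> k \<F> 1 \<subseteq> fol_cocycles \<A> k \<F> 1 \<times> fol_cocycles \<A> k \<F> 1"
    using cohomologous_sub by auto
  show "refl_on (fol_cocycles \<A> k \<F> 1) (cohomologous \<A> k \<F> 1)"
  proof (rule refl_onI)
    fix a assume a: "a \<in> fol_cocycles \<A> k \<F> 1"
    obtain \<beta> where b: "\<beta> \<in> \<Omega> 1" "a = pr 1 \<beta>" using rep[OF a] by blast
    have "\<beta> [Z] - \<beta> [Z] = Z 0" if "Z \<in> TF" for Z
      using vf_zero_arg[OF TF_vf[OF that]] by simp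
    then show "(a, a) \<in> cohomologous \<A> k \<F> 1"
      using cohomologous_iff[OF b(1) b(1)] a b(2) smooth_zero by blast
  qed
  show "sym (cohomologous \<A> k \<F> 1)"
  proof (rule symI)
    fix a b assume ab: "(a, b) \<in> cohomologous \<A> k \<F> 1"
    note c = cohomologous_sub[OF ab]
    obtain \<beta> where b: "\<beta> \<in> \<Omega> 1" "a = pr 1 \<beta>" using rep c by blast
    obtain \<rho> where r: "\<rho> \<in> \<Omega> 1" "b = pr 1 \<rho>" using rep c by blast
    obtain f where f: "f \<in> S" "\<forall>Z\<in>TF. \<beta> [Z] - \<rho> [Z] = Z f"
      using ab c cohomologous_iff[OF b(1) r(1)] unfolding b(2) r(2) by blast
    have "\<rho> [Z] - \<beta> [Z] = Z (- f)" if "Z \<in> TF" for Z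
      using f(2) that vf_uminus[OF TF_vf[OF that] f(1)] minus_diff_eq[of "\<beta> [Z]" "\<rho> [Z]"] by metis
    then show "(b, a) \<in> cohomologous \<A> k \<F> 1"
      using cohomologous_iff[OF r(1) b(1)] c smooth_uminus[OF f(1)] unfolding b(2) r(2) by blast
  qed
  show "trans (cohomologous \<A> k \<F> 1)"
  proof (rule transI)
    fix a b d assume ab: "(a, b) \<in> cohomologous \<A> k \<F> 1" and bd: "(b, d) \<in> cohomologous \<A> k \<F> 1"
    note c = cohomologous_sub[OF ab] cohomologous_sub[OF bd]
    obtain \<beta> where b: "\<beta> \<in> \<Omega> 1" "a = pr 1 \<beta>" using rep c by blast
    obtain \<rho> where r: "\<rho> \<in> \<Omega> 1" "b = pr 1 \<rho>" using rep c by blast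
    obtain \<eta> where e: "\<eta> \<in> \<Omega> 1" "d = pr 1 \<eta>" using rep c by blast
    obtain f where f: "f \<in> S" "\<forall>Z\<in>TF. \<beta> [Z] - \<rho> [Z] = Z f"
      using ab c cohomologous_iff[OF b(1) r(1)] unfolding b(2) r(2) by blast
    obtain g where g: "g \<in> S" "\<forall>Z\<in>TF. \<rho> [Z] - \<eta> [Z] = Z g"
      using bd c cohomologous_iff[OF r(1) e(1)] unfolding e(2) r(2) by blast
    have "\<beta> [Z] - \<eta> [Z] = Z (f + g)" if "Z \<in> TF" for Z
    proof -
      have "Z (f + g) = (\<beta> [Z] - \<rho> [Z]) + (\<rho> [Z] - \<eta> [Z])"
        unfolding vf_add[OF TF_vf[OF that] f(1) g(1)] using f(2) g(2) that by simp
      then show ?thesis by simp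
    qed
    then show "(a, d) \<in> cohomologous \<A> k \<F> 1"
      using cohomologous_iff[OF b(1) e(1)] c smooth_add[OF f(1) g(1)] unfolding b(2) e(2) by blast
  qed
qed

lemma class_eq_iff:
  assumes "a \<in> fol_cocycles \<A> k \<F> 1" "b \<in> fol_cocycles \<A> k \<F> 1"
  shows "cohomology_class \<A> k \<F> 1 a = cohomology_class \<A> k \<F> 1 b \<longleftrightarrow> (a, b) \<in> cohomologous \<A> k \<F> 1"
  unfolding cohomology_class_def using eq_equiv_class_iff[OF cohomologous_equiv assms] .

section \<open>The obstruction class\<close>

lemma delta_cocycle:
  assumes g: "generates \<A> k \<alpha> \<F>" and X: "dual_fields \<A> k \<alpha> X"
  shows "pr 1 (delta_form \<A> k \<alpha> X) \<in> fol_cocycles \<A> k \<F> 1"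
proof -
  interpret C: foliated_coframe \<A> k \<alpha> X by (rule generates_foliated_coframe[OF g X])
  note T = generates_foliated_coframe(2)[OF g X]
  have "ext_deriv \<A> 1 C.\<delta> Ys = 0" if Ys: "Ys \<in> L 2" "set Ys \<subseteq> TF" for Ys
  proof -
    obtain Y Z where YZ: "Ys = [Y, Z]" using Ys(1) by (auto simp: L_iff length_Suc_conv numeral_2_eq_2)
    then have YT: "Y \<in> C.T" and ZT: "Z \<in> C.T" using Ys(2) T by auto
    show ?thesis
      unfolding YZ ext_deriv_one_form[OF C.T_vf[OF YT] C.T_vf[OF ZT]] C.delta_tangent[OF YT]
        C.delta_tangent[OF ZT] C.delta_tangent[OF C.T_bracket[OF YT ZT]] C.diverg_closed[OF YT ZT]
      by simp
  qed
  then have "null_on_leaves (Suc 1) (ext_deriv \<A> 1 C.\<delta>)"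
    by (simp add: null_on_leaves_def numeral_2_eq_2 del: One_nat_def)
  then show ?thesis using pr_cocycle_iff[OF C.delta_one_form] by simp
qed

text \<open>
  The two divergences differ by the differential of a function along the leaves.
\<close>

lemma delta_class_unique:
  assumes g: "generates \<A> k \<alpha> \<F>" "dual_fields \<A> k \<alpha> X"
    and g': "generates \<A> k \<alpha>' \<F>" "dual_fields \<A> k \<alpha>' X'"
  shows "cohomology_class \<A> k \<F> 1 (pr 1 (delta_form \<A> k \<alpha>' X'))
    = cohomology_class \<A> k \<F> 1 (pr 1 (delta_form \<A> k \<alpha> X))"
proof -
  interpret C: foliated_coframe \<A> k \<alpha> X by (rule generates_foliated_coframe[OF g])
  interpret C': foliated_coframe \<A> k \<alpha>' X' by (rule generates_foliated_coframe[OF g'])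
  note T = generates_foliated_coframe(2)[OF g] generates_foliated_coframe(2)[OF g']
  obtain f where f: "f \<in> S" "\<And>Z. Z \<in> C.T \<Longrightarrow> C'.diverg Z = C.diverg Z + Z f"
    using C.diverg_change[OF C'.foliated_coframe_axioms] T by metis
  have "C'.\<delta> [Z] - C.\<delta> [Z] = Z f" if "Z \<in> TF" for Z
    using that C.delta_tangent[of Z] C'.delta_tangent[of Z] f(2)[of Z] T by simp
  then show ?thesis
    using class_eq_iff[OF delta_cocycle[OF g'] delta_cocycle[OF g]]
      cohomologous_iff[OF C'.delta_one_form C.delta_one_form delta_cocycle[OF g'] delta_cocycle[OF g]]
      f(1) by blast
qed

text \<open>
  The definite description in the definition of the class is well posed, since all choices of generators
  and of dual fields give the same class.
\<close>

lemma obstruction_class_eq: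
  assumes g: "generates \<A> k \<alpha> \<F>" "dual_fields \<A> k \<alpha> X"
  shows "obstruction_class \<A> k \<F> = cohomology_class \<A> k \<F> 1 (pr 1 (delta_form \<A> k \<alpha> X))"
  unfolding obstruction_class_def
proof (rule the_equality)
  have "cohomology_class \<A> k \<F> 1 (pr 1 (delta_form \<A> k \<alpha> X)) \<in> fol_cohomology \<A> k \<F> 1"
    unfolding cohomology_class_def fol_cohomology_def by (rule quotientI[OF delta_cocycle[OF g]])
  then show "cohomology_class \<A> k \<F> 1 (pr 1 (delta_form \<A> k \<alpha> X)) \<in> fol_cohomology \<A> k \<F> 1 \<and>
      (\<exists>\<alpha>' X'. generates \<A> k \<alpha>' \<F> \<and> dual_fields \<A> k \<alpha>' X' \<and>
        cohomology_class \<A> k \<F> 1 (pr 1 (delta_form \<A> k \<alpha> X))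
          = cohomology_class \<A> k \<F> 1 (pr 1 (delta_form \<A> k \<alpha>' X')))"
    using g by blast
qed (use delta_class_unique[OF g] in blast)

lemma obstruction_zero_iff:
  assumes g: "generates \<A> k \<alpha> \<F>" "dual_fields \<A> k \<alpha> X"
  shows "obstruction_class \<A> k \<F> = fol_zero_class \<A> k \<F> 1
    \<longleftrightarrow> (\<exists>f\<in>S. \<forall>Z\<in>TF. foliated_coframe.diverg k \<alpha> X Z = Z f)"
proof -
  interpret C: foliated_coframe \<A> k \<alpha> X by (rule generates_foliated_coframe[OF g])
  have z: "pr 1 0 \<in> fol_cocycles \<A> k \<F> 1"
    unfolding pr_cocycle_iff[OF form_closed_zero] ext_zero by (rule null_zero)
  show ?thesis
    unfolding obstruction_class_eq[OF g] fol_zero_class_def class_eq_iff[OF delta_cocycle[OF g] z]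
      cohomologous_iff[OF C.delta_one_form form_closed_zero delta_cocycle[OF g] z]
    using C.delta_tangent generates_foliated_coframe(2)[OF g] by simp
qed

end

theorem theorem7:
  fixes \<A> :: "('a::{t2_space, second_countable_topology}, 'e::euclidean_space) chart set"
    and \<F> :: "('a, 'e) foliation_data"
    and k :: nat
  assumes "smooth_manifold \<A>"
    and "foliation \<A> k \<F>"
    and "\<exists>\<alpha>. generates \<A> k \<alpha> \<F>"
  shows "obstruction_class \<A> k \<F> = fol_zero_class \<A> k \<F> 1 \<longleftrightarrow>
    (\<exists>\<alpha>. generates \<A> k \<alpha> \<F> \<and> ext_deriv \<A> k (wedge_list k \<alpha>) = 0)"
proof -
  interpret generated_foliation \<A> k \<F>
    by unfold_locales (use assms in auto)
  show ?thesis
  proof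
    assume zero: "obstruction_class \<A> k \<F> = fol_zero_class \<A> k \<F> 1"
    obtain \<alpha> X where g: "generates \<A> k \<alpha> \<F>" "dual_fields \<A> k \<alpha> X"
      using generated generates_dual_fields by blast
    interpret C: foliated_coframe \<A> k \<alpha> X by (rule generates_foliated_coframe[OF g])
    note T = generates_foliated_coframe(2)[OF g]
    obtain f where f: "f \<in> S" "\<And>Z. Z \<in> C.T \<Longrightarrow> C.diverg Z = Z f"
      using zero unfolding obstruction_zero_iff[OF g] T by blast
    show "\<exists>\<alpha>. generates \<A> k \<alpha> \<F> \<and> ext_deriv \<A> k (wedge_list k \<alpha>) = 0"
    proof (cases "k = 0")
      \<comment> \<open>There is no form to rescale, and the empty product \<open>\<mu> = 1\<close> is closed.\<close>
      case True
      then have "C.diverg Z = 0" for Z unfolding C.diverg_def by simp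
      then show ?thesis using C.mu_closed_iff g(1) by blast
    next
      case False
      then have k: "0 < k" by simp
      \<comment> \<open>The factor \<open>e\<^sup>-\<^sup>f\<close> cancels the divergence \<open>Z(f)\<close>.\<close>
      define \<alpha>' where "\<alpha>' = \<alpha>(0 := (\<lambda>Ys. (\<lambda>p. exp ((- f) p)) * \<alpha> 0 Ys))"
      define X' where "X' = X(0 := fun_smult (\<lambda>p. exp (- (- f) p)) (X 0))"
      note r = C.diverg_rescale[OF smooth_uminus[OF f(1)] k, folded \<alpha>'_def X'_def]
      interpret C': foliated_coframe \<A> k \<alpha>' X' by (rule r(1))
      have ker: "\<alpha>' i [Y] p = 0 \<longleftrightarrow> \<alpha> i [Y] p = 0" for i Y p by (simp add: \<alpha>'_def)
      have gen: "generates \<A> k \<alpha>' \<F>"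
        by (rule C'.generatesI) (use g(1) in \<open>simp add: ker generates_def\<close>)
      have "C'.diverg Z = 0" if "Z \<in> C'.T" for Z
      proof -
        have Z: "Z \<in> C.T" using that by (simp add: C.T_def C'.T_def fun_eq_iff ker)
        show ?thesis
          unfolding r(2)[OF Z] f(2)[OF Z] vf_uminus[OF C.T_vf[OF Z] f(1)] by simp
      qed
      then show ?thesis using C'.mu_closed_iff gen by blast
    qed
  next
    assume "\<exists>\<alpha>. generates \<A> k \<alpha> \<F> \<and> ext_deriv \<A> k (wedge_list k \<alpha>) = 0"
    then obtain \<alpha> where g: "generates \<A> k \<alpha> \<F>" and closed: "ext_deriv \<A> k (wedge_list k \<alpha>) = 0"
      by blast
    obtain X where X: "dual_fields \<A> k \<alpha> X" using generates_dual_fields[OF g] by blast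
    interpret C: foliated_coframe \<A> k \<alpha> X by (rule generates_foliated_coframe[OF g X])
    have "C.diverg Z = Z 0" if "Z \<in> TF" for Z
      using closed that C.mu_closed_iff generates_foliated_coframe(2)[OF g X]
        vf_zero_arg[OF TF_vf[OF that]] by simp
    then show "obstruction_class \<A> k \<F> = fol_zero_class \<A> k \<F> 1"
      unfolding obstruction_zero_iff[OF g X] using smooth_zero by blast
  qed
qed

end
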